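(* Let $(M^2,D,\Omega)$ be an equi-affine $2$-manifold and let $\gamma(t)$ $(|t|<\delta)$ be a $C^\infty$ curve in $M^2$ with a $3/2$-cusp at $t=0$. Let $s_A$ be its affine arclength parameter. Then $\tau=(s_A)^{3/5}$ can be taken to be a coordinate of $\gamma$ at $t=0$ (the $3/5$-arclength parameter), and $f:=(s_A)^2\kappa_A$ is a $C^\infty$-function of $t$ (and of $\tau$) at $t=0$, called the normalized affine curvature function. Moreover, it satisfies $f(0)=4/25$, $\dot f(0)=0$ and $$\lim_{t\to0}\frac{(s_A)^2\kappa_A-4/25}{\tau^2}=\frac1{220}\sqrt[5]{\frac{20}{3}}\;\mu_A,$$ where $\mu_A$ is the affine cuspidal curvature of $\gamma$ at $t=0$. Conversely, for any $C^\infty$-function $f(\tau)$ (defined near $\tau=0$) with $f(0)=4/25$ and $\dot f(0)=0$, there exists a curve in $(M^2,D,\Omega)$ with a $3/2$-cusp at $\tau=0$ whose normalized affine curvature function is $f(\tau)$ with respect to the $3/5$-arclength parameter $\tau$.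
   Context: An equi-affine $2$-manifold is a triple $(M^2,D,\Omega)$ where $M^2$ is an oriented $2$-manifold, $D$ is an affine connection on $M^2$ (not necessarily torsion free, with no symmetry assumption on its Ricci tensor), and $\Omega$ is a non-vanishing positively oriented $2$-form on $M^2$ which is parallel with respect to $D$. Write $[v,w]=\Omega(v,w)$ for $v,w\in T_pM^2$. Along a curve $\gamma(t)$ put $\ddot\gamma=D_t\dot\gamma$, $\gamma^{(3)}=D_t\ddot\gamma$, $\gamma^{(k+1)}=D_t\gamma^{(k)}$. A $C^\infty$ curve $\gamma$ in $M^2$ has a $3/2$-cusp at $t=0$ if after a suitable coordinate change of the parameter and a suitable local coordinate system of $M^2$ at $\gamma(0)$ it becomes $t\mapsto(t^2,t^3)$; equivalently, $\dot\gamma(0)=0$ and $[\ddot\gamma(0),\gamma^{(3)}(0)]\ne0$. The domain is taken small enough that $[\dot\gamma,\ddot\gamma]\ne0$ for $t\ne0$. The affine arclength is $s_A(t)=\int_0^t\bigl|[\dot\gamma(u),\ddot\gamma(u)]\bigr|^{1/3}du$, and for $t\ne0$ $$\kappa_A=\frac{3[\dot\gamma,\ddot\gamma]\,[\dot\gamma,\gamma^{(4)}]+12[\dot\gamma,\ddot\gamma]\,[\ddot\gamma,\gamma^{(3)}]-5[\dot\gamma,\gamma^{(3)}]^2}{9\,\bigl|[\dot\gamma,\ddot\gamma]\bigr|^{8/3}}.$$ Here $(s_A)^{3/5}$ means $\operatorname{sgn}(s_A)|s_A|^{3/5}$. The affine cuspidal curvature at a $3/2$-cusp $t=0$ is $$\mu_A=\left.\frac{24[\ddot\gamma,\gamma^{(3)}]\,[\ddot\gamma,\gamma^{(5)}]+60[\ddot\gamma,\gamma^{(3)}]\,[\gamma^{(3)},\gamma^{(4)}]-35[\ddot\gamma,\gamma^{(4)}]^2}{\bigl|[\ddot\gamma,\gamma^{(3)}]\bigr|^{12/5}}\right|_{t=0}.$$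 Smoothness at $t=0$ concerns germs at $t=0$, functions being extended across $t=0$. *)

theory Defs
  imports "HOL-Analysis.Analysis"
begin

section \<open>Smooth maps between open subsets of normed spaces\<close>

text \<open>These notions are only meant for open \<open>S\<close>.\<close>

primrec Ck_on :: "nat \<Rightarrow> 'a::real_normed_vector set \<Rightarrow> ('a \<Rightarrow> 'b::real_normed_vector) \<Rightarrow> bool" where
  "Ck_on 0 S f \<longleftrightarrow> continuous_on S f"
| "Ck_on (Suc k) S f \<longleftrightarrow>
     (\<forall>x\<in>S. f differentiable (at x)) \<and> (\<forall>v. Ck_on k S (\<lambda>x. frechet_derivative f (at x) v))"

definition smooth_on :: "'a::real_normed_vector set \<Rightarrow> ('a \<Rightarrow> 'b::real_normed_vector) \<Rightarrow> bool" where
  "smooth_on S f \<longleftrightarrow> (\<forall>k. Ck_on k S f)"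

definition smooth_diffeo ::
    "'a::real_normed_vector set \<Rightarrow> 'b::real_normed_vector set \<Rightarrow> ('a \<Rightarrow> 'b) \<Rightarrow> bool" where
  "smooth_diffeo S T f \<longleftrightarrow>
     open S \<and> open T \<and> smooth_on S f \<and> (\<exists>g. homeomorphism S T f g \<and> smooth_on T g)"


section \<open>Oriented smooth 2-manifolds\<close>

text \<open>
  The manifold is the whole type \<open>'m\<close>, assumed Hausdorff and second countable
  by its type class, with an oriented atlas \<open>A\<close> (not required to be maximal).
  A chart is a pair of its domain and its coordinate map.
\<close>

type_synonym 'm chart = "'m set \<times> ('m \<Rightarrow> real^2)"

abbreviation dom_of :: "'m chart \<Rightarrow> 'm set" where
  "dom_of c \<equiv> fst c"

abbreviation coord :: "'m chart \<Rightarrow> 'm \<Rightarrow> real^2" where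
  "coord c \<equiv> snd c"

abbreviation param :: "'m chart \<Rightarrow> real^2 \<Rightarrow> 'm" where
  "param c \<equiv> inv_into (fst c) (snd c)"

abbreviation transition :: "'m chart \<Rightarrow> 'm chart \<Rightarrow> real^2 \<Rightarrow> real^2" where
  "transition c c' \<equiv> coord c' \<circ> param c"

definition is_chart :: "'m::topological_space chart \<Rightarrow> bool" where
  "is_chart c \<longleftrightarrow>
     open (dom_of c) \<and> open (coord c ` dom_of c) \<and>
     homeomorphism (dom_of c) (coord c ` dom_of c) (coord c) (param c)"

definition compatible :: "'m chart \<Rightarrow> 'm chart \<Rightarrow> bool" where
  "compatible c c' \<longleftrightarrow>
     smooth_on (coord c ` (dom_of c \<inter> dom_of c')) (transition c c') \<and>
     smooth_on (coord c' ` (dom_of c \<inter> dom_of c')) (transition c' c)"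

definition oriented_atlas :: "'m::{t2_space,second_countable_topology} chart set \<Rightarrow> bool" where
  "oriented_atlas A \<longleftrightarrow>
     (\<Union>c\<in>A. dom_of c) = UNIV \<and>
     (\<forall>c\<in>A. is_chart c) \<and>
     (\<forall>c\<in>A. \<forall>c'\<in>A. compatible c c' \<and>
        (\<forall>p\<in>dom_of c \<inter> dom_of c'. det (jacobian (transition c c') (at (coord c p))) > 0))"

text \<open>Local coordinate systems of the manifold; they need not preserve the orientation.\<close>

definition local_coordinates :: "'m::topological_space chart set \<Rightarrow> 'm chart \<Rightarrow> bool" where
  "local_coordinates A c \<longleftrightarrow> is_chart c \<and> (\<forall>c'\<in>A. compatible c c')"

definition smooth_function ::
    "'m::topological_space chart set \<Rightarrow> 'm set \<Rightarrow> ('m \<Rightarrow> real) \<Rightarrow> bool" where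
  "smooth_function A W f \<longleftrightarrow>
     (\<forall>c\<in>A. smooth_on (coord c ` (dom_of c \<inter> W)) (f \<circ> param c))"


section \<open>Tangent vectors and vector fields\<close>

text \<open>
  A tangent vector at \<open>p\<close> is the family of its components in the charts of \<open>A\<close>
  around \<open>p\<close>, related by the derivatives of the transition maps. The components in
  all other charts are set to 0, so that the tangent space is 2-dimensional.
\<close>

type_synonym 'm tvec = "'m chart \<Rightarrow> real^2"

definition tangent_space :: "'m chart set \<Rightarrow> 'm \<Rightarrow> 'm tvec set" where
  "tangent_space A p =
     {v. (\<forall>c. \<not> (c \<in> A \<and> p \<in> dom_of c) \<longrightarrow> v c = 0) \<and>
         (\<forall>c\<in>A. \<forall>c'\<in>A. p \<in> dom_of c \<inter> dom_of c' \<longrightarrow>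
            v c' = frechet_derivative (transition c c') (at (coord c p)) (v c))}"

text \<open>Vector fields on the open set \<open>W\<close>; their values outside \<open>W\<close> are irrelevant.\<close>

definition vector_field ::
    "'m::topological_space chart set \<Rightarrow> 'm set \<Rightarrow> ('m \<Rightarrow> 'm tvec) \<Rightarrow> bool" where
  "vector_field A W X \<longleftrightarrow>
     (\<forall>p\<in>W. X p \<in> tangent_space A p) \<and>
     (\<forall>c\<in>A. smooth_on (coord c ` (dom_of c \<inter> W)) (\<lambda>x. X (param c x) c))"

text \<open>The coordinate vector field of the chart \<open>c\<close> in the direction of its \<open>j\<close>-th coordinate.\<close>

definition coord_field :: "'m chart set \<Rightarrow> 'm chart \<Rightarrow> 2 \<Rightarrow> 'm \<Rightarrow> 'm tvec" where
  "coord_field A c j p =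
     (\<lambda>c'. if c' \<in> A \<and> p \<in> dom_of c \<inter> dom_of c'
           then frechet_derivative (transition c c') (at (coord c p)) (axis j 1) else 0)"

text \<open>The derivative of a function at \<open>p\<close> along a tangent vector, computed in the chart \<open>c\<close>;
  for charts of \<open>A\<close> around \<open>p\<close> it does not depend on \<open>c\<close>.\<close>

definition directional :: "'m chart \<Rightarrow> 'm \<Rightarrow> 'm tvec \<Rightarrow> ('m \<Rightarrow> real) \<Rightarrow> real" where
  "directional c p v f = frechet_derivative (f \<circ> param c) (at (coord c p)) (v c)"


section \<open>Affine connections and equi-affine structures\<close>

text \<open>
  \<open>D p v Y\<close> is the covariant derivative at \<open>p\<close> of the local vector field \<open>Y\<close> along
  the tangent vector \<open>v\<close>. Since fields are total functions that matter only near \<open>p\<close>,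
  locality in \<open>Y\<close> is stated explicitly. Neither torsion freeness nor a condition on the
  Ricci tensor is imposed.
\<close>

type_synonym 'm connection = "'m \<Rightarrow> 'm tvec \<Rightarrow> ('m \<Rightarrow> 'm tvec) \<Rightarrow> 'm tvec"

definition affine_connection ::
    "'m::topological_space chart set \<Rightarrow> 'm connection \<Rightarrow> bool" where
  "affine_connection A D \<longleftrightarrow>
     (\<forall>W. open W \<longrightarrow>
       (\<forall>p\<in>W. \<forall>Y. vector_field A W Y \<longrightarrow>
          (\<forall>v\<in>tangent_space A p. D p v Y \<in> tangent_space A p) \<and>
          (\<forall>v\<in>tangent_space A p. \<forall>w\<in>tangent_space A p. \<forall>a b.
             D p (\<lambda>c. a *\<^sub>R v c + b *\<^sub>R w c) Y = (\<lambda>c. a *\<^sub>R D p v Y c + b *\<^sub>R D p w Y c)) \<and>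
          (\<forall>v\<in>tangent_space A p. \<forall>Z. vector_field A W Z \<longrightarrow>
             D p v (\<lambda>q c. Y q c + Z q c) = (\<lambda>c. D p v Y c + D p v Z c)) \<and>
          (\<forall>v\<in>tangent_space A p. \<forall>f. smooth_function A W f \<longrightarrow>
             (\<forall>b\<in>A. p \<in> dom_of b \<longrightarrow>
                D p v (\<lambda>q c. f q *\<^sub>R Y q c) =
                (\<lambda>c. directional b p v f *\<^sub>R Y p c + f p *\<^sub>R D p v Y c))) \<and>
          (\<forall>v\<in>tangent_space A p. \<forall>Z. (\<forall>q\<in>W. Z q = Y q) \<longrightarrow> D p v Z = D p v Y)) \<and>
       (\<forall>X Y. vector_field A W X \<longrightarrow> vector_field A W Y \<longrightarrow>
          vector_field A W (\<lambda>p. D p (X p) Y)))"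

type_synonym 'm form2 = "'m \<Rightarrow> 'm tvec \<Rightarrow> 'm tvec \<Rightarrow> real"

definition two_form :: "'m::topological_space chart set \<Rightarrow> 'm form2 \<Rightarrow> bool" where
  "two_form A \<Omega> \<longleftrightarrow>
     (\<forall>p. \<forall>u\<in>tangent_space A p. \<forall>v\<in>tangent_space A p. \<Omega> p u v = - \<Omega> p v u) \<and>
     (\<forall>p. \<forall>u\<in>tangent_space A p. \<forall>v\<in>tangent_space A p. \<forall>w\<in>tangent_space A p. \<forall>a b.
        \<Omega> p (\<lambda>c. a *\<^sub>R u c + b *\<^sub>R v c) w = a * \<Omega> p u w + b * \<Omega> p v w) \<and>
     (\<forall>W X Y. open W \<longrightarrow> vector_field A W X \<longrightarrow> vector_field A W Y \<longrightarrow>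
        smooth_function A W (\<lambda>p. \<Omega> p (X p) (Y p)))"

text \<open>Positive on positively oriented bases, in particular nowhere vanishing.\<close>

definition positively_oriented :: "'m chart set \<Rightarrow> 'm form2 \<Rightarrow> bool" where
  "positively_oriented A \<Omega> \<longleftrightarrow>
     (\<forall>c\<in>A. \<forall>p\<in>dom_of c. \<Omega> p (coord_field A c 1 p) (coord_field A c 2 p) > 0)"

definition parallel_form ::
    "'m::topological_space chart set \<Rightarrow> 'm connection \<Rightarrow> 'm form2 \<Rightarrow> bool" where
  "parallel_form A D \<Omega> \<longleftrightarrow>
     (\<forall>W X Y. open W \<longrightarrow> vector_field A W X \<longrightarrow> vector_field A W Y \<longrightarrow>
        (\<forall>p\<in>W. \<forall>v\<in>tangent_space A p. \<forall>c\<in>A. p \<in> dom_of c \<longrightarrow>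
           directional c p v (\<lambda>q. \<Omega> q (X q) (Y q)) =
           \<Omega> p (D p v X) (Y p) + \<Omega> p (X p) (D p v Y)))"

definition equiaffine_2_manifold ::
    "'m::{t2_space,second_countable_topology} chart set \<Rightarrow> 'm connection \<Rightarrow> 'm form2 \<Rightarrow> bool" where
  "equiaffine_2_manifold A D \<Omega> \<longleftrightarrow>
     oriented_atlas A \<and> affine_connection A D \<and>
     two_form A \<Omega> \<and> positively_oriented A \<Omega> \<and> parallel_form A D \<Omega>"


section \<open>Curves\<close>

definition smooth_curve ::
    "'m::topological_space chart set \<Rightarrow> real set \<Rightarrow> (real \<Rightarrow> 'm) \<Rightarrow> bool" where
  "smooth_curve A I \<gamma> \<longleftrightarrow>
     continuous_on I \<gamma> \<and> (\<forall>c\<in>A. smooth_on {t\<in>I. \<gamma> t \<in> dom_of c} (coord c \<circ> \<gamma>))"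

definition velocity :: "'m chart set \<Rightarrow> (real \<Rightarrow> 'm) \<Rightarrow> real \<Rightarrow> 'm tvec" where
  "velocity A \<gamma> t =
     (\<lambda>c. if c \<in> A \<and> \<gamma> t \<in> dom_of c then vector_derivative (coord c \<circ> \<gamma>) (at t) else 0)"

text \<open>
  The covariant derivative of a vector field \<open>V\<close> along \<open>\<gamma>\<close>: writing \<open>V\<close> as the sum of
  \<open>V\<^sub>j \<partial>\<^sub>j\<close> in the chart \<open>c\<close>, these are the components in \<open>c\<close> of the sum of
  \<open>V\<^sub>j' \<partial>\<^sub>j + V\<^sub>j D\<^bsub>\<gamma>'\<^esub> \<partial>\<^sub>j\<close>.
\<close>

definition covariant ::
    "'m chart set \<Rightarrow> 'm connection \<Rightarrow> (real \<Rightarrow> 'm) \<Rightarrow> (real \<Rightarrow> 'm tvec) \<Rightarrow> real \<Rightarrow> 'm tvec" where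
  "covariant A D \<gamma> V t =
     (\<lambda>c. if c \<in> A \<and> \<gamma> t \<in> dom_of c
          then vector_derivative (\<lambda>u. V u c) (at t) +
               (\<Sum>j\<in>UNIV. (V t c $ j) *\<^sub>R D (\<gamma> t) (velocity A \<gamma> t) (coord_field A c j) c)
          else 0)"

text \<open>The derivative of order \<open>k\<close> of \<open>\<gamma>\<close>, for \<open>k \<ge> 1\<close>.\<close>

definition curve_deriv ::
    "'m chart set \<Rightarrow> 'm connection \<Rightarrow> (real \<Rightarrow> 'm) \<Rightarrow> nat \<Rightarrow> real \<Rightarrow> 'm tvec" where
  "curve_deriv A D \<gamma> k = (covariant A D \<gamma> ^^ (k - 1)) (velocity A \<gamma>)"

definition bracket ::
    "'m chart set \<Rightarrow> 'm connection \<Rightarrow> 'm form2 \<Rightarrow> (real \<Rightarrow> 'm) \<Rightarrow> nat \<Rightarrow> nat \<Rightarrow> real \<Rightarrow> real" where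
  "bracket A D \<Omega> \<gamma> i j t = \<Omega> (\<gamma> t) (curve_deriv A D \<gamma> i t) (curve_deriv A D \<gamma> j t)"

text \<open>A curve defined on \<open>I\<close> has a 3/2-cusp at parameter 0: after the parameter change \<open>h\<close>
  and in the local coordinate system \<open>c\<close> it is the standard cusp near 0.\<close>

definition has_cusp_at_0 ::
    "'m::topological_space chart set \<Rightarrow> real set \<Rightarrow> (real \<Rightarrow> 'm) \<Rightarrow> bool" where
  "has_cusp_at_0 A I \<gamma> \<longleftrightarrow>
     (\<exists>c h \<eta> J. local_coordinates A c \<and> \<eta> > 0 \<and> J \<subseteq> I \<and>
        smooth_diffeo {-\<eta><..<\<eta>} J h \<and> h 0 = 0 \<and>
        (\<forall>t\<in>{-\<eta><..<\<eta>}. \<gamma> (h t) \<in> dom_of c \<and> coord c (\<gamma> (h t)) = vector [t^2, t^3]))"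


section \<open>Affine invariants of curves\<close>

text \<open>The interval integral is oriented, so the arclength is negative for negative \<open>t\<close>.\<close>

definition arclength ::
    "'m chart set \<Rightarrow> 'm connection \<Rightarrow> 'm form2 \<Rightarrow> (real \<Rightarrow> 'm) \<Rightarrow> real \<Rightarrow> real" where
  "arclength A D \<Omega> \<gamma> t = (LBINT u=0..t. \<bar>bracket A D \<Omega> \<gamma> 1 2 u\<bar> powr (1/3))"

definition arclength_3_5 ::
    "'m chart set \<Rightarrow> 'm connection \<Rightarrow> 'm form2 \<Rightarrow> (real \<Rightarrow> 'm) \<Rightarrow> real \<Rightarrow> real" where
  "arclength_3_5 A D \<Omega> \<gamma> t =
     sgn (arclength A D \<Omega> \<gamma> t) * \<bar>arclength A D \<Omega> \<gamma> t\<bar> powr (3/5)"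

definition affine_curvature ::
    "'m chart set \<Rightarrow> 'm connection \<Rightarrow> 'm form2 \<Rightarrow> (real \<Rightarrow> 'm) \<Rightarrow> real \<Rightarrow> real" where
  "affine_curvature A D \<Omega> \<gamma> t =
     (let br = (\<lambda>i j. bracket A D \<Omega> \<gamma> i j t) in
      (3 * br 1 2 * br 1 4 + 12 * br 1 2 * br 2 3 - 5 * (br 1 3)^2) /
      (9 * \<bar>br 1 2\<bar> powr (8/3)))"

definition cuspidal_curvature ::
    "'m chart set \<Rightarrow> 'm connection \<Rightarrow> 'm form2 \<Rightarrow> (real \<Rightarrow> 'm) \<Rightarrow> real" where
  "cuspidal_curvature A D \<Omega> \<gamma> =
     (let br = (\<lambda>i j. bracket A D \<Omega> \<gamma> i j 0) in
      (24 * br 2 3 * br 2 5 + 60 * br 2 3 * br 3 4 - 35 * (br 2 4)^2) /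
      (\<bar>br 2 3\<bar> powr (12/5)))"

text \<open>The normalized affine curvature away from the cusp, where it is given by a formula;
  at \<open>t = 0\<close> the curvature is not defined.\<close>

definition normalized_curvature ::
    "'m chart set \<Rightarrow> 'm connection \<Rightarrow> 'm form2 \<Rightarrow> (real \<Rightarrow> 'm) \<Rightarrow> real \<Rightarrow> real" where
  "normalized_curvature A D \<Omega> \<gamma> t = (arclength A D \<Omega> \<gamma> t)^2 * affine_curvature A D \<Omega> \<gamma> t"

end

theory Submission
  imports Defs
begin

text \<open>
  At a 3/2-cusp the velocity is divisible by the parameter: \<open>\<gamma>' = t W\<close> with a smooth field \<open>W\<close> along \<open>\<gamma>\<close> such that
  \<open>[W, W']\<close> does not vanish at 0 (lemmas \<open>cusp_velocity\<close> and \<open>cusp_germ_of_field\<close>). Because the area form is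
  parallel, brackets obey the Leibniz rule, and all brackets of the derivatives of \<open>\<gamma>\<close> that enter the invariants are
  polynomials in \<open>t\<close>, \<open>g = [W, W']\<close>, \<open>g'\<close>, \<open>g''\<close> and \<open>h = [W', W'']\<close> (\<open>cusp_brackets\<close>). In particular
  \<open>[\<gamma>', \<gamma>''] = t\<^sup>2 g\<close>. So the arclength element is \<open>|t|\<^bsup>2/3\<^esup> \<phi> dt\<close> with \<open>\<phi> = |g|\<^bsup>1/3\<^esup>\<close>, and the arclength is
  \<open>\<plusminus>|t|\<^bsup>5/3\<^esup> q\<close> with \<open>q(t) = \<integral>\<^sub>0\<^sup>1 v\<^bsup>2/3\<^esup> \<phi>(t v) dv\<close>, which is smooth and positive. Hence \<open>\<tau> = t q\<^bsup>3/5\<^esup>\<close> is a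
  coordinate, and in \<open>s\<^sub>A\<^sup>2 \<kappa>\<^sub>A\<close> the powers of \<open>|t|\<close> cancel (\<open>normalized_curvature_eq_F\<close>). The equation
  \<open>t q' + (5/3) q = \<phi>\<close> expresses the Taylor coefficients of \<open>q\<close> at 0 by those of \<open>\<phi>\<close>. Inserting them gives the
  value 4/25, the vanishing of the first derivative, and the limit, which is the second Taylor coefficient up to a
  power of \<open>q(0)\<close> (\<open>F_expansion\<close>, \<open>curvature_limit\<close>).

  Conversely, let \<open>g\<close> be the constant \<open>(5/3)\<^sup>3\<close>. Then \<open>q = 1\<close>, the parameter itself is the 3/5-arclength, and the
  normalized curvature is \<open>4/25 + (3/5)\<^sup>5 t\<^sup>2 h\<close>, so that \<open>f\<close> prescribes a smooth function \<open>h\<close>. Both conditions hold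
  for a solution of \<open>\<gamma>' = t W\<close>, \<open>W'' = \<alpha> W\<close> with \<open>\<alpha> = - h / g\<close> and suitable initial values
  (\<open>ex_curve_with_frame\<close>, \<open>ex_cusp_with_curvature\<close>). It remains to see that such a curve is \<open>(t\<^sup>2, t\<^sup>3)\<close> in
  suitable coordinates (\<open>has_cuspI\<close>). This rests on Whitney's theorem that a smooth even function of \<open>s\<close> is a smooth
  function of \<open>s\<^sup>2\<close> (\<open>smooth_even_function\<close>). The latter function has to be continued to negative arguments,
  which is done by Borel's lemma.
\<close>

section \<open>Calculus of smooth maps\<close>

lemma Ck_on_subset: "Ck_on k T f \<Longrightarrow> S \<subseteq> T \<Longrightarrow> Ck_on k S f"
  by (induction k arbitrary: f) (auto intro: continuous_on_subset)

lemma Ck_on_cong_imp: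
  assumes "open S" "Ck_on k S f" "\<And>x. x \<in> S \<Longrightarrow> f x = g x"
  shows "Ck_on k S g"
  using assms(2,3)
proof (induction k arbitrary: f g)
  case 0
  then show ?case by (simp cong: continuous_on_cong)
next
  case (Suc k)
  have der: "(g has_derivative frechet_derivative f (at x)) (at x)" if "x \<in> S" for x
    using Suc.prems that \<open>open S\<close>
    by (intro has_derivative_transform_within_open[of f _ x UNIV S g])
       (auto simp: frechet_derivative_works[symmetric])
  have "Ck_on k S (\<lambda>x. frechet_derivative g (at x) v)" for v
  proof (rule Suc.IH)
    show "Ck_on k S (\<lambda>x. frechet_derivative f (at x) v)" using Suc.prems by simp
    show "frechet_derivative f (at x) v = frechet_derivative g (at x) v" if "x \<in> S" for x
      using frechet_derivative_at[OF der[OF that]] by simp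
  qed
  then show ?case using der by (auto simp: differentiable_def)
qed

lemma Ck_on_SucI:
  assumes "open S" "\<And>x. x \<in> S \<Longrightarrow> (f has_derivative f' x) (at x)" "\<And>v. Ck_on k S (\<lambda>x. f' x v)"
  shows "Ck_on (Suc k) S f"
proof -
  have "Ck_on k S (\<lambda>x. frechet_derivative f (at x) v)" for v
    by (rule Ck_on_cong_imp[OF assms(1) assms(3)[of v]])
       (metis assms(2) frechet_derivative_at)
  then show ?thesis using assms(2) by (auto simp: differentiable_def)
qed

lemma Ck_on_cong:
  assumes "open S" "\<And>x. x \<in> S \<Longrightarrow> f x = g x"
  shows "Ck_on k S f \<longleftrightarrow> Ck_on k S g"
  using Ck_on_cong_imp[OF assms(1)] assms(2) by metis

lemma Ck_on_SucD:
  assumes "Ck_on (Suc k) S f"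
  shows "x \<in> S \<Longrightarrow> (f has_derivative frechet_derivative f (at x)) (at x)"
    and "Ck_on k S (\<lambda>x. frechet_derivative f (at x) v)"
  using assms by (auto simp: frechet_derivative_works[symmetric])

lemma Ck_on_Suc_imp: "Ck_on (Suc k) S f \<Longrightarrow> Ck_on k S f"
proof (induction k arbitrary: f)
  case 0
  then show ?case
    by (auto intro!: continuous_at_imp_continuous_on differentiable_imp_continuous_within)
next
  case (Suc k)
  then show ?case by (metis Ck_on.simps(2))
qed

lemma Ck_on_continuous: "Ck_on k S f \<Longrightarrow> continuous_on S f"
  by (induction k) (auto dest: Ck_on_Suc_imp simp del: Ck_on.simps(2))

lemma Ck_on_local:
  assumes "\<And>x. x \<in> S \<Longrightarrow> \<exists>U. open U \<and> x \<in> U \<and> Ck_on k U f"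
  shows "Ck_on k S f"
  using assms
proof (induction k arbitrary: f)
  case 0
  have "isCont f x" if "x \<in> S" for x
    using 0[OF that] continuous_on_eq_continuous_at by (auto simp: Ck_on.simps)
  then show ?case by (auto intro: continuous_at_imp_continuous_on)
next
  case (Suc k)
  have "f differentiable (at x)" if "x \<in> S" for x
    using Suc.prems[OF that] by auto
  moreover have "Ck_on k S (\<lambda>x. frechet_derivative f (at x) v)" for v
    by (rule Suc.IH) (use Suc.prems in force)
  ultimately show ?case by simp
qed

lemma Ck_on_const: "open S \<Longrightarrow> Ck_on k S (\<lambda>x. c)"
proof (induction k arbitrary: c)
  case (Suc k)
  then show ?case
    by (intro Ck_on_SucI[where f' = "\<lambda>x v. 0"]) auto
qed simp

lemma Ck_on_bounded_linear:
  assumes "open S" "bounded_linear f"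
  shows "Ck_on k S f"
proof (cases k)
  case 0
  then show ?thesis using assms by (simp add: linear_continuous_on)
next
  case (Suc m)
  then show ?thesis
    using assms by (simp only:)
      (intro Ck_on_SucI[where f' = "\<lambda>x. f"], auto simp: Ck_on_const bounded_linear_imp_has_derivative)
qed

lemma Ck_on_add:
  assumes "open S"
  shows "Ck_on k S f \<Longrightarrow> Ck_on k S g \<Longrightarrow> Ck_on k S (\<lambda>x. f x + g x)"
proof (induction k arbitrary: f g)
  case (Suc k)
  show ?case
    by (rule Ck_on_SucI[where f' = "\<lambda>x v. frechet_derivative f (at x) v + frechet_derivative g (at x) v"])
       (auto intro!: derivative_intros Suc.IH Ck_on_SucD(1)[OF Suc.prems(1)] Ck_on_SucD(1)[OF Suc.prems(2)]
          Ck_on_SucD(2)[OF Suc.prems(1)] Ck_on_SucD(2)[OF Suc.prems(2)] assms)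
qed (auto intro: continuous_intros)

lemma Ck_on_bilinear:
  assumes "open S" "bounded_bilinear m"
  shows "Ck_on k S f \<Longrightarrow> Ck_on k S g \<Longrightarrow> Ck_on k S (\<lambda>x. m (f x) (g x))"
proof (induction k arbitrary: f g)
  case 0
  then show ?case by (auto intro: bounded_bilinear.continuous_on[OF assms(2)])
next
  case (Suc k)
  show ?case
    by (rule Ck_on_SucI[where f' = "\<lambda>x v. m (f x) (frechet_derivative g (at x) v)
        + m (frechet_derivative f (at x) v) (g x)"])
       (auto intro!: Ck_on_add Suc.IH bounded_bilinear.FDERIV[OF assms(2)]
          Ck_on_SucD(1)[OF Suc.prems(1)] Ck_on_SucD(1)[OF Suc.prems(2)]
          Ck_on_SucD(2)[OF Suc.prems(1)] Ck_on_SucD(2)[OF Suc.prems(2)]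
          Ck_on_Suc_imp[OF Suc.prems(1)] Ck_on_Suc_imp[OF Suc.prems(2)] assms)
qed

lemma Ck_on_Pair:
  assumes "open S"
  shows "Ck_on k S f \<Longrightarrow> Ck_on k S g \<Longrightarrow> Ck_on k S (\<lambda>x. (f x, g x))"
proof (induction k arbitrary: f g)
  case (Suc k)
  show ?case
    by (rule Ck_on_SucI[where f' = "\<lambda>x v. (frechet_derivative f (at x) v, frechet_derivative g (at x) v)"])
       (auto intro!: has_derivative_Pair Suc.IH Ck_on_SucD(1)[OF Suc.prems(1)] Ck_on_SucD(1)[OF Suc.prems(2)]
          Ck_on_SucD(2)[OF Suc.prems(1)] Ck_on_SucD(2)[OF Suc.prems(2)] assms)
qed (auto intro: continuous_on_Pair)

lemma Ck_on_sum:
  assumes "open S" "\<And>i. i \<in> I \<Longrightarrow> Ck_on k S (f i)"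
  shows "Ck_on k S (\<lambda>x. \<Sum>i\<in>I. f i x)"
  using assms(2)
  by (induction I rule: infinite_finite_induct) (auto intro: Ck_on_add Ck_on_const assms(1))

text \<open>The chain rule expresses the directional derivatives of \<open>g \<circ> f\<close> as finite sums of products
  of directional derivatives of \<open>f\<close> and of \<open>g\<close> along a basis, which is where the finite dimension of
  the middle space enters.\<close>

lemma Ck_on_compose:
  fixes g :: "'b::euclidean_space \<Rightarrow> 'c::real_normed_vector" and f :: "'a::real_normed_vector \<Rightarrow> 'b"
  assumes "open S" "open T" "f ` S \<subseteq> T"
  shows "Ck_on k T g \<Longrightarrow> Ck_on k S f \<Longrightarrow> Ck_on k S (\<lambda>x. g (f x))"
proof (induction k arbitrary: g)
  case 0
  then show ?case using assms by (auto intro: continuous_on_compose2)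
next
  case (Suc k)
  have fd: "((\<lambda>x. g (f x)) has_derivative (\<lambda>v. frechet_derivative g (at (f x)) (frechet_derivative f (at x) v))) (at x)"
    if "x \<in> S" for x
    by (rule has_derivative_compose[OF Ck_on_SucD(1)[OF Suc.prems(2) that], of g])
       (use Ck_on_SucD(1)[OF Suc.prems(1)] assms(3) that in auto)
  show ?case
  proof (rule Ck_on_SucI)
    show "((\<lambda>x. g (f x)) has_derivative (\<lambda>v. \<Sum>b\<in>Basis. (frechet_derivative f (at x) v \<bullet> b) *\<^sub>R
        frechet_derivative g (at (f x)) b)) (at x)" if "x \<in> S" for x
    proof -
      have lin: "linear (frechet_derivative g (at (f x)))"
        using Ck_on_SucD(1)[OF Suc.prems(1)] assms(3) that by (blast intro: has_derivative_linear)
      have eq: "frechet_derivative g (at (f x)) w = (\<Sum>b\<in>Basis. (w \<bullet> b) *\<^sub>R frechet_derivative g (at (f x)) b)" for w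
        by (subst euclidean_representation[of w, symmetric])
           (simp add: linear_sum[OF lin] linear_scale[OF lin])
      show ?thesis unfolding eq[symmetric] by (rule fd[OF that])
    qed
    show "Ck_on k S (\<lambda>x. \<Sum>b\<in>Basis. (frechet_derivative f (at x) v \<bullet> b) *\<^sub>R
        frechet_derivative g (at (f x)) b)" for v
      by (intro Ck_on_sum Ck_on_bilinear[OF \<open>open S\<close> bounded_bilinear_scaleR] Suc.IH
          Ck_on_bilinear[OF \<open>open S\<close> bounded_bilinear_inner] Ck_on_const Ck_on_SucD(2)[OF Suc.prems(1)]
          Ck_on_SucD(2)[OF Suc.prems(2)] Ck_on_Suc_imp[OF Suc.prems(2)] assms(1))
  qed (use assms in auto)
qed

lemma smooth_on_subset: "smooth_on T f \<Longrightarrow> S \<subseteq> T \<Longrightarrow> smooth_on S f"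
  by (auto simp: smooth_on_def intro: Ck_on_subset)

lemma smooth_on_cong:
  assumes "open S" "\<And>x. x \<in> S \<Longrightarrow> f x = g x"
  shows "smooth_on S f \<longleftrightarrow> smooth_on S g"
  using Ck_on_cong[OF assms] by (simp add: smooth_on_def)

lemma smooth_on_local:
  assumes "\<And>x. x \<in> S \<Longrightarrow> \<exists>U. open U \<and> x \<in> U \<and> smooth_on U f"
  shows "smooth_on S f"
  unfolding smooth_on_def by (intro allI Ck_on_local) (metis assms smooth_on_def)

lemma smooth_on_const: "open S \<Longrightarrow> smooth_on S (\<lambda>x. c)"
  by (simp add: smooth_on_def Ck_on_const)

lemma smooth_on_bounded_linear: "open S \<Longrightarrow> bounded_linear l \<Longrightarrow> smooth_on S l"
  by (simp add: smooth_on_def Ck_on_bounded_linear)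

lemma smooth_on_add: "open S \<Longrightarrow> smooth_on S f \<Longrightarrow> smooth_on S g \<Longrightarrow> smooth_on S (\<lambda>x. f x + g x)"
  by (simp add: smooth_on_def Ck_on_add)

lemma smooth_on_bilinear:
  "open S \<Longrightarrow> bounded_bilinear m \<Longrightarrow> smooth_on S f \<Longrightarrow> smooth_on S g \<Longrightarrow> smooth_on S (\<lambda>x. m (f x) (g x))"
  by (simp add: smooth_on_def Ck_on_bilinear)

lemma smooth_on_Pair: "open S \<Longrightarrow> smooth_on S f \<Longrightarrow> smooth_on S g \<Longrightarrow> smooth_on S (\<lambda>x. (f x, g x))"
  by (simp add: smooth_on_def Ck_on_Pair)

lemma smooth_on_sum:
  "open S \<Longrightarrow> (\<And>i. i \<in> I \<Longrightarrow> smooth_on S (f i)) \<Longrightarrow> smooth_on S (\<lambda>x. \<Sum>i\<in>I. f i x)"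
  by (simp add: smooth_on_def Ck_on_sum)

lemma smooth_on_compose:
  fixes g :: "'b::euclidean_space \<Rightarrow> 'c::real_normed_vector"
  assumes "smooth_on T g" "smooth_on S f" "f ` S \<subseteq> T" "open S" "open T"
  shows "smooth_on S (\<lambda>x. g (f x))"
  using assms by (auto simp: smooth_on_def intro: Ck_on_compose)

lemma smooth_on_continuous: "smooth_on S f \<Longrightarrow> continuous_on S f"
  using Ck_on_continuous by (auto simp: smooth_on_def)

lemma smooth_on_derivative:
  assumes "smooth_on S f"
  shows "x \<in> S \<Longrightarrow> (f has_derivative frechet_derivative f (at x)) (at x)"
    and "smooth_on S (\<lambda>x. frechet_derivative f (at x) v)"
proof -
  have "Ck_on (Suc k) S f" for k using assms unfolding smooth_on_def by blast
  then show "x \<in> S \<Longrightarrow> (f has_derivative frechet_derivative f (at x)) (at x)"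
    and "smooth_on S (\<lambda>x. frechet_derivative f (at x) v)"
    unfolding smooth_on_def by (blast dest: Ck_on_SucD)+
qed

lemma smooth_on_linear_compose:
  assumes "open S" "bounded_linear l" "smooth_on S f"
  shows "smooth_on S (\<lambda>x. l (f x))"
proof -
  interpret l: bounded_linear l by fact
  show ?thesis
    unfolding smooth_on_def
  proof
    fix k
    have "Ck_on k S f" using assms(3) by (simp add: smooth_on_def)
    then show "Ck_on k S (\<lambda>x. l (f x))"
    proof (induction k arbitrary: f)
      case 0
      then show ?case by (auto intro: l.continuous_on)
    next
      case (Suc k)
      show ?case
        by (rule Ck_on_SucI[where f' = "\<lambda>x v. l (frechet_derivative f (at x) v)"])
          (auto intro!: l.has_derivative Suc.IH Ck_on_SucD(1)[OF Suc.prems] Ck_on_SucD(2)[OF Suc.prems] assms(1))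
    qed
  qed
qed

lemma smooth_on_id: "open S \<Longrightarrow> smooth_on S (\<lambda>x. x)"
  by (intro smooth_on_bounded_linear bounded_linear_ident)

lemma smooth_on_scaleR: "open S \<Longrightarrow> smooth_on S f \<Longrightarrow> smooth_on S g \<Longrightarrow> smooth_on S (\<lambda>x. f x *\<^sub>R g x)"
  by (rule smooth_on_bilinear[OF _ bounded_bilinear_scaleR])

lemma smooth_on_mult:
  fixes f g :: "'a::real_normed_vector \<Rightarrow> 'b::real_normed_algebra"
  shows "open S \<Longrightarrow> smooth_on S f \<Longrightarrow> smooth_on S g \<Longrightarrow> smooth_on S (\<lambda>x. f x * g x)"
  by (rule smooth_on_bilinear[OF _ bounded_bilinear_mult])

lemma smooth_on_minus: "open S \<Longrightarrow> smooth_on S f \<Longrightarrow> smooth_on S (\<lambda>x. - f x)"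
  by (rule smooth_on_linear_compose[OF _ bounded_linear_minus[OF bounded_linear_ident]])

lemma smooth_on_diff: "open S \<Longrightarrow> smooth_on S f \<Longrightarrow> smooth_on S g \<Longrightarrow> smooth_on S (\<lambda>x. f x - g x)"
  unfolding diff_conv_add_uminus by (intro smooth_on_add smooth_on_minus)

lemma smooth_on_power:
  fixes f :: "'a::real_normed_vector \<Rightarrow> real"
  shows "open S \<Longrightarrow> smooth_on S f \<Longrightarrow> smooth_on S (\<lambda>x. f x ^ n)"
  by (induction n) (auto intro: smooth_on_const smooth_on_mult)

lemma smooth_on_fst: "open S \<Longrightarrow> smooth_on S f \<Longrightarrow> smooth_on S (\<lambda>x. fst (f x))"
  by (rule smooth_on_linear_compose[OF _ bounded_linear_fst])

lemma smooth_on_snd: "open S \<Longrightarrow> smooth_on S f \<Longrightarrow> smooth_on S (\<lambda>x. snd (f x))"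
  by (rule smooth_on_linear_compose[OF _ bounded_linear_snd])

lemma smooth_on_nth: "open S \<Longrightarrow> smooth_on S f \<Longrightarrow> smooth_on S (\<lambda>x. f x $ i)"
  by (rule smooth_on_linear_compose[OF _ bounded_linear_vec_nth])

lemmas smooth_intros = smooth_on_const smooth_on_add smooth_on_Pair smooth_on_sum smooth_on_id
  smooth_on_scaleR smooth_on_mult smooth_on_minus smooth_on_diff smooth_on_power smooth_on_fst
  smooth_on_snd smooth_on_nth


subsection \<open>Functions of one real variable\<close>

definition vderiv :: "(real \<Rightarrow> 'b::real_normed_vector) \<Rightarrow> real \<Rightarrow> 'b" where
  "vderiv f t = vector_derivative f (at t)"

lemma has_vector_derivative_vderiv:
  assumes "smooth_on S f" "t \<in> S"
  shows "(f has_vector_derivative vderiv f t) (at t)"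
  using smooth_on_derivative(1)[OF assms] unfolding vderiv_def
  by (metis differentiable_def vector_derivative_works)

lemma has_real_derivative_vderiv:
  assumes "smooth_on S f" "t \<in> S"
  shows "(f has_real_derivative vderiv f t) (at t)"
  using has_vector_derivative_vderiv[OF assms]
  by (simp add: has_real_derivative_iff_has_vector_derivative)

lemma vderiv_eq: "(f has_vector_derivative f') (at t) \<Longrightarrow> vderiv f t = f'"
  by (simp add: vderiv_def vector_derivative_at)

lemma smooth_on_vderiv:
  assumes "open S" "smooth_on S f"
  shows "smooth_on S (vderiv f)"
proof -
  have "smooth_on S (\<lambda>x. frechet_derivative f (at x) 1)" by (rule smooth_on_derivative(2)[OF assms(2)])
  moreover have "frechet_derivative f (at x) 1 = vderiv f x" if "x \<in> S" for x
    using has_vector_derivative_vderiv[OF assms(2) that] unfolding has_vector_derivative_def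
    by (metis frechet_derivative_at scaleR_one)
  ultimately show ?thesis
    using smooth_on_cong[OF assms(1), of "\<lambda>x. frechet_derivative f (at x) 1" "vderiv f"] by simp
qed

lemma Ck_on_Suc_real:
  assumes "open S" "\<And>x. x \<in> S \<Longrightarrow> (f has_vector_derivative f' x) (at x)" "Ck_on k S f'"
  shows "Ck_on (Suc k) S f"
proof (rule Ck_on_SucI[OF assms(1), where f' = "\<lambda>x v. v *\<^sub>R f' x"])
  show "Ck_on k S (\<lambda>x. v *\<^sub>R f' x)" for v
    by (rule Ck_on_bilinear[OF assms(1) bounded_bilinear_scaleR Ck_on_const[OF assms(1)] assms(3)])
qed (use assms in \<open>auto simp: has_vector_derivative_def\<close>)

text \<open>Smoothness of an explicit family of functions is proved by finding the derivatives within the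
  family, without counting orders of differentiability.\<close>

lemma smooth_on_closed_class:
  assumes "open S" "P f"
    and step: "\<And>f. P f \<Longrightarrow> \<exists>f'. P f' \<and> (\<forall>x\<in>S. (f has_vector_derivative f' x) (at x))"
  shows "smooth_on S f"
proof -
  have "Ck_on k S f" if "P f" for k f
    using that
  proof (induction k arbitrary: f)
    case 0
    then show ?case using step[OF 0]
      by (auto intro!: continuous_at_imp_continuous_on dest: has_vector_derivative_continuous)
  next
    case (Suc k)
    then show ?case using step[OF Suc.prems] Ck_on_Suc_real[OF assms(1)] by metis
  qed
  then show ?thesis using assms by (auto simp: smooth_on_def)
qed

lemma smooth_on_chain:
  assumes "open S" "\<And>n x. x \<in> S \<Longrightarrow> (D n has_vector_derivative D (Suc n) x) (at x)"
  shows "smooth_on S (D n)"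
  by (rule smooth_on_closed_class[where P = "\<lambda>f. \<exists>n. f = D n"]) (use assms in auto)

lemma smooth_on_powr_real: "smooth_on {0<..} (\<lambda>x::real. x powr a)"
proof (rule smooth_on_closed_class[where P = "\<lambda>f. \<exists>c a. f = (\<lambda>x::real. c * x powr a)"])
  fix f :: "real \<Rightarrow> real" assume "\<exists>c a. f = (\<lambda>x. c * x powr a)"
  then obtain c a where f: "f = (\<lambda>x. c * x powr a)" by blast
  show "\<exists>f'. (\<exists>c a. f' = (\<lambda>x. c * x powr a)) \<and> (\<forall>x\<in>{0<..}. (f has_vector_derivative f' x) (at x))"
    unfolding f
    by (rule exI[of _ "\<lambda>x. (c * a) * x powr (a - 1)"])
       (auto simp: has_real_derivative_iff_has_vector_derivative[symmetric] intro!: derivative_eq_intros)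
next
  show "\<exists>c b. (\<lambda>x. x powr a) = (\<lambda>x::real. c * x powr b)" by (rule exI[of _ 1], rule exI[of _ a]) simp
qed simp

lemma smooth_on_powr:
  fixes f :: "'a::real_normed_vector \<Rightarrow> real"
  assumes "open S" "smooth_on S f" "\<And>x. x \<in> S \<Longrightarrow> f x > 0"
  shows "smooth_on S (\<lambda>x. f x powr a)"
  by (rule smooth_on_compose[OF smooth_on_powr_real assms(2)]) (use assms in auto)

lemma smooth_on_inverse:
  fixes f :: "'a::real_normed_vector \<Rightarrow> real"
  assumes "open S" "smooth_on S f" "\<And>x. x \<in> S \<Longrightarrow> f x \<noteq> 0"
  shows "smooth_on S (\<lambda>x. inverse (f x))"
proof -
  have "smooth_on S (\<lambda>x. f x * (f x ^ 2) powr (-1))"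
    by (intro smooth_on_mult smooth_on_powr smooth_on_power assms) (use assms in auto)
  moreover have "f x * (f x ^ 2) powr (-1) = inverse (f x)" if "x \<in> S" for x
    using assms(3)[OF that] by (simp add: powr_minus power2_eq_square)
  ultimately show ?thesis
    using smooth_on_cong[OF assms(1), of "\<lambda>x. f x * (f x ^ 2) powr (-1)" "\<lambda>x. inverse (f x)"] by simp
qed

lemma smooth_on_divide:
  fixes f g :: "'a::real_normed_vector \<Rightarrow> real"
  assumes "open S" "smooth_on S f" "smooth_on S g" "\<And>x. x \<in> S \<Longrightarrow> g x \<noteq> 0"
  shows "smooth_on S (\<lambda>x. f x / g x)"
  unfolding divide_inverse by (intro smooth_on_mult smooth_on_inverse assms) (use assms in auto)


section \<open>Parameter integrals, Hadamard's lemma and inverse functions\<close>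

text \<open>Differentiating under the integral replaces the weight \<open>\<rho> v\<close> by \<open>v * \<rho> v\<close> and \<open>\<phi>\<close> by its derivative. So the
  integrals of this form are a class that is closed under differentiation.\<close>

lemma param_integral_has_vector_derivative:
  fixes \<phi> :: "real \<Rightarrow> 'b::euclidean_space"
  assumes \<rho>: "continuous_on {0..1} \<rho>" and \<phi>: "smooth_on {-a<..<a} \<phi>" and t: "t \<in> {-a<..<a}"
  shows "((\<lambda>t. integral {0..1} (\<lambda>v. \<rho> v *\<^sub>R \<phi> (t * v))) has_vector_derivative
           integral {0..1} (\<lambda>v. (v * \<rho> v) *\<^sub>R vderiv \<phi> (t * v))) (at t)"
proof -
  let ?I = "{-a<..<a}"
  have in_I: "s * v \<in> ?I" if "s \<in> ?I" "v \<in> {0..1}" for s v :: real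
  proof -
    have "\<bar>s * v\<bar> \<le> \<bar>s\<bar>" using that by (simp add: abs_mult mult_left_le)
    then show ?thesis using that by auto
  qed
  have "((\<lambda>t. integral (cbox 0 1) (\<lambda>v. \<rho> v *\<^sub>R \<phi> (t * v))) has_vector_derivative
           integral (cbox 0 1) (\<lambda>v. (v * \<rho> v) *\<^sub>R vderiv \<phi> (t * v))) (at t within ?I)"
  proof (rule leibniz_rule_vector_derivative)
    fix s v :: real assume s: "s \<in> ?I" and v: "v \<in> cbox 0 1"
    then have sv: "s * v \<in> ?I" using in_I by simp
    have "((\<lambda>s. s * v) has_vector_derivative v) (at s)"
      by (auto intro!: derivative_eq_intros simp: has_real_derivative_iff_has_vector_derivative[symmetric])
    from vector_diff_chain_at[OF this has_vector_derivative_vderiv[OF \<phi> sv]]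
    have "((\<lambda>s. \<phi> (s * v)) has_vector_derivative v *\<^sub>R vderiv \<phi> (s * v)) (at s)"
      by (simp add: o_def)
    from has_vector_derivative_scaleR[OF DERIV_const[of "\<rho> v"] this]
    show "((\<lambda>s. \<rho> v *\<^sub>R \<phi> (s * v)) has_vector_derivative (v * \<rho> v) *\<^sub>R vderiv \<phi> (s * v)) (at s within ?I)"
      by (auto simp: mult.commute intro: has_vector_derivative_at_within)
  next
    fix s assume "s \<in> ?I"
    then show "(\<lambda>v. \<rho> v *\<^sub>R \<phi> (s * v)) integrable_on cbox 0 1"
      using \<rho> in_I by (intro integrable_continuous continuous_intros
          continuous_on_compose2[OF smooth_on_continuous[OF \<phi>]]) auto
  next
    have "continuous_on (?I \<times> cbox 0 1) (\<lambda>z. (snd z * \<rho> (snd z)) *\<^sub>R vderiv \<phi> (fst z * snd z))"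
      using in_I
      by (intro continuous_intros continuous_on_compose2[OF \<rho>]
          continuous_on_compose2[OF smooth_on_continuous[OF smooth_on_vderiv[OF _ \<phi>]]]) auto
    then show "continuous_on (?I \<times> cbox 0 1) (\<lambda>(s, v). (v * \<rho> v) *\<^sub>R vderiv \<phi> (s * v))"
      by (simp add: case_prod_unfold)
  qed (use t in auto)
  then show ?thesis using t by (simp add: at_within_open_NO_MATCH)
qed

lemma smooth_on_param_integral:
  fixes \<phi> :: "real \<Rightarrow> 'b::euclidean_space"
  assumes "continuous_on {0..1} \<rho>" "smooth_on {-a<..<a} \<phi>"
  shows "smooth_on {-a<..<a} (\<lambda>t. integral {0..1} (\<lambda>v. \<rho> v *\<^sub>R \<phi> (t * v)))"
proof (rule smooth_on_closed_class[where P = "\<lambda>f. \<exists>\<rho> \<phi> :: real \<Rightarrow> 'b. continuous_on {0..1} \<rho> \<and>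
    smooth_on {-a<..<a} \<phi> \<and> f = (\<lambda>t. integral {0..1} (\<lambda>v. \<rho> v *\<^sub>R \<phi> (t * v)))"])
  fix f assume "\<exists>\<rho> \<phi> :: real \<Rightarrow> 'b. continuous_on {0..1} \<rho> \<and>
    smooth_on {-a<..<a} \<phi> \<and> f = (\<lambda>t. integral {0..1} (\<lambda>v. \<rho> v *\<^sub>R \<phi> (t * v)))"
  then obtain \<rho> and \<phi> :: "real \<Rightarrow> 'b" where \<rho>: "continuous_on {0..1} \<rho>" and \<phi>: "smooth_on {-a<..<a} \<phi>"
    and f: "f = (\<lambda>t. integral {0..1} (\<lambda>v. \<rho> v *\<^sub>R \<phi> (t * v)))" by blast
  have "continuous_on {0..1} (\<lambda>v. v * \<rho> v)" by (intro continuous_intros \<rho>)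
  moreover have "smooth_on {-a<..<a} (vderiv \<phi>)" by (intro smooth_on_vderiv \<phi>) auto
  ultimately show "\<exists>f'. (\<exists>\<rho> \<phi> :: real \<Rightarrow> 'b. continuous_on {0..1} \<rho> \<and>
    smooth_on {-a<..<a} \<phi> \<and> f' = (\<lambda>t. integral {0..1} (\<lambda>v. \<rho> v *\<^sub>R \<phi> (t * v)))) \<and>
    (\<forall>t\<in>{-a<..<a}. (f has_vector_derivative f' t) (at t))"
    unfolding f using param_integral_has_vector_derivative[OF \<rho> \<phi>]
    by (intro exI[of _ "\<lambda>t. integral {0..1} (\<lambda>v. (v * \<rho> v) *\<^sub>R vderiv \<phi> (t * v))"]) blast
qed (use assms in auto)

text \<open>The quotient is \<open>\<integral>\<^sub>0\<^sup>1 v\<^sup>k m(t v) dv\<close>, since \<open>t\<^sup>k\<^sup>+\<^sup>1 v\<^sup>k m(t v)\<close> is the derivative of \<open>f(t v)\<close> in \<open>v\<close>. For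
  \<open>k = 0\<close> this is Hadamard's lemma.\<close>

lemma Hadamard_power:
  fixes f m :: "real \<Rightarrow> 'b::euclidean_space"
  assumes f: "smooth_on {-a<..<a} f" "f 0 = 0" and m: "smooth_on {-a<..<a} m"
    and f': "\<And>t. t \<in> {-a<..<a} \<Longrightarrow> vderiv f t = t ^ k *\<^sub>R m t"
  obtains M where "smooth_on {-a<..<a} M" "\<And>t. t \<in> {-a<..<a} \<Longrightarrow> f t = t ^ Suc k *\<^sub>R M t"
    "M 0 = m 0 /\<^sub>R Suc k"
proof
  let ?M = "\<lambda>t. integral {0..1} (\<lambda>v. v ^ k *\<^sub>R m (t * v))"
  show "smooth_on {-a<..<a} ?M"
    by (rule smooth_on_param_integral[OF _ m]) (intro continuous_intros)
  show "f t = t ^ Suc k *\<^sub>R ?M t" if t: "t \<in> {-a<..<a}" for t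
  proof -
    have "((\<lambda>v. f (t * v)) has_vector_derivative t ^ Suc k *\<^sub>R (v ^ k *\<^sub>R m (t * v))) (at v within {0..1})"
      if v: "v \<in> {0..1}" for v
    proof -
      have "\<bar>t * v\<bar> \<le> \<bar>t\<bar>" using v by (simp add: abs_mult mult_left_le)
      then have tv: "t * v \<in> {-a<..<a}" using t by auto
      have "((\<lambda>v. t * v) has_vector_derivative t) (at v)"
        by (auto intro!: derivative_eq_intros simp: has_real_derivative_iff_has_vector_derivative[symmetric])
      from vector_diff_chain_at[OF this has_vector_derivative_vderiv[OF f(1) tv]]
      show ?thesis
        by (simp add: o_def f'[OF tv] power_mult_distrib mult_ac has_vector_derivative_at_within)
    qed
    from fundamental_theorem_of_calculus[OF _ this]
    have "((\<lambda>v. t ^ Suc k *\<^sub>R (v ^ k *\<^sub>R m (t * v))) has_integral f t) {0..1}" by (simp add: f(2))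
    from integral_unique[OF this, unfolded integral_cmul] show ?thesis by (rule sym)
  qed
  have "((\<lambda>v::real. v ^ Suc k / Suc k) has_vector_derivative v ^ k) (at v within {0..1})" for v
  proof -
    have "((\<lambda>v::real. v ^ Suc k / Suc k) has_real_derivative (1 + real k) * (1 * v ^ k) / Suc k) (at v)"
      by (intro DERIV_cdivide DERIV_power_Suc DERIV_ident)
    then show ?thesis
      by (simp add: has_real_derivative_iff_has_vector_derivative has_vector_derivative_at_within)
  qed
  from fundamental_theorem_of_calculus[of 0 1, OF _ this]
  have "((\<lambda>v::real. v ^ k) has_integral inverse (Suc k)) {0..1}" by (simp add: inverse_eq_divide)
  from integral_unique[OF has_integral_scaleR_left[OF this, of "m 0"]] show "?M 0 = m 0 /\<^sub>R Suc k" by simp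
qed

lemma Hadamard:
  fixes f :: "real \<Rightarrow> 'b::euclidean_space"
  assumes f: "smooth_on {-a<..<a} f" "f 0 = 0"
  obtains g where "smooth_on {-a<..<a} g" "\<And>t. t \<in> {-a<..<a} \<Longrightarrow> f t = t *\<^sub>R g t" "g 0 = vderiv f 0"
  by (rule Hadamard_power[OF f smooth_on_vderiv[OF _ f(1)], of 0]) auto

lemma vderiv_cong_open:
  assumes "open S" "t \<in> S" "\<And>u. u \<in> S \<Longrightarrow> f u = g u"
  shows "vderiv f t = vderiv g t"
proof -
  have "eventually (\<lambda>u. f u = g u) (nhds t)"
    using assms eventually_nhds by blast
  then show ?thesis unfolding vderiv_def by (intro vector_derivative_cong_eq) auto
qed

lemma strict_mono_open_image:
  fixes \<tau> :: "real \<Rightarrow> real"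
  assumes "strict_mono_on S \<tau>" "continuous_on S \<tau>" "open U" "U \<subseteq> S"
  shows "open (\<tau> ` U)"
  unfolding open_contains_ball
proof
  fix y assume "y \<in> \<tau> ` U"
  then obtain t where t: "t \<in> U" "y = \<tau> t" by blast
  obtain e where e: "e > 0" "cball t e \<subseteq> U" using \<open>open U\<close> t open_contains_cball by blast
  then have sub: "{t - e..t + e} \<subseteq> U" by (simp add: cball_eq_atLeastAtMost)
  have "t - e \<in> S" "t \<in> S" "t + e \<in> S" using sub e assms(4) by (auto simp: subset_iff)
  then have less: "\<tau> (t - e) < y" "y < \<tau> (t + e)"
    using e strict_mono_onD[OF assms(1)] t by auto
  have cont: "continuous_on {t - e..t + e} \<tau>"
    using assms(2,4) sub by (meson continuous_on_subset subset_trans)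
  have "z \<in> \<tau> ` U" if "\<tau> (t - e) \<le> z" "z \<le> \<tau> (t + e)" for z
    using IVT'[of \<tau> "t - e" z "t + e"] that cont e sub by fastforce
  moreover define d where "d = min (y - \<tau> (t - e)) (\<tau> (t + e) - y)"
  ultimately have "ball y d \<subseteq> \<tau> ` U" by (auto simp: ball_def dist_real_def)
  moreover have "d > 0" using less by (simp add: d_def)
  ultimately show "\<exists>d>0. ball y d \<subseteq> \<tau> ` U" by blast
qed

text \<open>The derivative of the inverse \<open>g\<close> is \<open>(1 / \<tau>') \<circ> g\<close>, so \<open>k\<close>-fold differentiability of \<open>g\<close> gives
  \<open>k\<close>-fold differentiability of its derivative.\<close>

lemma smooth_inverse_function:
  fixes \<tau> :: "real \<Rightarrow> real"
  assumes smooth: "smooth_on {a<..<b} \<tau>" and pos: "\<And>t. t \<in> {a<..<b} \<Longrightarrow> vderiv \<tau> t > 0"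
  obtains g where "homeomorphism {a<..<b} (\<tau> ` {a<..<b}) \<tau> g" "open (\<tau> ` {a<..<b})"
    "smooth_on (\<tau> ` {a<..<b}) g"
    "\<And>t. t \<in> {a<..<b} \<Longrightarrow> (g has_real_derivative inverse (vderiv \<tau> t)) (at (\<tau> t))"
proof -
  let ?S = "{a<..<b}"
  have mono: "strict_mono_on ?S \<tau>"
  proof (rule strict_mono_onI)
    fix x y assume "x \<in> ?S" "y \<in> ?S" "x < y"
    then show "\<tau> x < \<tau> y"
      by (intro DERIV_pos_imp_increasing[of x y \<tau>])
         (auto intro!: exI has_real_derivative_vderiv[OF smooth] pos)
  qed
  have cont: "continuous_on ?S \<tau>" by (rule smooth_on_continuous[OF smooth])
  have op: "open (\<tau> ` U)" if "open U" "U \<subseteq> ?S" for U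
    by (rule strict_mono_open_image[OF mono cont that])
  have "\<exists>g. homeomorphism ?S (\<tau> ` ?S) \<tau> g"
  proof -
    have "openin (top_of_set (\<tau> ` ?S)) (\<tau> ` U)" if "openin (top_of_set ?S) U" for U
      using that op by (simp add: openin_open_eq image_mono open_openin_trans)
    then show ?thesis
      using homeomorphism_injective_open_map[OF cont refl strict_mono_on_imp_inj_on[OF mono]] by metis
  qed
  then obtain g where g: "homeomorphism ?S (\<tau> ` ?S) \<tau> g" ..
  have openT: "open (\<tau> ` ?S)" using op by simp
  have der: "(g has_real_derivative inverse (vderiv \<tau> t)) (at (\<tau> t))" if t: "t \<in> ?S" for t
  proof -
    have gt: "g (\<tau> t) = t" using g t by (simp add: homeomorphism_apply1)
    show ?thesis
    proof (rule has_field_derivative_inverse_basic)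
      show "(\<tau> has_real_derivative vderiv \<tau> t) (at (g (\<tau> t)))"
        unfolding gt by (rule has_real_derivative_vderiv[OF smooth t])
      show "vderiv \<tau> t \<noteq> 0" using pos[OF t] by simp
      show "continuous (at (\<tau> t)) g"
        using homeomorphism_cont2[OF g] openT t continuous_on_eq_continuous_at by blast
    qed (use openT t g in \<open>auto simp: homeomorphism_apply2\<close>)
  qed
  let ?\<psi> = "\<lambda>t. inverse (vderiv \<tau> t)"
  have \<psi>: "smooth_on ?S ?\<psi>"
    using pos by (intro smooth_on_inverse smooth_on_vderiv smooth) force+
  have g': "(g has_vector_derivative ?\<psi> (g y)) (at y)" if "y \<in> \<tau> ` ?S" for y
    using der that g
    by (auto simp: homeomorphism_apply1 has_real_derivative_iff_has_vector_derivative[symmetric])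
  have gS: "g ` (\<tau> ` ?S) \<subseteq> ?S" using homeomorphism_image2[OF g] by simp
  have "Ck_on k (\<tau> ` ?S) g" for k
  proof (induction k)
    case 0
    show ?case using homeomorphism_cont2[OF g] by simp
  next
    case (Suc k)
    show ?case
    proof (rule Ck_on_Suc_real[OF openT g'])
      show "Ck_on k (\<tau> ` ?S) (\<lambda>y. ?\<psi> (g y))"
        by (rule Ck_on_compose[OF openT _ gS _ Suc]) (use \<psi> in \<open>auto simp: smooth_on_def\<close>)
    qed
  qed
  then have "smooth_on (\<tau> ` ?S) g" by (simp add: smooth_on_def)
  with g openT der show ?thesis by (intro that)
qed


section \<open>Asymptotics of the affine invariants at a cusp\<close>

subsection \<open>Second order expansions\<close>

text \<open>The remainder \<open>r\<close> is only required to have a limit. This admits products of \<open>t\<^sup>2\<close> with continuous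
  functions, of which only the value at 0 matters to second order.\<close>

definition jet2 :: "(real \<Rightarrow> real) \<Rightarrow> real \<Rightarrow> real \<Rightarrow> real \<Rightarrow> bool" where
  "jet2 f a b c \<longleftrightarrow> (\<exists>r. (\<forall>\<^sub>F t in at 0. f t = a + b * t + t\<^sup>2 * r t) \<and> (r \<longlongrightarrow> c) (at 0))"

lemma jet2I: "(\<forall>\<^sub>F t in at 0. f t = a + b * t + t\<^sup>2 * r t) \<Longrightarrow> (r \<longlongrightarrow> c) (at 0) \<Longrightarrow> jet2 f a b c"
  unfolding jet2_def by blast

lemma jet2_eq: "jet2 f a b c \<Longrightarrow> a = a' \<Longrightarrow> b = b' \<Longrightarrow> c = c' \<Longrightarrow> jet2 f a' b' c'"
  by simp

lemma jet2_add:
  assumes "jet2 f a b c" "jet2 g a' b' c'"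
  shows "jet2 (\<lambda>t. f t + g t) (a + a') (b + b') (c + c')"
proof -
  from assms obtain r r' where r: "\<forall>\<^sub>F t in at 0. f t = a + b * t + t\<^sup>2 * r t" "(r \<longlongrightarrow> c) (at 0)"
    and r': "\<forall>\<^sub>F t in at 0. g t = a' + b' * t + t\<^sup>2 * r' t" "(r' \<longlongrightarrow> c') (at 0)"
    unfolding jet2_def by blast
  show ?thesis
  proof (rule jet2I)
    show "\<forall>\<^sub>F t in at 0. f t + g t = (a + a') + (b + b') * t + t\<^sup>2 * (r t + r' t)"
      using r(1) r'(1) by eventually_elim (simp add: algebra_simps)
    show "((\<lambda>t. r t + r' t) \<longlongrightarrow> c + c') (at 0)" by (intro tendsto_intros r r')
  qed
qed

lemma jet2_mult:
  assumes "jet2 f a b c" "jet2 g a' b' c'"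
  shows "jet2 (\<lambda>t. f t * g t) (a * a') (a * b' + b * a') (a * c' + b * b' + c * a')"
proof -
  from assms obtain r r' where r: "\<forall>\<^sub>F t in at 0. f t = a + b * t + t\<^sup>2 * r t" "(r \<longlongrightarrow> c) (at 0)"
    and r': "\<forall>\<^sub>F t in at 0. g t = a' + b' * t + t\<^sup>2 * r' t" "(r' \<longlongrightarrow> c') (at 0)"
    unfolding jet2_def by blast
  let ?R = "\<lambda>t. a * r' t + b * b' + r t * a' + t * (b * r' t + r t * b') + t\<^sup>2 * (r t * r' t)"
  show ?thesis
  proof (rule jet2I)
    show "\<forall>\<^sub>F t in at 0. f t * g t = a * a' + (a * b' + b * a') * t + t\<^sup>2 * ?R t"
      using r(1) r'(1) by eventually_elim (simp add: algebra_simps power2_eq_square)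
    have "(?R \<longlongrightarrow> a * c' + b * b' + c * a' + 0 * (b * c' + c * b') + 0\<^sup>2 * (c * c')) (at 0)"
      by (intro tendsto_intros r r')
    then show "(?R \<longlongrightarrow> a * c' + b * b' + c * a') (at 0)" by simp
  qed
qed

lemma jet2_const: "jet2 (\<lambda>t. k) k 0 0"
  by (rule jet2I[where r = "\<lambda>t. 0"]) auto

lemma jet2_mult_var:
  assumes "jet2 f a b c"
  shows "jet2 (\<lambda>t. t * f t) 0 a b"
proof -
  have "jet2 (\<lambda>t. t) 0 1 0" by (rule jet2I[where r = "\<lambda>t. 0"]) auto
  from jet2_mult[OF this assms] show ?thesis by simp
qed

lemma jet2_square_mult:
  assumes "isCont u 0"
  shows "jet2 (\<lambda>t. t\<^sup>2 * u t) 0 0 (u 0)"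
  using assms by (intro jet2I[where r = u]) (auto simp: isCont_def)

lemma jet2_smooth:
  fixes f :: "real \<Rightarrow> real"
  assumes f: "smooth_on {-a<..<a} f" and a: "a > 0"
  shows "jet2 f (f 0) (vderiv f 0) (vderiv (vderiv f) 0 / 2)"
proof -
  have "smooth_on {-a<..<a} (\<lambda>t. f t - f 0)" by (intro smooth_intros f) auto
  from Hadamard[OF this] obtain f1 where f1: "smooth_on {-a<..<a} f1"
    "\<And>t. t \<in> {-a<..<a} \<Longrightarrow> f t - f 0 = t *\<^sub>R f1 t" by auto
  have "smooth_on {-a<..<a} (\<lambda>t. f1 t - f1 0)" by (intro smooth_intros f1) auto
  from Hadamard[OF this] obtain f2 where f2: "smooth_on {-a<..<a} f2"
    "\<And>t. t \<in> {-a<..<a} \<Longrightarrow> f1 t - f1 0 = t *\<^sub>R f2 t" by auto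
  have eq: "f t = f 0 + f1 0 * t + t\<^sup>2 * f2 t" if "t \<in> {-a<..<a}" for t
    using f1(2)[OF that] f2(2)[OF that] by (simp add: algebra_simps power2_eq_square)
  have d1: "vderiv f t = f1 0 + t * (2 * f2 t + t * vderiv f2 t)" if t: "t \<in> {-a<..<a}" for t
  proof (rule vderiv_eq)
    have "((\<lambda>t. f 0 + f1 0 * t + t\<^sup>2 * f2 t) has_real_derivative f1 0 + t * (2 * f2 t + t * vderiv f2 t)) (at t)"
      by (rule derivative_eq_intros has_real_derivative_vderiv[OF f2(1) t] refl)+
         (simp add: algebra_simps power2_eq_square)
    then show "(f has_vector_derivative f1 0 + t * (2 * f2 t + t * vderiv f2 t)) (at t)"
      unfolding has_real_derivative_iff_has_vector_derivative
      by (rule has_vector_derivative_transform_within_open[where S = "{-a<..<a}"])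
         (use t eq[symmetric] in auto)
  qed
  have "vderiv (vderiv f) 0 = vderiv (\<lambda>t. f1 0 + t * (2 * f2 t + t * vderiv f2 t)) 0"
    by (rule vderiv_cong_open[where S = "{-a<..<a}"]) (use a d1 in auto)
  also have "\<dots> = 2 * f2 0"
  proof (rule vderiv_eq)
    define w where "w t = 2 * f2 t + t * vderiv f2 t" for t
    have "smooth_on {-a<..<a} w"
      unfolding w_def by (intro smooth_intros smooth_on_vderiv f2) auto
    from has_real_derivative_vderiv[OF this, of 0] a
    have "(w has_real_derivative vderiv w 0) (at 0)" by simp
    then have "((\<lambda>t. f1 0 + t * w t) has_real_derivative w 0) (at 0)"
      by (auto intro!: derivative_eq_intros)
    then have "((\<lambda>t. f1 0 + t * (2 * f2 t + t * vderiv f2 t)) has_real_derivative 2 * f2 0) (at 0)"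
      by (simp add: w_def)
    then show "((\<lambda>t. f1 0 + t * (2 * f2 t + t * vderiv f2 t)) has_vector_derivative 2 * f2 0) (at 0)"
      by (simp add: has_real_derivative_iff_has_vector_derivative)
  qed
  finally have 2: "vderiv (vderiv f) 0 / 2 = f2 0" by simp
  have 1: "vderiv f 0 = f1 0" using d1[of 0] a by simp
  show ?thesis unfolding 1 2
  proof (rule jet2I)
    have "\<forall>\<^sub>F t in at 0. t \<in> {-a<..<a}" using a by (intro eventually_at_in_open') auto
    then show "\<forall>\<^sub>F t in at 0. f t = f 0 + f1 0 * t + t\<^sup>2 * f2 t"
      by eventually_elim (rule eq)
    show "(f2 \<longlongrightarrow> f2 0) (at 0)"
      using smooth_on_continuous[OF f2(1)] a
      by (simp add: continuous_on_eq_continuous_at isCont_def)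
  qed
qed


subsection \<open>The germ of a cusp\<close>

text \<open>For a cusp, \<open>\<gamma>' = t W\<close> with a smooth field \<open>W\<close> along the curve. The germ is described by the
  functions \<open>g = [W, W']\<close> and \<open>h = [W', W'']\<close>; \<open>\<sigma>\<close> is the sign of \<open>g\<close>. The affine arclength
  element is \<open>|t|\<^bsup>2/3\<^esup> \<phi> dt\<close> and the arclength is \<open>\<plusminus>|t|\<^bsup>5/3\<^esup> q\<close>, where \<open>q\<close> is a smooth average of \<open>\<phi>\<close>.\<close>

locale cusp_germ =
  fixes a \<sigma> :: real and g h :: "real \<Rightarrow> real"
  assumes a_pos: "a > 0"
    and smooth_g: "smooth_on {-a<..<a} g"
    and smooth_h: "smooth_on {-a<..<a} h"
    and sign: "\<sigma> = 1 \<or> \<sigma> = -1"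
    and sign_g: "t \<in> {-a<..<a} \<Longrightarrow> \<sigma> * g t > 0"
begin

abbreviation I :: "real set" where "I \<equiv> {-a<..<a}"

definition \<phi> :: "real \<Rightarrow> real" where
  "\<phi> t = (\<sigma> * g t) powr (1/3)"

definition q :: "real \<Rightarrow> real" where
  "q t = integral {0..1} (\<lambda>v. v powr (2/3) *\<^sub>R \<phi> (t * v))"

lemma zero_in_I: "0 \<in> I" using a_pos by simp

lemma smooth_\<phi>: "smooth_on I \<phi>"
  unfolding \<phi>_def using sign_g by (intro smooth_on_powr smooth_intros smooth_g) auto

lemma \<phi>_pos: "t \<in> I \<Longrightarrow> \<phi> t > 0"
  using sign_g[of t] by (auto simp: \<phi>_def)

lemma sign_mult_g: "t \<in> I \<Longrightarrow> \<sigma> * g t = \<phi> t ^ 3"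
  using sign_g[of t] powr_powr[of "\<sigma> * g t" "1/3" 3] by (simp add: \<phi>_def)

lemma sign_square: "\<sigma> * \<sigma> = 1" using sign by auto

lemma g_eq: "t \<in> I \<Longrightarrow> g t = \<sigma> * \<phi> t ^ 3"
  using sign_mult_g[of t] sign by auto

lemma abs_g: "t \<in> I \<Longrightarrow> \<bar>g t\<bar> = \<phi> t ^ 3"
  using g_eq[of t] \<phi>_pos[of t] sign by (auto simp: abs_mult)

lemma vderiv_g: "t \<in> I \<Longrightarrow> vderiv g t = \<sigma> * (3 * \<phi> t ^ 2 * vderiv \<phi> t)"
proof -
  assume t: "t \<in> I"
  have "vderiv g t = vderiv (\<lambda>t. \<sigma> * \<phi> t ^ 3) t"
    by (rule vderiv_cong_open[of I]) (use t g_eq in auto)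
  also have "\<dots> = \<sigma> * (3 * \<phi> t ^ 2 * vderiv \<phi> t)"
    by (rule vderiv_eq, unfold has_real_derivative_iff_has_vector_derivative[symmetric])
       (rule derivative_eq_intros has_real_derivative_vderiv[OF smooth_\<phi> t] refl | simp)+
  finally show ?thesis .
qed

lemma smooth_\<phi>': "smooth_on I (vderiv \<phi>)" "smooth_on I (vderiv (vderiv \<phi>))"
  by (intro smooth_on_vderiv smooth_\<phi> open_greaterThanLessThan)+

lemma vderiv_vderiv_g:
  assumes t: "t \<in> I"
  shows "vderiv (vderiv g) t = \<sigma> * (6 * \<phi> t * vderiv \<phi> t ^ 2 + 3 * \<phi> t ^ 2 * vderiv (vderiv \<phi>) t)"
proof -
  have "vderiv (vderiv g) t = vderiv (\<lambda>t. \<sigma> * (3 * \<phi> t ^ 2 * vderiv \<phi> t)) t"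
    by (rule vderiv_cong_open[of I]) (use t vderiv_g in auto)
  also have "\<dots> = \<sigma> * (6 * \<phi> t * vderiv \<phi> t ^ 2 + 3 * \<phi> t ^ 2 * vderiv (vderiv \<phi>) t)"
    by (rule vderiv_eq, unfold has_real_derivative_iff_has_vector_derivative[symmetric])
       (rule derivative_eq_intros has_real_derivative_vderiv[OF smooth_\<phi> t]
         has_real_derivative_vderiv[OF smooth_\<phi>'(1) t] refl | simp add: power2_eq_square algebra_simps)+
  finally show ?thesis .
qed

lemma cont_weight: "continuous_on {0..1::real} (\<lambda>v. v powr (2/3))"
  by (intro continuous_on_powr' continuous_intros) auto

lemma smooth_q: "smooth_on I q"
  unfolding q_def by (rule smooth_on_param_integral[OF cont_weight smooth_\<phi>])

lemma scaled_in_I: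
  assumes "t \<in> I" "v \<in> {0..1}"
  shows "t * v \<in> I"
proof -
  have "\<bar>t * v\<bar> \<le> \<bar>t\<bar>" using assms by (simp add: abs_mult mult_left_le)
  then show ?thesis using assms by auto
qed

lemma q_pos:
  assumes t: "t \<in> I"
  shows "q t > 0"
proof -
  let ?w = "\<lambda>v. v powr (2/3) *\<^sub>R \<phi> (t * v)"
  have cont: "continuous_on {0..1} ?w"
    using scaled_in_I[OF t]
    by (intro continuous_on_scaleR cont_weight continuous_on_compose2[OF smooth_on_continuous[OF smooth_\<phi>]]
        continuous_intros) auto
  have nonneg: "?w v \<ge> 0" if "v \<in> {0..1}" for v
    using \<phi>_pos[OF scaled_in_I[OF t that]] by simp
  have "q t \<ge> 0" unfolding q_def by (intro integral_nonneg integrable_continuous_real cont nonneg)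
  moreover have "q t \<noteq> 0"
  proof
    assume "q t = 0"
    then have "\<forall>v\<in>{0..1}. ?w v = 0"
      using integral_eq_0_iff[OF cont _ nonneg] unfolding q_def by auto
    then have "?w 1 = 0" by (rule bspec) simp
    then show False using \<phi>_pos[OF t] by simp
  qed
  ultimately show ?thesis by simp
qed

text \<open>The equation expresses that \<open>\<plusminus>|t|\<^bsup>5/3\<^esup> q\<close> is a primitive of \<open>|t|\<^bsup>2/3\<^esup> \<phi>\<close>. It comes from integrating the
  derivative of \<open>v\<^bsup>5/3\<^esup> \<phi> (t v)\<close> over \<open>v\<close>, and it also yields the Taylor coefficients of \<open>q\<close> at 0.\<close>

lemma q_ode:
  assumes t: "t \<in> I"
  shows "t * vderiv q t + 5/3 * q t = \<phi> t"
proof -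
  have "((\<lambda>v. v powr (5/3) * \<phi> (t * v)) has_vector_derivative
          (5/3) * (v powr (2/3) * \<phi> (t * v)) + t * ((v * v powr (2/3)) * vderiv \<phi> (t * v))) (at v)"
    if v: "v \<in> {0<..<1}" for v
  proof -
    have tv: "t * v \<in> I" using scaled_in_I[OF t] v by simp
    have vv: "v powr (5/3) = v * v powr (2/3)" using v powr_add[of v 1 "2/3"] by simp
    have "((\<lambda>v. v powr (5/3) * \<phi> (t * v)) has_real_derivative
        (5/3 * v powr (5/3 - 1)) * \<phi> (t * v) + v powr (5/3) * (vderiv \<phi> (t * v) * t)) (at v)"
      using v by (auto intro!: derivative_eq_intros
          DERIV_chain2[where f = \<phi> and g = "\<lambda>v. t * v", OF has_real_derivative_vderiv[OF smooth_\<phi> tv]])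
    then show ?thesis
      unfolding has_real_derivative_iff_has_vector_derivative
      by (rule has_vector_derivative_eq_rhs) (simp add: vv)
  qed
  moreover have "continuous_on {0..1} (\<lambda>v. v powr (5/3) * \<phi> (t * v))"
    using scaled_in_I[OF t]
    by (intro continuous_on_mult continuous_on_powr' continuous_on_compose2[OF smooth_on_continuous[OF smooth_\<phi>]]
        continuous_intros) auto
  ultimately have ftc: "((\<lambda>v. (5/3) * (v powr (2/3) * \<phi> (t * v)) + t * ((v * v powr (2/3)) * vderiv \<phi> (t * v)))
      has_integral 1 powr (5/3) * \<phi> (t * 1) - 0 powr (5/3) * \<phi> (t * 0)) {0..1}"
    by (intro fundamental_theorem_of_calculus_interior[where f = "\<lambda>v. v powr (5/3) * \<phi> (t * v)"]) auto
  have i1: "(\<lambda>v. v powr (2/3) * \<phi> (t * v)) integrable_on {0..1}"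
    using scaled_in_I[OF t]
    by (intro integrable_continuous_real continuous_on_mult cont_weight
        continuous_on_compose2[OF smooth_on_continuous[OF smooth_\<phi>]] continuous_intros) auto
  have i2: "(\<lambda>v. (v * v powr (2/3)) * vderiv \<phi> (t * v)) integrable_on {0..1}"
    using scaled_in_I[OF t]
    by (intro integrable_continuous_real continuous_on_mult cont_weight
        continuous_on_compose2[OF smooth_on_continuous[OF smooth_\<phi>'(1)]] continuous_intros) auto
  have q': "vderiv q t = integral {0..1} (\<lambda>v. (v * v powr (2/3)) * vderiv \<phi> (t * v))"
    using vderiv_eq[OF param_integral_has_vector_derivative[OF cont_weight smooth_\<phi> t]]
    unfolding q_def by simp
  have "((\<lambda>v. (5/3) * (v powr (2/3) * \<phi> (t * v)) + t * ((v * v powr (2/3)) * vderiv \<phi> (t * v)))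
      has_integral (5/3) * q t + t * vderiv q t) {0..1}"
    unfolding q' q_def real_scaleR_def
    by (intro has_integral_add has_integral_mult_right integrable_integral i1 i2)
  from has_integral_unique[OF this ftc] show ?thesis by simp
qed

text \<open>By the differential equation of \<open>q\<close>, the right-hand side is a primitive of the arclength element away from 0. At 0 it
  is of order 5/3, so its derivative there is 0, which is also the value of the integrand.\<close>

lemma arclength_integral:
  assumes t: "t \<in> I" and b: "\<And>u. u \<in> I \<Longrightarrow> b u = u\<^sup>2 * g u"
  shows "(LBINT u=0..t. \<bar>b u\<bar> powr (1/3)) = sgn t * \<bar>t\<bar> powr (5/3) * q t"
proof -
  let ?K = "\<lambda>t. sgn t * \<bar>t\<bar> powr (5/3) * q t"
  have der: "(?K has_real_derivative \<bar>u\<bar> powr (2/3) * \<phi> u) (at u)" if u: "u \<in> I" for u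
  proof -
    have dq: "(q has_real_derivative vderiv q u) (at u)" by (rule has_real_derivative_vderiv[OF smooth_q u])
    consider "u > 0" | "u < 0" | "u = 0" by linarith
    then show ?thesis
    proof cases
      case 1
      have "((\<lambda>u. u powr (5/3) * q u) has_real_derivative u powr (2/3) * \<phi> u) (at u)"
        using 1 q_ode[OF u, symmetric] powr_add[of u 1 "2/3"]
        by (auto intro!: derivative_eq_intros dq simp: algebra_simps)
      then have "(?K has_real_derivative u powr (2/3) * \<phi> u) (at u)"
        by (rule has_field_derivative_transform_within_open[of _ _ _ "{0<..}"]) (use 1 in auto)
      then show ?thesis using 1 by simp
    next
      case 2
      have "((\<lambda>u. - ((- u) powr (5/3) * q u)) has_real_derivative (- u) powr (2/3) * \<phi> u) (at u)"
        using 2 q_ode[OF u, symmetric] powr_add[of "-u" 1 "2/3"]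
        by (auto intro!: derivative_eq_intros dq simp: algebra_simps)
      then have "(?K has_real_derivative (- u) powr (2/3) * \<phi> u) (at u)"
        by (rule has_field_derivative_transform_within_open[of _ _ _ "{..<0}"]) (use 2 in auto)
      then show ?thesis using 2 by simp
    next
      case 3
      have "((\<lambda>t. \<bar>t\<bar> powr (2/3) * q t) \<longlongrightarrow> \<bar>0\<bar> powr (2/3) * q 0) (at 0)"
        using DERIV_isCont[OF dq] 3
        by (intro tendsto_mult tendsto_powr' tendsto_intros) (auto simp: isCont_def)
      moreover have "\<forall>\<^sub>F t in at 0. \<bar>t\<bar> powr (2/3) * q t = (?K t - ?K 0) / (t - 0)"
      proof -
        have "\<bar>t\<bar> powr (2/3) * q t = (?K t - ?K 0) / (t - 0)" if "t \<noteq> 0" for t :: real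
        proof -
          have "\<bar>t\<bar> powr (5/3) = \<bar>t\<bar> * \<bar>t\<bar> powr (2/3)"
            using powr_add[of "\<bar>t\<bar>" 1 "2/3"] that by simp
          moreover have "sgn t * \<bar>t\<bar> = t" by (simp add: mult_sgn_abs)
          ultimately show ?thesis using that by (simp add: mult.assoc[symmetric])
        qed
        then show ?thesis by (auto simp: eventually_at_filter)
      qed
      ultimately have "((\<lambda>t. (?K t - ?K 0) / (t - 0)) \<longlongrightarrow> 0) (at 0)"
        by (simp add: tendsto_cong)
      then show ?thesis using 3 by (simp add: has_field_derivative_iff)
    qed
  qed
  have eq: "\<bar>b u\<bar> powr (1/3) = \<bar>u\<bar> powr (2/3) * \<phi> u" if "u \<in> I" for u
  proof -
    have "\<bar>b u\<bar> = \<bar>u\<bar> powr 2 * \<phi> u powr 3"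
      using b[OF that] abs_g[OF that] \<phi>_pos[OF that] by (simp add: abs_mult)
    then show ?thesis using \<phi>_pos[OF that] by (simp add: powr_mult powr_powr del: powr_numeral)
  qed
  have seg: "{min 0 t..max 0 t} \<subseteq> I" using t by auto
  have "(LBINT u=0..t. \<bar>b u\<bar> powr (1/3)) = ?K t - ?K 0"
    unfolding zero_ereal_def
  proof (rule interval_integral_FTC_finite)
    have "continuous_on I (\<lambda>u. \<bar>u\<bar> powr (2/3) * \<phi> u)"
      by (intro continuous_on_mult continuous_on_powr' smooth_on_continuous[OF smooth_\<phi>] continuous_intros) auto
    from continuous_on_eq[OF continuous_on_subset[OF this seg], of "\<lambda>u. \<bar>b u\<bar> powr (1/3)"]
    show "continuous_on {min 0 t..max 0 t} (\<lambda>u. \<bar>b u\<bar> powr (1/3))"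
      using eq seg by (metis subsetD)
    show "(?K has_vector_derivative \<bar>b u\<bar> powr (1/3)) (at u within {min 0 t..max 0 t})"
      if "min 0 t \<le> u" "u \<le> max 0 t" for u
    proof -
      have "u \<in> I" using that seg by auto
      then show ?thesis using der[of u] eq[of u]
        by (simp add: has_real_derivative_iff_has_vector_derivative has_vector_derivative_at_within)
    qed
  qed
  then show ?thesis by simp
qed

definition \<tau> :: "real \<Rightarrow> real" where
  "\<tau> t = t * q t powr (3/5)"

lemma root_arclength:
  assumes t: "t \<in> I" and S: "S = sgn t * \<bar>t\<bar> powr (5/3) * q t"
  shows "sgn S * \<bar>S\<bar> powr (3/5) = \<tau> t"
proof -
  have "sgn S = sgn t" using q_pos[OF t] by (cases "t = 0") (auto simp: S sgn_mult)
  moreover have "\<bar>S\<bar> powr (3/5) = \<bar>t\<bar> * q t powr (3/5)"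
    using q_pos[OF t] by (cases "t = 0") (auto simp: S abs_mult powr_mult powr_powr)
  ultimately show ?thesis by (simp add: \<tau>_def mult.assoc[symmetric] sgn_mult_abs)
qed

lemma smooth_\<tau>: "smooth_on I \<tau>"
  unfolding \<tau>_def using q_pos by (intro smooth_intros smooth_on_powr smooth_q) auto

lemma vderiv_\<tau>_pos:
  assumes t: "t \<in> I"
  shows "vderiv \<tau> t > 0"
proof -
  have "q t powr (3/5) = q t powr (-2/5) * q t"
    using powr_add[of "q t" "-2/5" 1] q_pos[OF t] by simp
  then have "(\<tau> has_real_derivative (3/5) * q t powr (-2/5) * \<phi> t) (at t)"
    unfolding \<tau>_def using q_pos[OF t] q_ode[OF t, symmetric]
    by (auto intro!: derivative_eq_intros has_real_derivative_vderiv[OF smooth_q t] simp: algebra_simps)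
  then have eq: "vderiv \<tau> t = (3/5) * q t powr (-2/5) * \<phi> t"
    by (intro vderiv_eq) (simp add: has_real_derivative_iff_has_vector_derivative)
  show ?thesis unfolding eq using \<phi>_pos[OF t] q_pos[OF t] by simp
qed

text \<open>What remains of \<open>s\<^sub>A\<^sup>2 \<kappa>\<^sub>A\<close> after the powers of \<open>|t|\<close> have been cancelled; \<open>\<phi> ^ 8\<close> is \<open>|g|\<^bsup>8/3\<^esup>\<close>.\<close>

definition F :: "real \<Rightarrow> real" where
  "F t = q t ^ 2 * (4 * g t ^ 2 + t * (g t * vderiv g t) +
     t\<^sup>2 * (3 * (g t * vderiv (vderiv g) t) + 9 * (g t * h t) - 5 * vderiv g t ^ 2)) / (9 * (\<phi> t ^ 8))"

lemma smooth_F: "smooth_on I F"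
  unfolding F_def using \<phi>_pos
  by (intro smooth_on_divide smooth_intros smooth_on_vderiv smooth_q smooth_g smooth_h smooth_\<phi>) force+

text \<open>The numerator of the affine curvature is divisible by \<open>t\<^sup>2\<close>; the fractional powers of
  \<open>|t|\<close> in \<open>s\<^sub>A\<^sup>2\<close> and in the denominator cancel this factor.\<close>

lemma normalized_curvature_eq_F:
  assumes t: "t \<in> I" "t \<noteq> 0" and S: "S = sgn t * \<bar>t\<bar> powr (5/3) * q t"
    and b: "b12 = t\<^sup>2 * g t" "b13 = 2 * t * g t + t\<^sup>2 * vderiv g t"
      "b14 = 3 * t * vderiv g t + t\<^sup>2 * (vderiv (vderiv g) t - h t)"
      "b23 = 2 * g t + t * vderiv g t + t\<^sup>2 * h t"
  shows "S\<^sup>2 * ((3 * b12 * b14 + 12 * b12 * b23 - 5 * b13\<^sup>2) / (9 * \<bar>b12\<bar> powr (8/3))) = F t"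
proof -
  let ?N = "4 * g t ^ 2 + t * (g t * vderiv g t) +
     t\<^sup>2 * (3 * (g t * vderiv (vderiv g) t) + 9 * (g t * h t) - 5 * vderiv g t ^ 2)"
  have num: "3 * b12 * b14 + 12 * b12 * b23 - 5 * b13\<^sup>2 = t\<^sup>2 * ?N"
    unfolding b by algebra
  have "sgn t ^ 2 = 1" using t by (simp add: sgn_if)
  moreover have "(\<bar>t\<bar> powr (5/3))\<^sup>2 = \<bar>t\<bar> powr (10/3)" using t by (simp add: powr_power)
  ultimately have S2: "S\<^sup>2 = \<bar>t\<bar> powr (10/3) * q t ^ 2" by (simp add: S power_mult_distrib)
  have "\<bar>b12\<bar> = \<bar>t\<bar> powr 2 * \<phi> t powr 3"
    using abs_g[OF t(1)] \<phi>_pos[OF t(1)] t by (simp add: b abs_mult)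
  then have "\<bar>b12\<bar> powr (8/3) = \<bar>t\<bar> powr (16/3) * \<phi> t powr 8"
    using \<phi>_pos[OF t(1)] by (simp add: powr_mult powr_powr del: powr_numeral)
  also have "\<bar>t\<bar> powr (16/3) = \<bar>t\<bar> powr (10/3) * t\<^sup>2"
    using t powr_add[of "\<bar>t\<bar>" "10/3" 2] by simp
  also have "\<phi> t powr 8 = \<phi> t ^ 8" using \<phi>_pos[OF t(1)] by simp
  finally show ?thesis
    unfolding num S2 F_def using t \<phi>_pos[OF t(1)] by (simp add: field_simps)
qed

lemma q_jet:
  "q 0 = 3/5 * \<phi> 0" "vderiv q 0 = 3/8 * vderiv \<phi> 0" "vderiv (vderiv q) 0 = 3/11 * vderiv (vderiv \<phi>) 0"
proof -
  \<comment> \<open>Differentiating \<open>t p' + c p = \<psi>\<close> gives an equation of the same form for \<open>p'\<close>, with \<open>c + 1\<close>.\<close>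
  have step: "t * vderiv (vderiv p) t + (c + 1) * vderiv p t = vderiv \<psi> t"
    if p: "smooth_on I p" and eq: "\<And>t. t \<in> I \<Longrightarrow> t * vderiv p t + c * p t = \<psi> t" and t: "t \<in> I"
    for p \<psi> :: "real \<Rightarrow> real" and c t
  proof -
    have "vderiv \<psi> t = vderiv (\<lambda>t. t * vderiv p t + c * p t) t"
      by (rule vderiv_cong_open[of I]) (use t eq in auto)
    also have "\<dots> = t * vderiv (vderiv p) t + (c + 1) * vderiv p t"
      by (rule vderiv_eq, unfold has_real_derivative_iff_has_vector_derivative[symmetric])
        (rule derivative_eq_intros has_real_derivative_vderiv[OF p t] refl
          has_real_derivative_vderiv[OF smooth_on_vderiv[OF _ p] t] | simp add: algebra_simps)+
    finally show ?thesis by simp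
  qed
  have 1: "t * vderiv (vderiv q) t + 8/3 * vderiv q t = vderiv \<phi> t" if "t \<in> I" for t
    using step[OF smooth_q q_ode that] by simp
  have 2: "t * vderiv (vderiv (vderiv q)) t + 11/3 * vderiv (vderiv q) t = vderiv (vderiv \<phi>) t" if "t \<in> I" for t
    using step[OF smooth_on_vderiv[OF _ smooth_q] 1 that] by simp
  show "q 0 = 3/5 * \<phi> 0" "vderiv q 0 = 3/8 * vderiv \<phi> 0"
    "vderiv (vderiv q) 0 = 3/11 * vderiv (vderiv \<phi>) 0"
    using q_ode[OF zero_in_I] 1[OF zero_in_I] 2[OF zero_in_I] by auto
qed

text \<open>The second Taylor coefficient at 0 of the normalized curvature.\<close>

definition f2 :: real where
  "f2 = 108/275 * vderiv (vderiv \<phi>) 0 / \<phi> 0 - 459/400 * (vderiv \<phi> 0 / \<phi> 0)\<^sup>2 + 9/25 * \<sigma> * h 0 / \<phi> 0 ^ 3"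

text \<open>Written in terms of \<open>\<phi>\<close>, the difference \<open>F - 4/25\<close> is a quotient with denominator \<open>225 \<phi> ^ 5\<close> whose numerator \<open>P\<close> is a
  polynomial in \<open>t\<close>, \<open>q\<close>, \<open>\<phi>\<close>, the derivatives of \<open>\<phi>\<close>, and \<open>h\<close>. Its expansion is obtained from those
  of \<open>q\<close> and \<open>\<phi>\<close> by multiplication; the coefficients of order 0 and 1 cancel.\<close>

lemma F_expansion: "((\<lambda>t. (F t - 4/25) / t\<^sup>2) \<longlongrightarrow> f2) (at 0)"
proof -
  let ?u = "\<lambda>t. 9 * \<phi> t ^ 2 * vderiv (vderiv \<phi>) t - 27 * \<phi> t * vderiv \<phi> t ^ 2 + 9 * \<sigma> * h t"
  define M where "M t = 4 * (\<phi> t * (\<phi> t * \<phi> t)) + (t * (3 * (\<phi> t * (\<phi> t * vderiv \<phi> t))) + t\<^sup>2 * ?u t)" for t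
  define P where "P t = 25 * (q t * (q t * M t)) + (-36) * (\<phi> t * (\<phi> t * (\<phi> t * (\<phi> t * \<phi> t))))" for t
  have F_eq: "F t - 4/25 = P t / (225 * \<phi> t ^ 5)" if t: "t \<in> I" for t
  proof -
    let ?N = "4 * g t ^ 2 + t * (g t * vderiv g t) +
     t\<^sup>2 * (3 * (g t * vderiv (vderiv g) t) + 9 * (g t * h t) - 5 * vderiv g t ^ 2)"
    have N: "?N = \<phi> t ^ 3 * M t"
      unfolding M_def g_eq[OF t] vderiv_g[OF t] vderiv_vderiv_g[OF t]
      using sign_square by algebra
    have "F t = q t ^ 2 * M t / (9 * \<phi> t ^ 5)"
      unfolding F_def N using \<phi>_pos[OF t] by (simp add: field_simps flip: power_add)
    then show ?thesis
      using \<phi>_pos[OF t] by (simp add: P_def field_simps power2_eq_square eval_nat_numeral)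
  qed
  have ju: "jet2 (\<lambda>t. t\<^sup>2 * ?u t) 0 0 (?u 0)"
  proof (rule jet2_square_mult)
    have "continuous_on I ?u"
      by (intro smooth_on_continuous smooth_intros smooth_\<phi> smooth_\<phi>' smooth_h) auto
    then show "isCont ?u 0" using zero_in_I by (simp add: continuous_on_eq_continuous_at)
  qed
  note j\<phi> = jet2_smooth[OF smooth_\<phi> a_pos] and j\<phi>' = jet2_smooth[OF smooth_\<phi>'(1) a_pos]
    and jq = jet2_smooth[OF smooth_q a_pos, unfolded q_jet]
  note jM = jet2_add[OF jet2_mult[OF jet2_const[of 4] jet2_mult[OF j\<phi> jet2_mult[OF j\<phi> j\<phi>]]]
      jet2_add[OF jet2_mult_var[OF jet2_mult[OF jet2_const[of 3] jet2_mult[OF j\<phi> jet2_mult[OF j\<phi> j\<phi>']]]] ju],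
      folded M_def]
  note jP = jet2_add[OF jet2_mult[OF jet2_const[of 25] jet2_mult[OF jq jet2_mult[OF jq jM]]]
      jet2_mult[OF jet2_const[of "-36"] jet2_mult[OF j\<phi> jet2_mult[OF j\<phi> jet2_mult[OF j\<phi> jet2_mult[OF j\<phi> j\<phi>]]]]],
      folded P_def]
  have \<phi>0: "\<phi> 0 \<noteq> 0" using \<phi>_pos[OF zero_in_I] by simp
  have "jet2 P 0 0 (225 * \<phi> 0 ^ 5 * f2)"
  proof -
    have c: "225 * \<phi> 0 ^ 5 * f2 = 225 * (108/275 * vderiv (vderiv \<phi>) 0 * \<phi> 0 ^ 4
       - 459/400 * vderiv \<phi> 0 ^ 2 * \<phi> 0 ^ 3 + 9/25 * \<sigma> * h 0 * \<phi> 0 ^ 2)"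
      unfolding f2_def using \<phi>0 by (simp add: field_simps eval_nat_numeral)
    show ?thesis
      unfolding c by (rule jet2_eq[OF jP]) (simp_all add: eval_nat_numeral field_simps)
  qed
  then obtain r where r: "\<forall>\<^sub>F t in at 0. P t = t\<^sup>2 * r t" "(r \<longlongrightarrow> 225 * \<phi> 0 ^ 5 * f2) (at 0)"
    unfolding jet2_def by auto
  have "isCont \<phi> 0"
    using smooth_on_continuous[OF smooth_\<phi>] zero_in_I by (simp add: continuous_on_eq_continuous_at)
  then have "((\<lambda>t. r t / (225 * \<phi> t ^ 5)) \<longlongrightarrow> 225 * \<phi> 0 ^ 5 * f2 / (225 * \<phi> 0 ^ 5)) (at 0)"
    using \<phi>0 by (intro tendsto_intros r) (auto simp: isCont_def)
  moreover have "\<forall>\<^sub>F t in at 0. r t / (225 * \<phi> t ^ 5) = (F t - 4/25) / t\<^sup>2"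
  proof -
    have "\<forall>\<^sub>F t in at 0. t \<in> I \<and> t \<noteq> 0"
      using a_pos by (auto simp: eventually_at intro!: exI[of _ a])
    with r(1) show ?thesis by eventually_elim (simp add: F_eq)
  qed
  ultimately show ?thesis using \<phi>0 by (simp add: tendsto_cong)
qed

lemma F_0: "F 0 = 4/25"
  using \<phi>_pos[OF zero_in_I] sign_square g_eq[OF zero_in_I]
  by (simp add: F_def q_jet power_mult_distrib power2_eq_square[of \<sigma>] field_simps eval_nat_numeral)

lemma F_deriv_0: "(F has_real_derivative 0) (at 0)"
proof -
  have "((\<lambda>t. t * ((F t - 4/25) / t\<^sup>2)) \<longlongrightarrow> 0 * f2) (at 0)" by (intro tendsto_intros F_expansion)
  moreover have "t * ((F t - 4/25) / t\<^sup>2) = (F t - F 0) / (t - 0)" for t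
    by (simp add: F_0 power2_eq_square)
  ultimately show ?thesis by (simp add: has_field_derivative_iff)
qed

text \<open>The numerator of the cuspidal curvature is the multiple \<open>(4400/3) \<phi>(0)\<^sup>6\<close> of \<open>f2\<close>, and
  \<open>\<tau>\<^sup>2\<close> is \<open>t\<^sup>2 q\<^bsup>6/5\<^esup>\<close> with \<open>q(0) = (3/5) \<phi>(0)\<close>. What is left is an identity between powers of
  numbers, \<open>(3/5)\<^bsup>6/5\<^esup> (20/3)\<^bsup>6/5\<^esup> = 2\<^bsup>12/5\<^esup>\<close>.\<close>

lemma curvature_limit:
  assumes \<mu>: "\<mu> = (24 * b23 * b25 + 60 * b23 * b34 - 35 * b24\<^sup>2) / \<bar>b23\<bar> powr (12/5)"
    and b: "b23 = 2 * g 0" "b24 = 3 * vderiv g 0" "b25 = 4 * (vderiv (vderiv g) 0 - h 0)" "b34 = 6 * h 0"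
  shows "((\<lambda>t. (F t - 4/25) / \<tau> t ^ 2) \<longlongrightarrow> 1/220 * root 5 (20/3) * \<mu>) (at 0)"
proof -
  let ?p = "\<phi> 0"
  have p: "?p > 0" and q0: "q 0 > 0" using \<phi>_pos[OF zero_in_I] q_pos[OF zero_in_I] by auto
  have N: "24 * b23 * b25 + 60 * b23 * b34 - 35 * b24\<^sup>2 = 4400/3 * ?p ^ 6 * f2"
  proof -
    have "24 * b23 * b25 + 60 * b23 * b34 - 35 * b24\<^sup>2 =
      (\<sigma> * \<sigma>) * (576 * ?p ^ 5 * vderiv (vderiv \<phi>) 0 - 1683 * ?p ^ 4 * vderiv \<phi> 0 ^ 2) + 528 * \<sigma> * ?p ^ 3 * h 0"
      unfolding b g_eq[OF zero_in_I] vderiv_g[OF zero_in_I] vderiv_vderiv_g[OF zero_in_I]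
      by algebra
    also have "\<dots> = 4400/3 * ?p ^ 6 * f2"
      unfolding sign_square f2_def using p by (simp add: field_simps eval_nat_numeral)
    finally show ?thesis .
  qed
  have "\<bar>b23\<bar> = 2 * ?p powr 3" using abs_g[OF zero_in_I] p by (simp add: b abs_mult)
  then have D: "\<bar>b23\<bar> powr (12/5) = 2 powr (12/5) * ?p powr (36/5)" using p by (simp add: powr_mult powr_powr del: powr_numeral)
  have "q 0 powr (6/5) * (1/220 * root 5 (20/3) * \<mu>) = f2"
  proof -
    have "q 0 powr (6/5) = (3/5) powr (6/5) * ?p powr (6/5)"
      using p powr_mult[of "3/5" ?p "6/5"] by (simp only: q_jet)
    moreover have "?p ^ 6 = ?p powr 6" using p by simp
    moreover have "?p powr (6/5) * ?p powr 6 = ?p powr (36/5)" by (simp flip: powr_add)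
    moreover have "root 5 (20/3) = (20/3) powr (1/5)" by (simp add: root_powr_inverse)
    moreover have "(3/5) powr (6/5) * ((20/3) powr (1/5) * (20/3)) = (2::real) powr (12/5)"
    proof -
      have "(20/3) powr (1/5) * (20/3) = (20/3::real) powr (6/5)"
        using powr_add[of "20/3::real" "1/5" 1] by simp
      moreover have "(3/5) powr (6/5) * (20/3) powr (6/5) = (4::real) powr (6/5)" by (simp flip: powr_mult)
      moreover have "(4::real) powr (6/5) = (2 powr 2) powr (6/5)" by simp
      ultimately show ?thesis by (simp only: powr_powr) simp
    qed
    ultimately have "q 0 powr (6/5) * (1/220 * root 5 (20/3) * (4400/3 * ?p ^ 6 * f2)) =
        2 powr (12/5) * ?p powr (36/5) * f2"
      by algebra
    then show ?thesis unfolding \<mu> N D using p by (simp add: field_simps)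
  qed
  then have lim: "1/220 * root 5 (20/3) * \<mu> = f2 / q 0 powr (6/5)" using q0 by (simp add: field_simps)
  have "((\<lambda>t. (F t - 4/25) / t\<^sup>2 / q t powr (6/5)) \<longlongrightarrow> f2 / q 0 powr (6/5)) (at 0)"
    using q0 smooth_on_continuous[OF smooth_q] zero_in_I
    by (intro tendsto_intros F_expansion) (auto simp: continuous_on_eq_continuous_at isCont_def)
  moreover have "\<forall>\<^sub>F t in at 0. (F t - 4/25) / t\<^sup>2 / q t powr (6/5) = (F t - 4/25) / \<tau> t ^ 2"
  proof -
    have "\<forall>\<^sub>F t in at 0. t \<in> I"
      using a_pos by (intro eventually_at_in_open') auto
    then show ?thesis
    proof eventually_elim
      fix t assume "t \<in> I"
      from q_pos[OF this] have "(q t powr (3/5))\<^sup>2 = q t powr (6/5)" by (simp add: powr_power)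
      then show "(F t - 4/25) / t\<^sup>2 / q t powr (6/5) = (F t - 4/25) / \<tau> t ^ 2"
        by (simp add: \<tau>_def power_mult_distrib)
    qed
  qed
  ultimately show ?thesis unfolding lim by (rule Lim_transform_eventually)
qed

end


section \<open>Charts, tangent vectors and the connection\<close>

lemma vec2_expand: "(v::real^2) = v $ 1 *\<^sub>R axis 1 1 + v $ 2 *\<^sub>R axis 2 1"
  by (simp add: vec_eq_iff forall_2 axis_def)

lemma linear_vec2:
  fixes L :: "real^2 \<Rightarrow> 'b::real_vector"
  assumes "linear L"
  shows "L v = v $ 1 *\<^sub>R L (axis 1 1) + v $ 2 *\<^sub>R L (axis 2 1)"
  by (subst vec2_expand) (simp add: linear_add[OF assms] linear_scale[OF assms])

definition det2 :: "real^2 \<Rightarrow> real^2 \<Rightarrow> real" where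
  "det2 u v = u $ 1 * v $ 2 - u $ 2 * v $ 1"

lemma smooth_on_det2:
  "open S \<Longrightarrow> smooth_on S f \<Longrightarrow> smooth_on S g \<Longrightarrow> smooth_on S (\<lambda>x. det2 (f x) (g x))"
  unfolding det2_def by (intro smooth_intros)

lemma chart_homeomorphism: "is_chart c \<Longrightarrow> homeomorphism (dom_of c) (coord c ` dom_of c) (coord c) (param c)"
  and chart_open_dom: "is_chart c \<Longrightarrow> open (dom_of c)"
  by (auto simp: is_chart_def)

lemma param_coord: "is_chart c \<Longrightarrow> p \<in> dom_of c \<Longrightarrow> param c (coord c p) = p"
  using chart_homeomorphism homeomorphism_apply1 by metis

lemma chart_open_image:
  assumes c: "is_chart c" and W: "open W"
  shows "open (coord c ` (dom_of c \<inter> W))"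
proof -
  have "continuous_on (coord c ` dom_of c) (param c)"
    using homeomorphism_cont2[OF chart_homeomorphism[OF c]] .
  moreover have "open (coord c ` dom_of c)" using c by (auto simp: is_chart_def)
  ultimately have "open (coord c ` dom_of c \<inter> param c -` W)"
    using W by (simp add: continuous_on_open_vimage Int_commute)
  also have "coord c ` dom_of c \<inter> param c -` W = coord c ` (dom_of c \<inter> W)"
    using param_coord[OF c] by (auto simp del: ex_simps)
  finally show ?thesis .
qed

locale equiaffine =
  fixes A :: "'m::{t2_space,second_countable_topology} chart set"
    and D :: "'m connection" and \<Omega> :: "'m form2"
  assumes equiaffine: "equiaffine_2_manifold A D \<Omega>"
begin

lemma is_chart: "c \<in> A \<Longrightarrow> is_chart c"
  using equiaffine by (auto simp: equiaffine_2_manifold_def oriented_atlas_def)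

lemma open_dom: "c \<in> A \<Longrightarrow> open (dom_of c)"
  using is_chart chart_open_dom by blast

lemma ex_chart: "\<exists>c\<in>A. p \<in> dom_of c"
proof -
  have "p \<in> (\<Union>c\<in>A. dom_of c)"
    using equiaffine by (auto simp: equiaffine_2_manifold_def oriented_atlas_def)
  then show ?thesis by blast
qed

lemma open_image: "c \<in> A \<Longrightarrow> open W \<Longrightarrow> open (coord c ` (dom_of c \<inter> W))"
  using chart_open_image is_chart by blast

lemma open_coord_dom: "c \<in> A \<Longrightarrow> open (coord c ` dom_of c)"
  using open_image[of c UNIV] by simp

lemma par_co [simp]: "c \<in> A \<Longrightarrow> p \<in> dom_of c \<Longrightarrow> param c (coord c p) = p"
  using param_coord is_chart by blast

lemma smooth_transition:
  assumes "c \<in> A" "c' \<in> A"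
  shows "smooth_on (coord c ` (dom_of c \<inter> dom_of c')) (transition c c')"
  using equiaffine assms by (auto simp: equiaffine_2_manifold_def oriented_atlas_def compatible_def)

text \<open>The differential of a change of charts, as a function of the point of the manifold.\<close>

definition dtrans :: "'m chart \<Rightarrow> 'm chart \<Rightarrow> 'm \<Rightarrow> real^2 \<Rightarrow> real^2" where
  "dtrans c c' p = frechet_derivative (transition c c') (at (coord c p))"

lemma has_derivative_transition:
  assumes "c \<in> A" "c' \<in> A" "p \<in> dom_of c" "p \<in> dom_of c'"
  shows "(transition c c' has_derivative dtrans c c' p) (at (coord c p))"
  unfolding dtrans_def using assms by (intro smooth_on_derivative(1)[OF smooth_transition]) auto

lemma linear_dtrans:
  assumes "c \<in> A" "c' \<in> A" "p \<in> dom_of c" "p \<in> dom_of c'"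
  shows "linear (dtrans c c' p)"
  using has_derivative_transition[OF assms] has_derivative_linear by blast

lemma dtrans_cocycle:
  assumes c: "c \<in> A" "c' \<in> A" "c'' \<in> A" and p: "p \<in> dom_of c" "p \<in> dom_of c'" "p \<in> dom_of c''"
  shows "dtrans c' c'' p (dtrans c c' p v) = dtrans c c'' p v"
proof -
  let ?W = "dom_of c' \<inter> dom_of c''"
  have "(transition c' c'' has_derivative dtrans c' c'' p) (at (transition c c' (coord c p)))"
    using has_derivative_transition[OF c(2,3) p(2,3)] par_co[OF c(1) p(1)] by simp
  from diff_chain_at[OF has_derivative_transition[OF c(1,2) p(1,2)] this]
  have "(transition c' c'' \<circ> transition c c' has_derivative dtrans c' c'' p \<circ> dtrans c c' p) (at (coord c p))" .
  then have "(transition c c'' has_derivative dtrans c' c'' p \<circ> dtrans c c' p) (at (coord c p))"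
  proof (rule has_derivative_transform_within_open[where s = "coord c ` (dom_of c \<inter> ?W)"])
    show "open (coord c ` (dom_of c \<inter> ?W))" using c by (intro open_image open_Int open_dom)
    show "coord c p \<in> coord c ` (dom_of c \<inter> ?W)" using p by blast
  qed (use c in auto)
  from has_derivative_unique[OF this has_derivative_transition[OF c(1,3) p(1,3)]]
  have "dtrans c' c'' p \<circ> dtrans c c' p = dtrans c c'' p" .
  from fun_cong[OF this, of v] show ?thesis by simp
qed

lemma dtrans_self: "c \<in> A \<Longrightarrow> p \<in> dom_of c \<Longrightarrow> dtrans c c p v = v"
proof -
  assume c: "c \<in> A" "p \<in> dom_of c"
  have "(transition c c has_derivative (\<lambda>v. v)) (at (coord c p))"
    by (rule has_derivative_transform_within_open[where s = "coord c ` dom_of c", OF has_derivative_ident])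
       (use c open_coord_dom in auto)
  from has_derivative_unique[OF this has_derivative_transition[OF c(1) c(1) c(2) c(2)]]
  show ?thesis by metis
qed

lemma smooth_dtrans:
  assumes c: "c \<in> A" "c' \<in> A"
  shows "smooth_on (coord c ` (dom_of c \<inter> dom_of c')) (\<lambda>x. dtrans c c' (param c x) v)"
proof -
  have eq: "frechet_derivative (transition c c') (at x) v = dtrans c c' (param c x) v"
    if "x \<in> coord c ` (dom_of c \<inter> dom_of c')" for x
    using that c by (auto simp: dtrans_def)
  have "smooth_on (coord c ` (dom_of c \<inter> dom_of c')) (\<lambda>x. frechet_derivative (transition c c') (at x) v)"
    by (rule smooth_on_derivative(2)[OF smooth_transition[OF c]])
  then show ?thesis
    using smooth_on_cong[OF open_image[OF c(1) open_dom[OF c(2)]] eq] by simp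
qed

lemma smooth_change_chart:
  fixes f :: "'m \<Rightarrow> 'b::real_normed_vector"
  assumes c: "c \<in> A" "c' \<in> A" and W: "open W"
    and f: "smooth_on (coord c ` (dom_of c \<inter> W)) (\<lambda>x. f (param c x))"
  shows "smooth_on (coord c' ` (dom_of c' \<inter> (dom_of c \<inter> W))) (\<lambda>x. f (param c' x))"
proof -
  have o: "open (coord c' ` (dom_of c' \<inter> (dom_of c \<inter> W)))" using c W by (intro open_image open_Int open_dom)
  have "smooth_on (coord c' ` (dom_of c' \<inter> (dom_of c \<inter> W))) (\<lambda>x. f (param c (transition c' c x)))"
    by (rule smooth_on_compose[OF f smooth_on_subset[OF smooth_transition[OF c(2,1)]]])
       (use c W open_image o in auto)
  then show ?thesis using c by (subst smooth_on_cong[OF o]) auto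
qed


subsection \<open>Tangent vectors and vector fields\<close>

lemma tangentD0: "v \<in> tangent_space A p \<Longrightarrow> \<not> (c \<in> A \<and> p \<in> dom_of c) \<Longrightarrow> v c = 0"
  and tangentD: "v \<in> tangent_space A p \<Longrightarrow> c \<in> A \<Longrightarrow> c' \<in> A \<Longrightarrow> p \<in> dom_of c \<Longrightarrow> p \<in> dom_of c' \<Longrightarrow>
    v c' = dtrans c c' p (v c)"
  unfolding tangent_space_def dtrans_def by blast+

lemma tangentI:
  "(\<And>c. \<not> (c \<in> A \<and> p \<in> dom_of c) \<Longrightarrow> v c = 0) \<Longrightarrow>
   (\<And>c c'. c \<in> A \<Longrightarrow> c' \<in> A \<Longrightarrow> p \<in> dom_of c \<Longrightarrow> p \<in> dom_of c' \<Longrightarrow> v c' = dtrans c c' p (v c)) \<Longrightarrow>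
   v \<in> tangent_space A p"
  unfolding tangent_space_def dtrans_def by blast

lemma tangent_eqI:
  assumes "u \<in> tangent_space A p" "v \<in> tangent_space A p" "c \<in> A" "p \<in> dom_of c" "u c = v c"
  shows "u = v"
proof
  fix c' show "u c' = v c'"
    using assms tangentD0[of u p c'] tangentD0[of v p c'] tangentD[of u p c c'] tangentD[of v p c c']
    by (cases "c' \<in> A \<and> p \<in> dom_of c'") auto
qed

lemma tangent_lincomb:
  assumes "u \<in> tangent_space A p" "v \<in> tangent_space A p"
  shows "(\<lambda>c. x *\<^sub>R u c + y *\<^sub>R v c) \<in> tangent_space A p"
proof (rule tangentI)
  fix c c' assume c: "c \<in> A" "c' \<in> A" "p \<in> dom_of c" "p \<in> dom_of c'"
  show "x *\<^sub>R u c' + y *\<^sub>R v c' = dtrans c c' p (x *\<^sub>R u c + y *\<^sub>R v c)"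
    using tangentD[OF assms(1) c] tangentD[OF assms(2) c]
    by (simp add: linear_add[OF linear_dtrans[OF c]] linear_scale[OF linear_dtrans[OF c]])
qed (auto simp: tangentD0[OF assms(1)] tangentD0[OF assms(2)])

lemma tangent_scale: "u \<in> tangent_space A p \<Longrightarrow> (\<lambda>c. x *\<^sub>R u c) \<in> tangent_space A p"
  using tangent_lincomb[of u p u x 0] by simp

text \<open>The components in one chart determine the whole family, so that tangent vectors and vector
  fields along curves can be constructed in a single chart.\<close>

definition tvec :: "'m chart \<Rightarrow> 'm \<Rightarrow> real^2 \<Rightarrow> 'm tvec" where
  "tvec c p w = (\<lambda>c'. if c' \<in> A \<and> p \<in> dom_of c' then dtrans c c' p w else 0)"

lemma tvec_self: "c \<in> A \<Longrightarrow> p \<in> dom_of c \<Longrightarrow> tvec c p w c = w"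
  by (simp add: tvec_def dtrans_self)

lemma tvec_tangent:
  assumes "c \<in> A" "p \<in> dom_of c"
  shows "tvec c p w \<in> tangent_space A p"
  by (rule tangentI) (auto simp: tvec_def dtrans_cocycle assms)

lemma coord_field_eq: "p \<in> dom_of c \<Longrightarrow> coord_field A c j p = tvec c p (axis j 1)"
  by (auto simp: coord_field_def tvec_def dtrans_def)

lemma coord_field_self: "c \<in> A \<Longrightarrow> p \<in> dom_of c \<Longrightarrow> coord_field A c j p c = axis j 1"
  by (simp add: coord_field_eq tvec_self)

lemma coord_field_tangent: "c \<in> A \<Longrightarrow> p \<in> dom_of c \<Longrightarrow> coord_field A c j p \<in> tangent_space A p"
  by (simp add: coord_field_eq tvec_tangent)

lemma tangent_expand:
  assumes "v \<in> tangent_space A p" "c \<in> A" "p \<in> dom_of c"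
  shows "v = (\<lambda>c'. v c $ 1 *\<^sub>R coord_field A c 1 p c' + v c $ 2 *\<^sub>R coord_field A c 2 p c')"
  by (rule tangent_eqI[OF assms(1) tangent_lincomb assms(2,3)])
     (auto simp: coord_field_tangent coord_field_self assms vec2_expand[of "v c", symmetric])

lemma vector_field_coord_field:
  assumes c: "c \<in> A" and W: "open W" "W \<subseteq> dom_of c"
  shows "vector_field A W (coord_field A c j)"
  unfolding vector_field_def
proof (intro conjI ballI)
  fix c' assume c': "c' \<in> A"
  have "smooth_on (coord c ` (dom_of c \<inter> (dom_of c' \<inter> W))) (\<lambda>x. dtrans c c' (param c x) (axis j 1))"
    by (rule smooth_on_subset[OF smooth_dtrans[OF c c']]) auto
  from smooth_change_chart[OF c c' _ this]
  have sm: "smooth_on (coord c' ` (dom_of c' \<inter> (dom_of c \<inter> (dom_of c' \<inter> W)))) (\<lambda>x. dtrans c c' (param c' x) (axis j 1))"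
    using W open_dom[OF c'] by auto
  have eq: "dom_of c' \<inter> (dom_of c \<inter> (dom_of c' \<inter> W)) = dom_of c' \<inter> W" using W by auto
  show "smooth_on (coord c' ` (dom_of c' \<inter> W)) (\<lambda>x. coord_field A c j (param c' x) c')"
    using sm W c' unfolding eq
    by (subst smooth_on_cong[OF open_image[OF c' W(1)], where g = "\<lambda>x. dtrans c c' (param c' x) (axis j 1)"])
       (auto simp: coord_field_eq tvec_def)
qed (use W c coord_field_tangent in blast)

lemma smooth_functionI:
  assumes c: "c \<in> A" and W: "open W" "W \<subseteq> dom_of c"
    and f: "smooth_on (coord c ` W) (\<lambda>x. f (param c x))"
  shows "smooth_function A W f"
  unfolding smooth_function_def o_def
proof
  fix c' assume c': "c' \<in> A"
  have eq: "dom_of c \<inter> W = W" using W by auto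
  from smooth_change_chart[OF c c' W(1), of f] f show "smooth_on (coord c' ` (dom_of c' \<inter> W)) (\<lambda>x. f (param c' x))"
    by (simp add: eq)
qed

lemma vector_field_scale:
  assumes "vector_field A W X" "smooth_function A W f" "open W"
  shows "vector_field A W (\<lambda>p c. f p *\<^sub>R X p c)"
  using assms open_image
  by (auto simp: vector_field_def smooth_function_def o_def tangent_scale intro!: smooth_on_scaleR)


subsection \<open>The area form and the connection in a chart\<close>

lemma two_form: "two_form A \<Omega>"
  using equiaffine unfolding equiaffine_2_manifold_def by simp

lemma \<Omega>_anti: "u \<in> tangent_space A p \<Longrightarrow> v \<in> tangent_space A p \<Longrightarrow> \<Omega> p u v = - \<Omega> p v u"
  by (rule two_form[unfolded two_form_def, THEN conjunct1, THEN spec, THEN bspec, THEN bspec])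

lemma \<Omega>_left:
  assumes "u \<in> tangent_space A p" "v \<in> tangent_space A p" "w \<in> tangent_space A p"
  shows "\<Omega> p (\<lambda>c. a *\<^sub>R u c + b *\<^sub>R v c) w = a * \<Omega> p u w + b * \<Omega> p v w"
  by (rule two_form[unfolded two_form_def, THEN conjunct2, THEN conjunct1, THEN spec,
        THEN bspec, THEN bspec, THEN bspec, THEN spec, THEN spec, OF assms])

lemma \<Omega>_right:
  assumes "u \<in> tangent_space A p" "v \<in> tangent_space A p" "w \<in> tangent_space A p"
  shows "\<Omega> p w (\<lambda>c. a *\<^sub>R u c + b *\<^sub>R v c) = a * \<Omega> p w u + b * \<Omega> p w v"
  using \<Omega>_left[OF assms, of a b] \<Omega>_anti[OF assms(3) tangent_lincomb[OF assms(1,2)], of a b]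
    \<Omega>_anti[OF assms(3) assms(1)] \<Omega>_anti[OF assms(3) assms(2)] by simp

definition \<omega> :: "'m chart \<Rightarrow> real^2 \<Rightarrow> real" where
  "\<omega> c x = \<Omega> (param c x) (coord_field A c 1 (param c x)) (coord_field A c 2 (param c x))"

lemma \<omega>_pos: "c \<in> A \<Longrightarrow> x \<in> coord c ` dom_of c \<Longrightarrow> \<omega> c x > 0"
  using equiaffine by (auto simp: \<omega>_def equiaffine_2_manifold_def positively_oriented_def)

lemma smooth_\<omega>:
  assumes "c \<in> A"
  shows "smooth_on (coord c ` dom_of c) (\<omega> c)"
proof -
  have "smooth_function A (dom_of c) (\<lambda>p. \<Omega> p (coord_field A c 1 p) (coord_field A c 2 p))"
    by (rule two_form[unfolded two_form_def, THEN conjunct2, THEN conjunct2, THEN spec, THEN spec,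
          THEN spec, THEN mp, THEN mp, THEN mp])
       (auto intro!: open_dom vector_field_coord_field assms)
  then show ?thesis using assms by (auto simp: smooth_function_def o_def \<omega>_def[abs_def])
qed

lemma \<Omega>_eq:
  assumes u: "u \<in> tangent_space A p" and v: "v \<in> tangent_space A p" and c: "c \<in> A" "p \<in> dom_of c"
  shows "\<Omega> p u v = \<omega> c (coord c p) * det2 (u c) (v c)"
proof -
  let ?e = "\<lambda>j. coord_field A c j p"
  note e = coord_field_tangent[OF c]
  have e0: "\<Omega> p (?e j) (?e j) = 0" for j using \<Omega>_anti[OF e e, of j j] by simp
  have e21: "\<Omega> p (?e 2) (?e 1) = - \<Omega> p (?e 1) (?e 2)" by (rule \<Omega>_anti[OF e e])
  have "\<Omega> p u v = \<Omega> p (\<lambda>c'. u c $ 1 *\<^sub>R ?e 1 c' + u c $ 2 *\<^sub>R ?e 2 c') (\<lambda>c'. v c $ 1 *\<^sub>R ?e 1 c' + v c $ 2 *\<^sub>R ?e 2 c')"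
    using tangent_expand[OF u c] tangent_expand[OF v c] by simp
  also have "\<dots> = det2 (u c) (v c) * \<Omega> p (?e 1) (?e 2)"
    by (simp add: \<Omega>_left[OF e e tangent_lincomb[OF e e]] \<Omega>_right[OF e e e] e0 e21 det2_def algebra_simps)
  finally show ?thesis using c by (simp add: \<omega>_def)
qed

lemma
  assumes "open W" "p \<in> W" "vector_field A W Y" "v \<in> tangent_space A p"
  shows D_tangent: "D p v Y \<in> tangent_space A p"
    and D_lincomb: "w \<in> tangent_space A p \<Longrightarrow>
      D p (\<lambda>c. a *\<^sub>R v c + b *\<^sub>R w c) Y = (\<lambda>c. a *\<^sub>R D p v Y c + b *\<^sub>R D p w Y c)"
    and D_add: "vector_field A W Z \<Longrightarrow> D p v (\<lambda>q c. Y q c + Z q c) = (\<lambda>c. D p v Y c + D p v Z c)"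
    and D_Leibniz: "smooth_function A W f \<Longrightarrow> c0 \<in> A \<Longrightarrow> p \<in> dom_of c0 \<Longrightarrow>
       D p v (\<lambda>q c. f q *\<^sub>R Y q c) = (\<lambda>c. directional c0 p v f *\<^sub>R Y p c + f p *\<^sub>R D p v Y c)"
    and D_local: "(\<And>q. q \<in> W \<Longrightarrow> Z' q = Y q) \<Longrightarrow> D p v Z' = D p v Y"
proof -
  have "affine_connection A D" using equiaffine unfolding equiaffine_2_manifold_def by simp
  note all = this[unfolded affine_connection_def, THEN spec, THEN mp, OF assms(1), THEN conjunct1,
      THEN bspec, OF assms(2), THEN spec, THEN mp, OF assms(3)]
  show "D p v Y \<in> tangent_space A p" by (rule all[THEN conjunct1, THEN bspec, OF assms(4)])
  show "w \<in> tangent_space A p \<Longrightarrow>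
      D p (\<lambda>c. a *\<^sub>R v c + b *\<^sub>R w c) Y = (\<lambda>c. a *\<^sub>R D p v Y c + b *\<^sub>R D p w Y c)"
    using all[THEN conjunct2, THEN conjunct1, THEN bspec, OF assms(4)] by simp
  show "vector_field A W Z \<Longrightarrow> D p v (\<lambda>q c. Y q c + Z q c) = (\<lambda>c. D p v Y c + D p v Z c)"
    using all[THEN conjunct2, THEN conjunct2, THEN conjunct1, THEN bspec, OF assms(4)] by simp
  show "smooth_function A W f \<Longrightarrow> c0 \<in> A \<Longrightarrow> p \<in> dom_of c0 \<Longrightarrow>
       D p v (\<lambda>q c. f q *\<^sub>R Y q c) = (\<lambda>c. directional c0 p v f *\<^sub>R Y p c + f p *\<^sub>R D p v Y c)"
    using all[THEN conjunct2, THEN conjunct2, THEN conjunct2, THEN conjunct1, THEN bspec, OF assms(4)] by simp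
  show "(\<And>q. q \<in> W \<Longrightarrow> Z' q = Y q) \<Longrightarrow> D p v Z' = D p v Y"
    by (rule all[THEN conjunct2, THEN conjunct2, THEN conjunct2, THEN conjunct2, THEN bspec, OF assms(4),
          THEN spec, THEN mp]) blast
qed

lemma D_smooth:
  assumes "open W" "vector_field A W X" "vector_field A W Y"
  shows "vector_field A W (\<lambda>p. D p (X p) Y)"
proof -
  have "affine_connection A D" using equiaffine unfolding equiaffine_2_manifold_def by simp
  from this[unfolded affine_connection_def, THEN spec, THEN mp, OF assms(1), THEN conjunct2,
      THEN spec, THEN spec, THEN mp, THEN mp, OF assms(2,3)]
  show ?thesis .
qed

lemma parallel:
  assumes "open W" "vector_field A W X" "vector_field A W Y" "p \<in> W" "v \<in> tangent_space A p"
    "c \<in> A" "p \<in> dom_of c"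
  shows "directional c p v (\<lambda>q. \<Omega> q (X q) (Y q)) = \<Omega> p (D p v X) (Y p) + \<Omega> p (X p) (D p v Y)"
proof -
  have "parallel_form A D \<Omega>" using equiaffine unfolding equiaffine_2_manifold_def by simp
  from this[unfolded parallel_form_def, THEN spec, THEN spec, THEN spec, THEN mp, THEN mp, THEN mp,
      OF assms(1-3)]
  show ?thesis using assms(4-7) by blast
qed

text \<open>The components of \<open>D\<^bsub>\<partial>\<^sub>i\<^esub> \<partial>\<^sub>j\<close>, that is, the Christoffel symbols.\<close>

definition chr :: "'m chart \<Rightarrow> 2 \<Rightarrow> 2 \<Rightarrow> real^2 \<Rightarrow> real^2" where
  "chr c i j x = D (param c x) (coord_field A c i (param c x)) (coord_field A c j) c"

lemma smooth_chr:
  assumes c: "c \<in> A"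
  shows "smooth_on (coord c ` dom_of c) (chr c i j)"
proof -
  have "vector_field A (dom_of c) (\<lambda>p. D p (coord_field A c i p) (coord_field A c j))"
    using open_dom[OF c] by (intro D_smooth vector_field_coord_field c) auto
  then show ?thesis using c by (auto simp: vector_field_def chr_def[abs_def])
qed

lemma D_coord_field_tangent:
  assumes "c \<in> A" "p \<in> dom_of c" "v \<in> tangent_space A p"
  shows "D p v (coord_field A c j) \<in> tangent_space A p"
  using assms open_dom by (intro D_tangent[of "dom_of c"] vector_field_coord_field) auto

lemma D_coord_field:
  assumes c: "c \<in> A" "p \<in> dom_of c" and v: "v \<in> tangent_space A p"
  shows "D p v (coord_field A c j) c = (\<Sum>i\<in>UNIV. v c $ i *\<^sub>R chr c i j (coord c p))"
proof -
  have vf: "vector_field A (dom_of c) (coord_field A c j)"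
    by (rule vector_field_coord_field[OF c(1) open_dom[OF c(1)]]) simp
  have "D p v (coord_field A c j) = (\<lambda>c'. v c $ 1 *\<^sub>R D p (coord_field A c 1 p) (coord_field A c j) c' +
      v c $ 2 *\<^sub>R D p (coord_field A c 2 p) (coord_field A c j) c')"
    using D_lincomb[OF open_dom[OF c(1)] c(2) vf coord_field_tangent[OF c] coord_field_tangent[OF c]]
      tangent_expand[OF v c] by metis
  then show ?thesis using c by (simp add: sum_2 chr_def)
qed

text \<open>Near \<open>p\<close> the field \<open>\<partial>\<^sub>j\<close> of \<open>c\<close> is a combination of the fields \<open>\<partial>\<^sub>k\<close> of \<open>c'\<close>, whose coefficients are the entries of the
  differential of the change of charts. The Leibniz rule differentiates these coefficients: this is the
  inhomogeneous term in the transformation law of the Christoffel symbols.\<close>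

lemma D_coord_field_change:
  assumes c: "c \<in> A" "c' \<in> A" and p: "p \<in> dom_of c" "p \<in> dom_of c'" and v: "v \<in> tangent_space A p"
  shows "D p v (coord_field A c j) c' = (\<Sum>k\<in>UNIV.
     directional c p v (\<lambda>q. dtrans c c' q (axis j 1) $ k) *\<^sub>R axis k 1 +
     dtrans c c' p (axis j 1) $ k *\<^sub>R D p v (coord_field A c' k) c')"
proof -
  let ?W = "dom_of c \<inter> dom_of c'"
  let ?f = "\<lambda>k q. dtrans c c' q (axis j 1) $ k"
  have W: "open ?W" "p \<in> ?W" using p by (auto intro: open_Int open_dom[OF c(1)] open_dom[OF c(2)])
  have vf': "vector_field A ?W (coord_field A c' k)" for k
    using W(1) by (rule vector_field_coord_field[OF c(2)]) simp
  have sf: "smooth_function A ?W (?f k)" for k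
    by (rule smooth_functionI[OF c(1) W(1)])
       (auto intro!: smooth_on_nth smooth_dtrans c open_image[OF c(1) open_dom[OF c(2)]])
  note vfs = vector_field_scale[OF vf' sf W(1)]
  have vf: "vector_field A ?W (coord_field A c j)"
    using W(1) by (rule vector_field_coord_field[OF c(1)]) simp
  have "coord_field A c j q = (\<lambda>d. ?f 1 q *\<^sub>R coord_field A c' 1 q d + ?f 2 q *\<^sub>R coord_field A c' 2 q d)"
    if "q \<in> ?W" for q
  proof -
    have "coord_field A c j q c' = dtrans c c' q (axis j 1)"
      using that c by (simp add: coord_field_eq tvec_def)
    then show ?thesis
      using tangent_expand[OF coord_field_tangent[of c q j] c(2)] that c by auto
  qed
  then have "D p v (coord_field A c j) = D p v (\<lambda>q d. ?f 1 q *\<^sub>R coord_field A c' 1 q d + ?f 2 q *\<^sub>R coord_field A c' 2 q d)"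
    by (intro D_local[OF W vf v, symmetric]) auto
  also have "\<dots> = (\<lambda>d. D p v (\<lambda>q d. ?f 1 q *\<^sub>R coord_field A c' 1 q d) d + D p v (\<lambda>q d. ?f 2 q *\<^sub>R coord_field A c' 2 q d) d)"
    by (rule D_add[OF W vfs v vfs])
  finally have "D p v (coord_field A c j) c' =
      D p v (\<lambda>q d. ?f 1 q *\<^sub>R coord_field A c' 1 q d) c' + D p v (\<lambda>q d. ?f 2 q *\<^sub>R coord_field A c' 2 q d) c'"
    by simp
  then show ?thesis
    using c p by (simp add: D_Leibniz[OF W vf' v sf c(1) p(1)] sum_2 coord_field_self)
qed

end


section \<open>Covariant calculus along a curve\<close>

locale curve_along = equiaffine A D \<Omega>
  for A :: "'m::{t2_space,second_countable_topology} chart set" and D \<Omega> +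
  fixes \<gamma> :: "real \<Rightarrow> 'm" and I :: "real set"
  assumes open_I: "open I" and smooth_\<gamma>: "smooth_curve A I \<gamma>"
begin

abbreviation dom_times :: "'m chart \<Rightarrow> real set" where
  "dom_times c \<equiv> {t \<in> I. \<gamma> t \<in> dom_of c}"

abbreviation vel :: "real \<Rightarrow> 'm tvec" where
  "vel \<equiv> velocity A \<gamma>"

abbreviation cov :: "(real \<Rightarrow> 'm tvec) \<Rightarrow> real \<Rightarrow> 'm tvec" where
  "cov \<equiv> covariant A D \<gamma>"

lemma open_times: "c \<in> A \<Longrightarrow> open (dom_times c)"
proof -
  assume "c \<in> A"
  have "continuous_on I \<gamma>" using smooth_\<gamma> by (simp add: smooth_curve_def)
  then have "open (I \<inter> \<gamma> -` dom_of c)"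
    using open_I open_dom[OF \<open>c \<in> A\<close>] by (simp add: continuous_on_open_vimage Int_commute)
  also have "I \<inter> \<gamma> -` dom_of c = dom_times c" by auto
  finally show ?thesis .
qed

lemma smooth_coord_\<gamma>: "c \<in> A \<Longrightarrow> smooth_on (dom_times c) (\<lambda>t. coord c (\<gamma> t))"
  using smooth_\<gamma> by (auto simp: smooth_curve_def o_def)

lemma vel_self: "c \<in> A \<Longrightarrow> t \<in> dom_times c \<Longrightarrow> vel t c = vderiv (\<lambda>t. coord c (\<gamma> t)) t"
  by (simp add: velocity_def vderiv_def o_def)

lemma has_vector_derivative_\<gamma>:
  "c \<in> A \<Longrightarrow> t \<in> dom_times c \<Longrightarrow> ((\<lambda>t. coord c (\<gamma> t)) has_vector_derivative vel t c) (at t)"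
  using has_vector_derivative_vderiv[OF smooth_coord_\<gamma>] vel_self by simp

lemma vel_tangent:
  assumes t: "t \<in> I"
  shows "vel t \<in> tangent_space A (\<gamma> t)"
proof (rule tangentI)
  fix c c' assume c: "c \<in> A" "c' \<in> A" and p: "\<gamma> t \<in> dom_of c" "\<gamma> t \<in> dom_of c'"
  have tt: "t \<in> dom_times c" "t \<in> dom_times c'" using p t by auto
  have "((\<lambda>t. transition c c' (coord c (\<gamma> t))) has_vector_derivative dtrans c c' (\<gamma> t) (vel t c)) (at t)"
    using vector_derivative_diff_chain_within[of "\<lambda>t. coord c (\<gamma> t)" "vel t c" t UNIV "transition c c'" "dtrans c c' (\<gamma> t)"]
      has_vector_derivative_\<gamma>[OF c(1) tt(1)] has_derivative_at_withinI[OF has_derivative_transition[OF c p]]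
    unfolding o_def[of "transition c c'"] by blast
  then have "((\<lambda>t. coord c' (\<gamma> t)) has_vector_derivative dtrans c c' (\<gamma> t) (vel t c)) (at t)"
    by (rule has_vector_derivative_transform_within_open[where S = "dom_times c"])
       (use tt open_times[OF c(1)] c in simp_all)
  then show "vel t c' = dtrans c c' (\<gamma> t) (vel t c)"
    using vel_self[OF c(2) tt(2)] vderiv_eq by metis
qed (auto simp: velocity_def)

lemma directional_vel:
  assumes c: "c \<in> A" and t: "t \<in> dom_times c"
    and f: "(\<lambda>x. f (param c x)) differentiable (at (coord c (\<gamma> t)))"
  shows "((\<lambda>u. f (\<gamma> u)) has_real_derivative directional c (\<gamma> t) (vel t) f) (at t)"
proof -
  have "((\<lambda>x. f (param c x)) has_derivative frechet_derivative (\<lambda>x. f (param c x)) (at (coord c (\<gamma> t)))) (at (coord c (\<gamma> t)))"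
    using f by (simp add: frechet_derivative_works)
  then have "((\<lambda>u. f (param c (coord c (\<gamma> u)))) has_vector_derivative directional c (\<gamma> t) (vel t) f) (at t)"
    using vector_derivative_diff_chain_within[of "\<lambda>t. coord c (\<gamma> t)" "vel t c" t UNIV "\<lambda>x. f (param c x)"]
      has_vector_derivative_\<gamma>[OF c t] has_derivative_at_withinI
    unfolding directional_def o_def by blast
  then have "((\<lambda>u. f (\<gamma> u)) has_vector_derivative directional c (\<gamma> t) (vel t) f) (at t)"
    by (rule has_vector_derivative_transform_within_open[where S = "dom_times c"])
       (use t open_times[OF c] c in simp_all)
  then show ?thesis by (simp add: has_real_derivative_iff_has_vector_derivative)
qed

definition field :: "(real \<Rightarrow> 'm tvec) \<Rightarrow> bool" where
  "field V \<longleftrightarrow> (\<forall>t\<in>I. V t \<in> tangent_space A (\<gamma> t)) \<and> (\<forall>c\<in>A. smooth_on (dom_times c) (\<lambda>t. V t c))"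

lemma fieldD: "field V \<Longrightarrow> t \<in> I \<Longrightarrow> V t \<in> tangent_space A (\<gamma> t)"
  and field_smooth: "field V \<Longrightarrow> c \<in> A \<Longrightarrow> smooth_on (dom_times c) (\<lambda>t. V t c)"
  by (simp_all add: field_def)

lemma field_vel: "field vel"
  unfolding field_def
proof (intro conjI ballI vel_tangent)
  fix c assume c: "c \<in> A"
  have "smooth_on (dom_times c) (vderiv (\<lambda>t. coord c (\<gamma> t)))"
    by (intro smooth_on_vderiv smooth_coord_\<gamma> open_times c)
  then show "smooth_on (dom_times c) (\<lambda>t. vel t c)"
    using smooth_on_cong[OF open_times[OF c] vel_self[OF c]] by simp
qed

lemma cov_self:
  assumes c: "c \<in> A" and t: "t \<in> dom_times c"
  shows "cov V t c = vderiv (\<lambda>u. V u c) t + (\<Sum>j\<in>UNIV. V t c $ j *\<^sub>R D (\<gamma> t) (vel t) (coord_field A c j) c)"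
  using assms by (simp add: covariant_def vderiv_def)

text \<open>When the components are transformed to another chart, their derivative acquires the derivative of
  the differential of the change of charts along the curve. It cancels the inhomogeneous term in the transformation
  law of the Christoffel symbols.\<close>

lemma cov_tangent:
  assumes V: "field V" and t: "t \<in> I"
  shows "cov V t \<in> tangent_space A (\<gamma> t)"
proof (rule tangentI)
  fix c c' assume c: "c \<in> A" "c' \<in> A" and p: "\<gamma> t \<in> dom_of c" "\<gamma> t \<in> dom_of c'"
  have tt: "t \<in> dom_times c" "t \<in> dom_times c'" using p t by auto
  let ?p = "\<gamma> t"
  let ?J = "dtrans c c' ?p"
  let ?e = "\<lambda>j. axis j 1 :: real^2"
  let ?dir = "\<lambda>j k. directional c ?p (vel t) (\<lambda>q. dtrans c c' q (?e j) $ k)"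
  note lin = linear_dtrans[OF c p]
  note v = vel_tangent[OF t]
  define V' where "V' = vderiv (\<lambda>u. V u c) t"
  have dV: "((\<lambda>u. V u c) has_vector_derivative V') (at t)"
    unfolding V'_def by (rule has_vector_derivative_vderiv[OF field_smooth[OF V c(1)] tt(1)])
  have dJ: "((\<lambda>u. dtrans c c' (\<gamma> u) (?e j) $ k) has_real_derivative ?dir j k) (at t)" for j k
  proof (rule directional_vel[OF c(1) tt(1)])
    have "smooth_on (coord c ` (dom_of c \<inter> dom_of c')) (\<lambda>x. dtrans c c' (param c x) (?e j) $ k)"
      using open_image[OF c(1) open_dom[OF c(2)]] by (intro smooth_on_nth smooth_dtrans c)
    from smooth_on_derivative(1)[OF this, of "coord c ?p"]
    show "(\<lambda>x. dtrans c c' (param c x) (?e j) $ k) differentiable at (coord c ?p)"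
      using p by (auto simp: differentiable_def)
  qed
  let ?G = "\<lambda>j. \<Sum>k\<in>UNIV. ?dir j k *\<^sub>R ?e k"
  have dJ': "((\<lambda>u. dtrans c c' (\<gamma> u) (?e j)) has_vector_derivative ?G j) (at t)" for j
  proof -
    have "((\<lambda>u. \<Sum>k\<in>UNIV. dtrans c c' (\<gamma> u) (?e j) $ k *\<^sub>R ?e k) has_vector_derivative ?G j) (at t)"
      using dJ[of j] by (intro has_vector_derivative_sum) (auto intro!: derivative_eq_intros)
    then show ?thesis by (simp add: sum_2 vec2_expand[symmetric])
  qed
  have eq: "V u c' = (\<Sum>j\<in>UNIV. V u c $ j *\<^sub>R dtrans c c' (\<gamma> u) (?e j))" if "u \<in> dom_times c \<inter> dom_times c'" for u
    using that tangentD[OF fieldD[OF V, of u] c] linear_vec2[OF linear_dtrans[OF c], of "\<gamma> u" "V u c"]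
    by (simp add: sum_2)
  have "((\<lambda>u. \<Sum>j\<in>UNIV. V u c $ j *\<^sub>R dtrans c c' (\<gamma> u) (?e j)) has_vector_derivative
      (\<Sum>j\<in>UNIV. V t c $ j *\<^sub>R ?G j + V' $ j *\<^sub>R ?J (?e j))) (at t)"
  proof (intro has_vector_derivative_sum)
    fix j :: 2
    have "((\<lambda>u. V u c $ j) has_vector_derivative V' $ j) (at t)"
      using bounded_linear.has_vector_derivative[OF bounded_linear_vec_nth dV] .
    then show "((\<lambda>u. V u c $ j *\<^sub>R dtrans c c' (\<gamma> u) (?e j)) has_vector_derivative
       V t c $ j *\<^sub>R ?G j + V' $ j *\<^sub>R ?J (?e j)) (at t)"
      using has_vector_derivative_scaleR[OF _ dJ'] by (simp add: has_real_derivative_iff_has_vector_derivative)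
  qed
  then have "((\<lambda>u. V u c') has_vector_derivative (\<Sum>j\<in>UNIV. V t c $ j *\<^sub>R ?G j + V' $ j *\<^sub>R ?J (?e j))) (at t)"
  proof (rule has_vector_derivative_transform_within_open[where S = "dom_times c \<inter> dom_times c'"])
    show "open (dom_times c \<inter> dom_times c')" using open_times[OF c(1)] open_times[OF c(2)] by (rule open_Int)
  qed (use tt eq in simp_all)
  then have dV2: "vderiv (\<lambda>u. V u c') t = (\<Sum>j\<in>UNIV. V t c $ j *\<^sub>R ?G j + V' $ j *\<^sub>R ?J (?e j))"
    by (rule vderiv_eq)
  have JD: "?J (D ?p (vel t) (coord_field A c j) c) =
     ?G j + (\<Sum>k\<in>UNIV. ?J (?e j) $ k *\<^sub>R D ?p (vel t) (coord_field A c' k) c')" for j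
    using tangentD[OF D_coord_field_tangent[OF c(1) p(1) v] c p, symmetric]
      D_coord_field_change[OF c p v] by (simp add: sum.distrib)
  have "?J (cov V t c) = V' $ 1 *\<^sub>R ?J (?e 1) + V' $ 2 *\<^sub>R ?J (?e 2) +
      (V t c $ 1 *\<^sub>R ?J (D ?p (vel t) (coord_field A c 1) c) + V t c $ 2 *\<^sub>R ?J (D ?p (vel t) (coord_field A c 2) c))"
    using linear_vec2[OF lin, of V']
    by (simp add: cov_self[OF c(1) tt(1)] V'_def[symmetric] sum_2 linear_add[OF lin] linear_scale[OF lin])
  also have "\<dots> = cov V t c'"
    unfolding cov_self[OF c(2) tt(2)] dV2 JD using eq[of t] tt
    by (simp add: sum_2 algebra_simps)
  finally show "cov V t c' = ?J (cov V t c)" ..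
qed (auto simp: covariant_def)

lemma field_cov:
  assumes V: "field V"
  shows "field (cov V)"
  unfolding field_def
proof (intro conjI ballI cov_tangent V)
  fix c assume c: "c \<in> A"
  have "smooth_on (dom_times c) (\<lambda>t. chr c i j (coord c (\<gamma> t)))" for i j
    by (rule smooth_on_compose[OF smooth_chr[OF c] smooth_coord_\<gamma>[OF c]])
       (use c open_times open_coord_dom in auto)
  then have "smooth_on (dom_times c) (\<lambda>t. vderiv (\<lambda>u. V u c) t +
      (\<Sum>j\<in>UNIV. V t c $ j *\<^sub>R (\<Sum>i\<in>UNIV. vel t c $ i *\<^sub>R chr c i j (coord c (\<gamma> t)))))"
    using open_times[OF c]
    by (intro smooth_on_add smooth_on_sum smooth_on_scaleR smooth_on_nth field_smooth[OF V] field_smooth[OF field_vel]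
         smooth_on_vderiv c) auto
  moreover have "cov V t c = vderiv (\<lambda>u. V u c) t +
      (\<Sum>j\<in>UNIV. V t c $ j *\<^sub>R (\<Sum>i\<in>UNIV. vel t c $ i *\<^sub>R chr c i j (coord c (\<gamma> t))))" if "t \<in> dom_times c" for t
    using that c by (simp add: cov_self D_coord_field vel_tangent)
  ultimately show "smooth_on (dom_times c) (\<lambda>t. cov V t c)"
    using smooth_on_cong[OF open_times[OF c], of "\<lambda>t. cov V t c"] by simp
qed

lemma fieldI: "(\<And>t. t \<in> I \<Longrightarrow> V t \<in> tangent_space A (\<gamma> t)) \<Longrightarrow>
    (\<And>c. c \<in> A \<Longrightarrow> smooth_on (dom_times c) (\<lambda>t. V t c)) \<Longrightarrow> field V"
  by (simp add: field_def)

lemma field_scale: "field V \<Longrightarrow> smooth_on I f \<Longrightarrow> field (\<lambda>t c. f t *\<^sub>R V t c)"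
  by (intro fieldI tangent_scale smooth_on_scaleR open_times)
     (auto intro: fieldD field_smooth smooth_on_subset)

lemma cov_cong:
  assumes "\<And>u. u \<in> I \<Longrightarrow> U u = V u" and t: "t \<in> I"
  shows "cov U t = cov V t"
proof
  fix c
  have "vector_derivative (\<lambda>u. U u c) (at t) = vector_derivative (\<lambda>u. V u c) (at t)"
    using vderiv_cong_open[OF open_I t, of "\<lambda>u. U u c" "\<lambda>u. V u c"] assms(1) by (simp add: vderiv_def)
  then show "cov U t c = cov V t c" unfolding covariant_def assms(1)[OF t] by simp
qed

lemma cov_add:
  assumes U: "field U" and V: "field V" and t: "t \<in> I"
  shows "cov (\<lambda>t c. U t c + V t c) t = (\<lambda>c. cov U t c + cov V t c)"
proof
  fix c
  show "cov (\<lambda>t c. U t c + V t c) t c = cov U t c + cov V t c"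
  proof (cases "c \<in> A \<and> \<gamma> t \<in> dom_of c")
    case True
    then have c: "c \<in> A" "t \<in> dom_times c" using t by auto
    have "vderiv (\<lambda>u. U u c + V u c) t = vderiv (\<lambda>u. U u c) t + vderiv (\<lambda>u. V u c) t"
      by (intro vderiv_eq has_vector_derivative_add has_vector_derivative_vderiv[OF field_smooth] U V c)
    then show ?thesis by (simp add: cov_self[OF c] sum.distrib algebra_simps)
  qed (auto simp: covariant_def)
qed

lemma cov_scale:
  assumes V: "field V" and f: "smooth_on I f" and t: "t \<in> I"
  shows "cov (\<lambda>t c. f t *\<^sub>R V t c) t = (\<lambda>c. vderiv f t *\<^sub>R V t c + f t *\<^sub>R cov V t c)"
proof
  fix c
  show "cov (\<lambda>t c. f t *\<^sub>R V t c) t c = vderiv f t *\<^sub>R V t c + f t *\<^sub>R cov V t c"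
  proof (cases "c \<in> A \<and> \<gamma> t \<in> dom_of c")
    case True
    then have c: "c \<in> A" "t \<in> dom_times c" using t by auto
    have "vderiv (\<lambda>u. f u *\<^sub>R V u c) t = f t *\<^sub>R vderiv (\<lambda>u. V u c) t + vderiv f t *\<^sub>R V t c"
      by (intro vderiv_eq has_vector_derivative_scaleR has_vector_derivative_vderiv[OF field_smooth]
          has_real_derivative_vderiv[OF f] V c t)
    then show ?thesis by (simp add: cov_self[OF c] scaleR_sum_right algebra_simps)
  qed (auto simp: covariant_def tangentD0[OF fieldD[OF V t]])
qed

lemma field_tvec:
  assumes c: "c \<in> A" and I: "\<And>t. t \<in> I \<Longrightarrow> \<gamma> t \<in> dom_of c" and w: "smooth_on I w"
  shows "field (\<lambda>t. tvec c (\<gamma> t) (w t))"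
  unfolding field_def
proof (intro conjI ballI tvec_tangent c I)
  fix c' assume c': "c' \<in> A"
  have tc: "dom_times c = I" using I by auto
  have sm: "smooth_on (dom_times c') (\<lambda>t. dtrans c c' (param c (coord c (\<gamma> t))) (axis j 1))" for j
    by (rule smooth_on_compose[OF smooth_dtrans[OF c c'] smooth_on_subset[OF smooth_coord_\<gamma>[OF c]]])
       (use I open_image[OF c open_dom[OF c']] open_times[OF c'] in auto)
  have "smooth_on (dom_times c') (\<lambda>t. w t $ 1 *\<^sub>R dtrans c c' (param c (coord c (\<gamma> t))) (axis 1 1) +
      w t $ 2 *\<^sub>R dtrans c c' (param c (coord c (\<gamma> t))) (axis 2 1))"
    using open_times[OF c']
    by (intro smooth_on_add smooth_on_scaleR sm smooth_on_nth smooth_on_subset[OF w]) auto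
  moreover have "tvec c (\<gamma> t) (w t) c' = w t $ 1 *\<^sub>R dtrans c c' (param c (coord c (\<gamma> t))) (axis 1 1) +
      w t $ 2 *\<^sub>R dtrans c c' (param c (coord c (\<gamma> t))) (axis 2 1)" if "t \<in> dom_times c'" for t
    using that I c c' linear_vec2[OF linear_dtrans[OF c c'], of "\<gamma> t" "w t"] by (simp add: tvec_def)
  ultimately show "smooth_on (dom_times c') (\<lambda>t. tvec c (\<gamma> t) (w t) c')"
    using smooth_on_cong[OF open_times[OF c'], of "\<lambda>t. tvec c (\<gamma> t) (w t) c'"] by simp
qed

definition br :: "(real \<Rightarrow> 'm tvec) \<Rightarrow> (real \<Rightarrow> 'm tvec) \<Rightarrow> real \<Rightarrow> real" where
  "br U V t = \<Omega> (\<gamma> t) (U t) (V t)"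

lemma br_eq:
  assumes "field U" "field V" "c \<in> A" "t \<in> dom_times c"
  shows "br U V t = \<omega> c (coord c (\<gamma> t)) * det2 (U t c) (V t c)"
  unfolding br_def by (rule \<Omega>_eq) (use assms in \<open>auto intro: fieldD\<close>)

lemma br_self: "field U \<Longrightarrow> t \<in> I \<Longrightarrow> br U U t = 0"
  using \<Omega>_anti[OF fieldD fieldD, of U t U] by (simp add: br_def)

lemma br_lincomb:
  assumes "field U" "field V" "field X" "field Y" and t: "t \<in> I"
  shows "\<Omega> (\<gamma> t) (\<lambda>c. a *\<^sub>R U t c + b *\<^sub>R V t c) (\<lambda>c. d *\<^sub>R X t c + e *\<^sub>R Y t c) =
    a * d * br U X t + a * e * br U Y t + b * d * br V X t + b * e * br V Y t"
  using assms by (simp add: br_def \<Omega>_left \<Omega>_right tangent_lincomb fieldD algebra_simps)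

lemma br_anti: "field U \<Longrightarrow> field V \<Longrightarrow> t \<in> I \<Longrightarrow> br U V t = - br V U t"
  unfolding br_def by (rule \<Omega>_anti) (auto intro: fieldD)

text \<open>In a chart the bracket is \<open>\<omega>\<close> times a determinant. Parallelism of the area form says that the
  derivative of \<open>\<omega>\<close> along the curve is \<open>\<omega>\<close> times the trace of the connection matrix, and the same trace arises
  when that matrix acts on either argument of the determinant.\<close>

lemma br_derivative:
  assumes U: "field U" and V: "field V" and t: "t \<in> I"
  shows "(br U V has_real_derivative br (cov U) V t + br U (cov V) t) (at t)"
proof -
  let ?p = "\<gamma> t"
  obtain c where c: "c \<in> A" and p: "?p \<in> dom_of c" using ex_chart by blast
  have tc: "t \<in> dom_times c" using t p by simp
  note v = vel_tangent[OF t]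
  let ?d = "\<lambda>j. D ?p (vel t) (coord_field A c j) c"
  let ?w = "\<omega> c (coord c ?p)"
  let ?\<Omega> = "\<lambda>q. \<Omega> q (coord_field A c 1 q) (coord_field A c 2 q)"
  have vf: "vector_field A (dom_of c) (coord_field A c j)" for j
    by (rule vector_field_coord_field[OF c open_dom[OF c]]) simp
  have "directional c ?p (vel t) ?\<Omega> =
      \<Omega> ?p (D ?p (vel t) (coord_field A c 1)) (coord_field A c 2 ?p) +
      \<Omega> ?p (coord_field A c 1 ?p) (D ?p (vel t) (coord_field A c 2))"
    by (rule parallel[OF open_dom[OF c] vf vf p v c p])
  also have "\<dots> = ?w * (?d 1 $ 1 + ?d 2 $ 2)"
    by (simp add: \<Omega>_eq[OF D_coord_field_tangent[OF c p v] coord_field_tangent[OF c p] c p]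
        \<Omega>_eq[OF coord_field_tangent[OF c p] D_coord_field_tangent[OF c p v] c p]
        coord_field_self[OF c p] det2_def axis_def algebra_simps)
  finally have dir: "directional c ?p (vel t) ?\<Omega> = ?w * (?d 1 $ 1 + ?d 2 $ 2)" .
  have "(\<lambda>x. ?\<Omega> (param c x)) differentiable at (coord c ?p)"
    using smooth_on_derivative(1)[OF smooth_\<omega>[OF c], of "coord c ?p"] p
    unfolding \<omega>_def differentiable_def by blast
  from directional_vel[OF c tc this]
  have dw: "((\<lambda>u. ?\<Omega> (\<gamma> u)) has_real_derivative ?w * (?d 1 $ 1 + ?d 2 $ 2)) (at t)"
    unfolding dir .
  have comp: "((\<lambda>u. X u c $ j) has_real_derivative vderiv (\<lambda>u. X u c) t $ j) (at t)" if "field X" for X j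
    using bounded_linear.has_vector_derivative[OF bounded_linear_vec_nth
        has_vector_derivative_vderiv[OF field_smooth[OF that c] tc]]
    by (simp add: has_real_derivative_iff_has_vector_derivative)
  have "((\<lambda>u. ?\<Omega> (\<gamma> u) * (U u c $ 1 * V u c $ 2 - U u c $ 2 * V u c $ 1)) has_real_derivative
      br (cov U) V t + br U (cov V) t) (at t)"
    by (rule derivative_eq_intros dw comp U V refl)+
       (use p c in \<open>simp add: br_eq[OF field_cov[OF U] V c tc] br_eq[OF U field_cov[OF V] c tc] det2_def
          cov_self[OF c tc] sum_2 \<omega>_def algebra_simps\<close>)
  then show ?thesis
  proof (rule has_field_derivative_transform_within_open[OF _ open_times[OF c] tc])
    fix u assume u: "u \<in> dom_times c"
    then show "?\<Omega> (\<gamma> u) * (U u c $ 1 * V u c $ 2 - U u c $ 2 * V u c $ 1) = br U V u"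
      using br_eq[OF U V c u] c by (simp add: \<omega>_def det2_def)
  qed
qed

lemma vderiv_br:
  "field U \<Longrightarrow> field V \<Longrightarrow> t \<in> I \<Longrightarrow> vderiv (br U V) t = br (cov U) V t + br U (cov V) t"
  using br_derivative by (intro vderiv_eq) (simp add: has_real_derivative_iff_has_vector_derivative)

lemma smooth_br:
  assumes U: "field U" and V: "field V"
  shows "smooth_on I (br U V)"
proof (rule smooth_on_local)
  fix t assume t: "t \<in> I"
  obtain c where c: "c \<in> A" and p: "\<gamma> t \<in> dom_of c" using ex_chart by blast
  have "smooth_on (dom_times c) (\<lambda>t. \<omega> c (coord c (\<gamma> t)))"
    by (rule smooth_on_compose[OF smooth_\<omega>[OF c] smooth_coord_\<gamma>[OF c]])
       (use open_coord_dom[OF c] open_times[OF c] in auto)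
  then have "smooth_on (dom_times c) (\<lambda>t. \<omega> c (coord c (\<gamma> t)) * det2 (U t c) (V t c))"
    using open_times[OF c] by (intro smooth_on_mult smooth_on_det2 field_smooth U V c)
  then have "smooth_on (dom_times c) (br U V)"
    using smooth_on_cong[OF open_times[OF c] br_eq[OF U V c]] by simp
  then show "\<exists>S. open S \<and> t \<in> S \<and> smooth_on S (br U V)"
    using open_times[OF c] t p by blast
qed


subsection \<open>The brackets at a cusp\<close>

definition cov_pow :: "(real \<Rightarrow> 'm tvec) \<Rightarrow> nat \<Rightarrow> real \<Rightarrow> 'm tvec" where
  "cov_pow W k = (cov ^^ k) W"

lemma field_cov_pow: "field W \<Longrightarrow> field (cov_pow W k)"
  by (induction k) (auto simp: cov_pow_def field_cov)

text \<open>This is the Leibniz rule for \<open>\<gamma>' = t W\<close>. For \<open>k = 0\<close> the first summand has the coefficient 0, so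
  that the truncated subtraction is harmless.\<close>

lemma curve_deriv_cusp:
  assumes W: "field W" and vel: "\<And>t. t \<in> I \<Longrightarrow> vel t = (\<lambda>c. t *\<^sub>R W t c)" and t: "t \<in> I"
  shows "curve_deriv A D \<gamma> (Suc k) t = (\<lambda>c. real k *\<^sub>R cov_pow W (k - 1) t c + t *\<^sub>R cov_pow W k t c)"
  using t
proof (induction k arbitrary: t)
  case 0
  then show ?case using vel by (simp add: curve_deriv_def cov_pow_def)
next
  case (Suc k)
  have const: "smooth_on I (\<lambda>t. real k)" and id: "smooth_on I (\<lambda>t. t)"
    by (intro smooth_on_const smooth_on_id open_I)+
  have d: "vderiv (\<lambda>t. real k) t = 0" "vderiv (\<lambda>t. t) t = 1"
    by (auto intro!: vderiv_eq derivative_eq_intros)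
  have "curve_deriv A D \<gamma> (Suc (Suc k)) t = cov (curve_deriv A D \<gamma> (Suc k)) t"
    by (simp add: curve_deriv_def)
  also have "\<dots> = cov (\<lambda>t c. real k *\<^sub>R cov_pow W (k - 1) t c + t *\<^sub>R cov_pow W k t c) t"
    by (rule cov_cong[OF Suc.IH Suc.prems])
  also have "\<dots> = (\<lambda>c. real k *\<^sub>R cov (cov_pow W (k - 1)) t c + (cov_pow W k t c + t *\<^sub>R cov (cov_pow W k) t c))"
    using Suc.prems
    by (simp add: cov_add cov_scale field_scale field_cov_pow W const id d)
  also have "\<dots> = (\<lambda>c. real (Suc k) *\<^sub>R cov_pow W (Suc k - 1) t c + t *\<^sub>R cov_pow W (Suc k) t c)"
  proof -
    have "real k *\<^sub>R cov (cov_pow W (k - 1)) t c = real k *\<^sub>R cov_pow W k t c" for c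
      by (cases k) (simp_all add: cov_pow_def)
    moreover have "cov (cov_pow W k) = cov_pow W (Suc k)" by (simp add: cov_pow_def)
    moreover have "real (Suc k) *\<^sub>R x = real k *\<^sub>R x + x" for x :: "real^2"
      by (simp add: scaleR_left_distrib)
    ultimately show ?thesis by (simp only: add.assoc diff_Suc_1)
  qed
  finally show ?case .
qed

text \<open>By parallelism \<open>g' = [W, W'']\<close>, and differentiating once more gives \<open>[W, W'''] = g'' - h\<close>. These and
  the Leibniz rule for \<open>t W\<close> evaluate the brackets that enter the affine curvature and the cuspidal curvature.\<close>

lemma cusp_brackets:
  assumes W: "field W" and vel: "\<And>t. t \<in> I \<Longrightarrow> vel t = (\<lambda>c. t *\<^sub>R W t c)"
  defines "g \<equiv> br W (cov W)" and "h \<equiv> br (cov W) (cov (cov W))"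
  shows "t \<in> I \<Longrightarrow> bracket A D \<Omega> \<gamma> 1 2 t = t\<^sup>2 * g t"
    and "t \<in> I \<Longrightarrow> bracket A D \<Omega> \<gamma> 1 3 t = 2 * t * g t + t\<^sup>2 * vderiv g t"
    and "t \<in> I \<Longrightarrow> bracket A D \<Omega> \<gamma> 1 4 t = 3 * t * vderiv g t + t\<^sup>2 * (vderiv (vderiv g) t - h t)"
    and "t \<in> I \<Longrightarrow> bracket A D \<Omega> \<gamma> 2 3 t = 2 * g t + t * vderiv g t + t\<^sup>2 * h t"
    and "0 \<in> I \<Longrightarrow> bracket A D \<Omega> \<gamma> 2 4 0 = 3 * vderiv g 0"
    and "0 \<in> I \<Longrightarrow> bracket A D \<Omega> \<gamma> 2 5 0 = 4 * (vderiv (vderiv g) 0 - h 0)"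
    and "0 \<in> I \<Longrightarrow> bracket A D \<Omega> \<gamma> 3 4 0 = 6 * h 0"
proof -
  let ?W = "cov_pow W"
  note F = field_cov_pow[OF W]
  have ga: "g t = br (?W 0) (?W 1) t" for t by (simp add: g_def cov_pow_def)
  have ha: "h t = br (?W 1) (?W 2) t" for t by (simp add: h_def cov_pow_def numeral_2_eq_2)
  have g1: "vderiv g t = br (?W 0) (?W 2) t" if "t \<in> I" for t
    using vderiv_br[OF F F, of t 0 1] br_self[OF F, of t 1] that
    by (simp add: g_def cov_pow_def numeral_2_eq_2)
  have "vderiv (vderiv g) t = vderiv (br (?W 0) (?W 2)) t" if "t \<in> I" for t
    by (rule vderiv_cong_open[OF open_I that g1])
  then have g2: "br (?W 0) (?W 3) t = vderiv (vderiv g) t - h t" if "t \<in> I" for t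
    using vderiv_br[OF F F, of t 0 2] that
    by (simp add: h_def cov_pow_def numeral_2_eq_2 numeral_3_eq_3)
  have anti: "br (?W j) (?W i) t = - br (?W i) (?W j) t" if "t \<in> I" for i j t
    by (rule br_anti[OF F F that])
  have cd: "curve_deriv A D \<gamma> (Suc k) t = (\<lambda>c. real k *\<^sub>R ?W (k - 1) t c + t *\<^sub>R ?W k t c)" if "t \<in> I" for k t
    by (rule curve_deriv_cusp[OF W vel that])
  have b: "bracket A D \<Omega> \<gamma> (Suc i) (Suc j) t =
      i * j * br (?W (i - 1)) (?W (j - 1)) t + i * t * br (?W (i - 1)) (?W j) t +
      t * j * br (?W i) (?W (j - 1)) t + t * t * br (?W i) (?W j) t" if "t \<in> I" for i j t
    unfolding bracket_def cd[OF that] by (rule br_lincomb[OF F F F F that])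
  note simps = br_self[OF F] ga ha g1 g2 algebra_simps power2_eq_square
  show "t \<in> I \<Longrightarrow> bracket A D \<Omega> \<gamma> 1 2 t = t\<^sup>2 * g t"
    using b[of t 0 1] anti[of t 0 1] by (simp add: simps numeral_2_eq_2)
  show "t \<in> I \<Longrightarrow> bracket A D \<Omega> \<gamma> 1 3 t = 2 * t * g t + t\<^sup>2 * vderiv g t"
    using b[of t 0 2] by (simp add: simps)
  show "t \<in> I \<Longrightarrow> bracket A D \<Omega> \<gamma> 1 4 t = 3 * t * vderiv g t + t\<^sup>2 * (vderiv (vderiv g) t - h t)"
    using b[of t 0 3] by (simp add: simps)
  show "t \<in> I \<Longrightarrow> bracket A D \<Omega> \<gamma> 2 3 t = 2 * g t + t * vderiv g t + t\<^sup>2 * h t"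
    using b[of t 1 2] by (simp add: simps numeral_2_eq_2[symmetric])
  show "0 \<in> I \<Longrightarrow> bracket A D \<Omega> \<gamma> 2 4 0 = 3 * vderiv g 0"
    using b[of 0 1 3] by (simp add: simps numeral_2_eq_2[symmetric])
  show "0 \<in> I \<Longrightarrow> bracket A D \<Omega> \<gamma> 2 5 0 = 4 * (vderiv (vderiv g) 0 - h 0)"
    using b[of 0 1 4] by (simp add: simps numeral_2_eq_2[symmetric])
  show "0 \<in> I \<Longrightarrow> bracket A D \<Omega> \<gamma> 3 4 0 = 6 * h 0"
    using b[of 0 2 3] by (simp add: simps numeral_2_eq_2[symmetric])
qed

end


section \<open>The normalized curvature of a cusp\<close>

lemma (in cusp_germ) smooth_diffeo_\<tau>:
  assumes T: "\<And>t. t \<in> I \<Longrightarrow> T t = \<tau> t" and f: "\<And>t. t \<in> I - {0} \<Longrightarrow> f t = F t"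
  shows "smooth_diffeo I (T ` I) T"
    and "\<exists>G. smooth_on (T ` I) G \<and> (\<forall>t\<in>I - {0}. G (T t) = f t) \<and> G 0 = 4/25 \<and> (G has_real_derivative 0) (at 0)"
proof -
  obtain inv where inv: "homeomorphism I (\<tau> ` I) \<tau> inv" "open (\<tau> ` I)" "smooth_on (\<tau> ` I) inv"
    "\<And>t. t \<in> I \<Longrightarrow> (inv has_real_derivative inverse (vderiv \<tau> t)) (at (\<tau> t))"
    using smooth_inverse_function[OF smooth_\<tau> vderiv_\<tau>_pos] by metis
  have im: "T ` I = \<tau> ` I" using T by (intro image_cong) auto
  have "homeomorphism I (T ` I) T inv"
    unfolding im using inv(1) T by (intro homeomorphism_cong[OF inv(1)]) auto
  moreover have "smooth_on I T" using smooth_on_cong[of I T \<tau>] T smooth_\<tau> by simp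
  ultimately show "smooth_diffeo I (T ` I) T"
    using inv unfolding smooth_diffeo_def im by auto
  have [simp]: "inv (\<tau> t) = t" if "t \<in> I" for t using homeomorphism_apply1[OF inv(1) that] .
  have \<tau>0: "\<tau> 0 = 0" by (simp add: \<tau>_def)
  have inv0: "inv 0 = 0" using zero_in_I \<tau>0 by (metis \<open>\<And>t. t \<in> I \<Longrightarrow> inv (\<tau> t) = t\<close>)
  show "\<exists>G. smooth_on (T ` I) G \<and> (\<forall>t\<in>I - {0}. G (T t) = f t) \<and> G 0 = 4/25 \<and> (G has_real_derivative 0) (at 0)"
  proof (intro exI[of _ "\<lambda>y. F (inv y)"] conjI ballI)
    show "smooth_on (T ` I) (\<lambda>y. F (inv y))"
      unfolding im by (rule smooth_on_compose[OF smooth_F inv(3)]) (use inv(1,2) in \<open>auto simp: homeomorphism_def\<close>)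
    show "F (inv (T t)) = f t" if "t \<in> I - {0}" for t using that T f by auto
    show "F (inv 0) = 4/25" by (simp add: inv0 F_0)
    have "(inv has_real_derivative inverse (vderiv \<tau> 0)) (at 0)" using inv(4)[OF zero_in_I] by (simp add: \<tau>0)
    then have "((\<lambda>y. F (inv y)) has_real_derivative 0 * inverse (vderiv \<tau> 0)) (at 0)"
      by (rule DERIV_chain2[rotated]) (simp add: inv0 F_deriv_0)
    then show "((\<lambda>y. F (inv y)) has_real_derivative 0) (at 0)" by simp
  qed
qed

lemma vector2_eq: "vector [a, b] = a *\<^sub>R axis 1 1 + b *\<^sub>R (axis 2 1 :: real^2)"
  by (simp add: vec_eq_iff forall_2 axis_def)

lemma det2_basis_neq_0:
  fixes J :: "real^2 \<Rightarrow> real^2"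
  assumes "linear J" and left_inverse: "\<And>v. L (J v) = v"
  shows "det2 (J (axis 1 1)) (J (axis 2 1)) \<noteq> 0"
proof
  let ?u = "J (axis 1 1)" and ?v = "J (axis 2 1)"
  assume z: "det2 ?u ?v = 0"
  have inj: "x = 0 \<and> y = 0" if "x *\<^sub>R ?u + y *\<^sub>R ?v = 0" for x y
  proof -
    have "J (x *\<^sub>R axis 1 1 + y *\<^sub>R axis 2 1) = J 0"
      using that by (simp add: linear_add[OF assms(1)] linear_scale[OF assms(1)] linear_0[OF assms(1)])
    then have "x *\<^sub>R axis 1 1 + y *\<^sub>R axis 2 1 = (0 :: real^2)" using left_inverse by metis
    then show ?thesis by (simp add: vec_eq_iff forall_2 axis_def)
  qed
  have "(?v $ 1) *\<^sub>R ?u + (- ?u $ 1) *\<^sub>R ?v = 0" "(?v $ 2) *\<^sub>R ?u + (- ?u $ 2) *\<^sub>R ?v = 0"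
    using z by (auto simp: vec_eq_iff forall_2 det2_def algebra_simps)
  then have "?u $ 1 = 0" "?u $ 2 = 0" using inj by fastforce+
  then have "1 *\<^sub>R ?u + 0 *\<^sub>R ?v = 0" by (simp add: vec_eq_iff forall_2)
  then show False using inj by fastforce
qed

context curve_along
begin

text \<open>If \<open>k\<close> denotes the parameter in which the curve is \<open>(k\<^sup>2, k\<^sup>3)\<close> and \<open>\<Phi>\<close> the change of
  coordinates, then differentiating \<open>\<Phi> (k\<^sup>2, k\<^sup>3)\<close> produces a factor \<open>k\<close>, which can be replaced by
  the factor \<open>t\<close>.\<close>

lemma cusp_velocity:
  assumes cusp: "has_cusp_at_0 A I \<gamma>"
  obtains c \<epsilon> w where "c \<in> A" "\<epsilon> > 0" "{-\<epsilon><..<\<epsilon>} \<subseteq> dom_times c" "smooth_on {-\<epsilon><..<\<epsilon>} w"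
    "\<And>t. t \<in> {-\<epsilon><..<\<epsilon>} \<Longrightarrow> vel t c = t *\<^sub>R w t" "det2 (w 0) (vderiv w 0) \<noteq> 0"
proof -
  from cusp obtain d h \<eta> J where d: "local_coordinates A d" and \<eta>: "\<eta> > 0" and J: "J \<subseteq> I"
    and h: "smooth_diffeo {-\<eta><..<\<eta>} J h" "h 0 = 0"
    and std: "\<And>s. s \<in> {-\<eta><..<\<eta>} \<Longrightarrow> \<gamma> (h s) \<in> dom_of d \<and> coord d (\<gamma> (h s)) = vector [s^2, s^3]"
    unfolding has_cusp_at_0_def by blast
  from h obtain k where k: "homeomorphism {-\<eta><..<\<eta>} J h k" "smooth_on J k" and sh: "smooth_on {-\<eta><..<\<eta>} h" "open J"
    unfolding smooth_diffeo_def by blast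
  have h0: "0 \<in> J" using homeomorphism_image1[OF k(1)] h(2) \<eta> by force
  have k0: "k 0 = 0" using homeomorphism_apply1[OF k(1), of 0] h(2) \<eta> by simp
  have kJ: "k t \<in> {-\<eta><..<\<eta>}" "h (k t) = t" if "t \<in> J" for t
    using homeomorphism_image2[OF k(1)] homeomorphism_apply2[OF k(1)] that by auto
  have k'0: "vderiv k 0 \<noteq> 0"
  proof -
    have "((\<lambda>t. h (k t)) has_real_derivative vderiv h (k 0) * vderiv k 0) (at 0)"
      using has_real_derivative_vderiv[OF k(2) h0] has_real_derivative_vderiv[OF sh(1) kJ(1)[OF h0]]
      by (intro DERIV_chain2) auto
    then have "((\<lambda>t. t) has_real_derivative vderiv h (k 0) * vderiv k 0) (at 0)"
      by (rule has_field_derivative_transform_within_open[OF _ sh(2) h0]) (simp add: kJ)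
    from DERIV_unique[OF this DERIV_ident] show ?thesis by auto
  qed
  have dchart: "is_chart d" and compat: "\<And>c. c \<in> A \<Longrightarrow> compatible d c"
    using d by (auto simp: local_coordinates_def)
  obtain c where c: "c \<in> A" and p: "\<gamma> 0 \<in> dom_of c" using ex_chart by blast
  let ?S = "coord d ` (dom_of d \<inter> dom_of c)" and ?S' = "coord c ` (dom_of d \<inter> dom_of c)"
  let ?\<Phi> = "transition d c"
  have \<Phi>: "smooth_on ?S ?\<Phi>" and \<Psi>: "smooth_on ?S' (transition c d)"
    using compat[OF c] by (auto simp: compatible_def)
  have S: "open ?S" by (rule chart_open_image[OF dchart open_dom[OF c]])
  define z where "z t = k t ^ 2 *\<^sub>R axis 1 1 + k t ^ 3 *\<^sub>R (axis 2 1 :: real^2)" for t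
  define N where "N = J \<inter> dom_times c"
  have N: "open N" using sh(2) open_times[OF c] by (auto simp: N_def)
  have N0: "0 \<in> N" using h0 p J by (auto simp: N_def)
  have zN: "\<gamma> t \<in> dom_of d" "coord d (\<gamma> t) = z t" "z t \<in> ?S" "coord c (\<gamma> t) = ?\<Phi> (z t)" if "t \<in> N" for t
  proof -
    have t: "t \<in> J" "\<gamma> t \<in> dom_of c" using that by (auto simp: N_def)
    show 1: "\<gamma> t \<in> dom_of d" "coord d (\<gamma> t) = z t"
      using std[OF kJ(1)[OF t(1)]] kJ(2)[OF t(1)] by (simp_all add: vector2_eq z_def)
    show "z t \<in> ?S" using 1 t(2) by (metis IntI imageI)
    show "coord c (\<gamma> t) = ?\<Phi> (z t)" using 1 param_coord[OF dchart 1(1)] by simp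
  qed
  have skN: "smooth_on N k" by (rule smooth_on_subset[OF k(2)]) (auto simp: N_def)
  have sz: "smooth_on N z" unfolding z_def by (intro smooth_intros skN N)
  have dz: "(z has_vector_derivative (2 * k t * vderiv k t) *\<^sub>R axis 1 1 + (3 * k t ^ 2 * vderiv k t) *\<^sub>R axis 2 1) (at t)"
    if "t \<in> N" for t
    unfolding z_def using has_real_derivative_vderiv[OF skN that]
    by (auto intro!: derivative_eq_intros simp: power2_eq_square mult_ac)
  define E where "E j t = frechet_derivative ?\<Phi> (at (z t)) (axis j 1)" for j :: 2 and t
  have sE: "smooth_on N (E j)" for j
    unfolding E_def
    by (rule smooth_on_compose[OF smooth_on_derivative(2)[OF \<Phi>] sz]) (use zN N S in auto)
  define m where "m t = (2 * vderiv k t) *\<^sub>R E 1 t + (3 * k t * vderiv k t) *\<^sub>R E 2 t" for t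
  have sm: "smooth_on N m" unfolding m_def by (intro smooth_intros smooth_on_vderiv sE skN N)
  have vel: "vel t c = k t *\<^sub>R m t" if t: "t \<in> N" for t
  proof -
    have tc: "t \<in> dom_times c" using t by (simp add: N_def)
    have d\<Phi>: "(?\<Phi> has_derivative frechet_derivative ?\<Phi> (at (z t))) (at (z t))"
      by (rule smooth_on_derivative(1)[OF \<Phi> zN(3)[OF t]])
    let ?z' = "(2 * k t * vderiv k t) *\<^sub>R axis 1 1 + (3 * k t ^ 2 * vderiv k t) *\<^sub>R axis 2 1 :: real^2"
    have "((\<lambda>t. ?\<Phi> (z t)) has_vector_derivative frechet_derivative ?\<Phi> (at (z t)) ?z') (at t)"
      using vector_derivative_diff_chain_within[of z ?z' t UNIV ?\<Phi> "frechet_derivative ?\<Phi> (at (z t))"]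
        dz[OF t] has_derivative_at_withinI[OF d\<Phi>] unfolding o_def[of ?\<Phi>] by blast
    then have "((\<lambda>t. coord c (\<gamma> t)) has_vector_derivative frechet_derivative ?\<Phi> (at (z t)) ?z') (at t)"
      by (rule has_vector_derivative_transform_within_open[OF _ N t]) (use zN(4) in simp)
    from vderiv_eq[OF this] have "vel t c = frechet_derivative ?\<Phi> (at (z t)) ?z'"
      by (simp add: vel_self[OF c tc])
    also have "\<dots> = k t *\<^sub>R m t"
      using has_derivative_linear[OF d\<Phi>]
      by (simp add: linear_add linear_scale m_def E_def scaleR_add_right power2_eq_square mult_ac)
    finally show ?thesis .
  qed
  have z0: "z 0 = 0" by (simp add: z_def k0)
  have E1': "vderiv (E 1) 0 = 0"
  proof (rule vderiv_eq)
    let ?G = "\<lambda>y. frechet_derivative ?\<Phi> (at y) (axis 1 1)"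
    have dG: "(?G has_derivative frechet_derivative ?G (at (z 0))) (at (z 0))"
      by (rule smooth_on_derivative(1)[OF smooth_on_derivative(2)[OF \<Phi>] zN(3)[OF N0]])
    have "(z has_vector_derivative 0) (at 0)" using dz[OF N0] by (simp add: k0)
    then have "((\<lambda>t. ?G (z t)) has_vector_derivative frechet_derivative ?G (at (z 0)) 0) (at 0)"
      using vector_derivative_diff_chain_within[of z 0 0 UNIV ?G "frechet_derivative ?G (at (z 0))"]
        has_derivative_at_withinI[OF dG] unfolding o_def by blast
    then show "(E 1 has_vector_derivative 0) (at 0)"
      using linear_0[OF has_derivative_linear[OF dG]] unfolding E_def by simp
  qed
  have detE: "det2 (E 1 0) (E 2 0) \<noteq> 0"
  proof -
    have zS: "z 0 \<in> ?S" by (rule zN(3)[OF N0])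
    let ?J = "frechet_derivative ?\<Phi> (at (z 0))" and ?L = "frechet_derivative (transition c d) (at (?\<Phi> (z 0)))"
    have d1: "(?\<Phi> has_derivative ?J) (at (z 0))" by (rule smooth_on_derivative(1)[OF \<Phi> zS])
    have "?\<Phi> (z 0) \<in> ?S'" using zS param_coord[OF dchart] by auto
    from smooth_on_derivative(1)[OF \<Psi> this]
    have "(transition c d \<circ> ?\<Phi> has_derivative ?L \<circ> ?J) (at (z 0))" by (rule diff_chain_at[OF d1])
    then have "((\<lambda>y. y) has_derivative ?L \<circ> ?J) (at (z 0))"
      by (rule has_derivative_transform_within_open[OF _ S zS]) (use param_coord[OF dchart] c in auto)
    from has_derivative_unique[OF this has_derivative_ident] have "?L (?J v) = v" for v
      by (metis comp_apply)
    from det2_basis_neq_0[OF has_derivative_linear[OF d1] this] show ?thesis by (simp add: E_def)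
  qed
  have "det2 (m 0) (vderiv m 0) \<noteq> 0"
  proof -
    have "vderiv m 0 = (2 * vderiv (vderiv k) 0) *\<^sub>R E 1 0 + (3 * vderiv k 0 ^ 2) *\<^sub>R E 2 0"
    proof (rule vderiv_eq)
      have dk: "(k has_real_derivative vderiv k 0) (at 0)" by (rule has_real_derivative_vderiv[OF skN N0])
      have dk': "(vderiv k has_real_derivative vderiv (vderiv k) 0) (at 0)"
        by (rule has_real_derivative_vderiv[OF smooth_on_vderiv[OF N skN] N0])
      have dE: "(E j has_vector_derivative vderiv (E j) 0) (at 0)" for j
        by (rule has_vector_derivative_vderiv[OF sE N0])
      show "(m has_vector_derivative (2 * vderiv (vderiv k) 0) *\<^sub>R E 1 0 + (3 * vderiv k 0 ^ 2) *\<^sub>R E 2 0) (at 0)"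
        unfolding m_def
        by (rule derivative_eq_intros dk dk' dE refl)+ (simp add: k0 E1' power2_eq_square mult_ac)
    qed
    then have "det2 (m 0) (vderiv m 0) = 6 * vderiv k 0 ^ 3 * det2 (E 1 0) (E 2 0)"
      by (simp add: m_def k0 det2_def algebra_simps power2_eq_square power3_eq_cube)
    then show ?thesis using k'0 detE by simp
  qed
  obtain \<epsilon> where \<epsilon>: "\<epsilon> > 0" "{-\<epsilon><..<\<epsilon>} \<subseteq> N"
  proof -
    obtain e where "e > 0" "ball 0 e \<subseteq> N" using N N0 open_contains_ball by blast
    moreover have "ball 0 e = {-e<..<e}" by (auto simp: ball_def dist_real_def)
    ultimately show ?thesis using that by auto
  qed
  obtain \<kappa> where \<kappa>: "smooth_on {-\<epsilon><..<\<epsilon>} \<kappa>" "\<And>t. t \<in> {-\<epsilon><..<\<epsilon>} \<Longrightarrow> k t = t * \<kappa> t" "\<kappa> 0 = vderiv k 0"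
    using Hadamard[OF smooth_on_subset[OF skN \<epsilon>(2)] k0] by auto
  let ?w = "\<lambda>t. \<kappa> t *\<^sub>R m t"
  have sw: "smooth_on {-\<epsilon><..<\<epsilon>} m" by (rule smooth_on_subset[OF sm \<epsilon>(2)])
  have "vderiv ?w 0 = \<kappa> 0 *\<^sub>R vderiv m 0 + vderiv \<kappa> 0 *\<^sub>R m 0"
    using \<epsilon> by (intro vderiv_eq has_vector_derivative_scaleR has_vector_derivative_vderiv[OF sw]
        has_real_derivative_vderiv[OF \<kappa>(1)]) auto
  then have "det2 (?w 0) (vderiv ?w 0) = \<kappa> 0 ^ 2 * det2 (m 0) (vderiv m 0)"
    by (simp add: det2_def algebra_simps power2_eq_square)
  then have "det2 (?w 0) (vderiv ?w 0) \<noteq> 0"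
    using k'0 \<kappa>(3) \<open>det2 (m 0) (vderiv m 0) \<noteq> 0\<close> by simp
  moreover have "vel t c = t *\<^sub>R ?w t" if "t \<in> {-\<epsilon><..<\<epsilon>}" for t
    using vel[of t] \<kappa>(2)[OF that] \<epsilon>(2) that by (simp add: subset_iff)
  moreover have "{-\<epsilon><..<\<epsilon>} \<subseteq> dom_times c" using \<epsilon>(2) by (auto simp: N_def)
  moreover have "smooth_on {-\<epsilon><..<\<epsilon>} ?w" by (intro smooth_intros \<kappa> sw) auto
  ultimately show ?thesis using that c \<epsilon>(1) by blast
qed

lemma restrict_curve: "open I' \<Longrightarrow> I' \<subseteq> I \<Longrightarrow> curve_along A D \<Omega> \<gamma> I'"
  using smooth_\<gamma> unfolding smooth_curve_def
  by unfold_locales (auto simp: smooth_curve_def intro: continuous_on_subset smooth_on_subset)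

text \<open>The connection is linear in the velocity, hence does not contribute where \<open>\<gamma>\<close> is stationary. So the
  cusp condition, which concerns \<open>t = 0\<close>, can be read off from the components in a chart.\<close>

lemma cov_stationary:
  assumes c: "c \<in> A" "t \<in> dom_times c" and "vel t c = 0"
  shows "cov V t c = vderiv (\<lambda>u. V u c) t"
  using assms by (simp add: cov_self[OF c] D_coord_field vel_tangent)

text \<open>As \<open>\<gamma>\<close> is stationary at 0, the bracket \<open>[W, W']\<close> there is a positive multiple of the determinant of
  \<open>w(0)\<close> and \<open>w'(0)\<close>.\<close>

lemma cusp_germ_of_field:
  assumes c: "c \<in> A" and I: "\<And>t. t \<in> I \<Longrightarrow> \<gamma> t \<in> dom_of c" "0 \<in> I" and w: "smooth_on I w"
    and vel: "\<And>t. t \<in> I \<Longrightarrow> vel t c = t *\<^sub>R w t" and det: "det2 (w 0) (vderiv w 0) \<noteq> 0"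
  defines "W \<equiv> \<lambda>t. tvec c (\<gamma> t) (w t)"
  shows "field W" "\<And>t. t \<in> I \<Longrightarrow> velocity A \<gamma> t = (\<lambda>c. t *\<^sub>R W t c)"
    "br W (cov W) 0 \<noteq> 0"
proof -
  show W: "field W" unfolding W_def by (rule field_tvec[OF c I(1) w])
  have Wc: "W t c = w t" if "t \<in> I" for t using that c I by (simp add: W_def tvec_self)
  show "velocity A \<gamma> t = (\<lambda>c. t *\<^sub>R W t c)" if t: "t \<in> I" for t
    by (rule tangent_eqI[OF vel_tangent[OF t] tangent_scale[OF fieldD[OF W t]] c I(1)[OF t]])
       (simp add: Wc[OF t] vel[OF t])
  have t0: "0 \<in> dom_times c" using I by auto
  have "vderiv (\<lambda>u. W u c) 0 = vderiv w 0"
    by (rule vderiv_cong_open[OF open_I I(2)]) (simp add: Wc)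
  then have "cov W 0 c = vderiv w 0"
    using cov_stationary[OF c t0] vel[OF I(2)] by simp
  then show "br W (cov W) 0 \<noteq> 0"
    using det \<omega>_pos[OF c, of "coord c (\<gamma> 0)"] I by (simp add: br_eq[OF W field_cov[OF W] c t0] Wc)
qed

lemma cusp_germ_invariants:
  assumes a: "a > 0" "{-a<..<a} \<subseteq> I" and W: "field W"
    and vel: "\<And>t. t \<in> I \<Longrightarrow> velocity A \<gamma> t = (\<lambda>c. t *\<^sub>R W t c)"
    and \<sigma>: "\<sigma> = 1 \<or> \<sigma> = -1" "\<And>t. t \<in> {-a<..<a} \<Longrightarrow> \<sigma> * br W (cov W) t > 0"
  shows "cusp_germ a \<sigma> (br W (cov W)) (br (cov W) (cov (cov W)))"
    and "t \<in> {-a<..<a} \<Longrightarrow> arclength A D \<Omega> \<gamma> t =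
      sgn t * \<bar>t\<bar> powr (5/3) * cusp_germ.q \<sigma> (br W (cov W)) t"
    and "t \<in> {-a<..<a} \<Longrightarrow> arclength_3_5 A D \<Omega> \<gamma> t = cusp_germ.\<tau> \<sigma> (br W (cov W)) t"
    and "t \<in> {-a<..<a} - {0} \<Longrightarrow> normalized_curvature A D \<Omega> \<gamma> t =
      cusp_germ.F \<sigma> (br W (cov W)) (br (cov W) (cov (cov W))) t"
    and "t \<in> {-a<..<a} - {0} \<Longrightarrow> bracket A D \<Omega> \<gamma> 1 2 t \<noteq> 0"
    and "((\<lambda>t. (cusp_germ.F \<sigma> (br W (cov W)) (br (cov W) (cov (cov W))) t - 4/25) /
          cusp_germ.\<tau> \<sigma> (br W (cov W)) t ^ 2) \<longlongrightarrow>
            1/220 * root 5 (20/3) * cuspidal_curvature A D \<Omega> \<gamma>) (at 0)"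
proof -
  let ?g = "br W (cov W)" and ?h = "br (cov W) (cov (cov W))"
  show germ: "cusp_germ a \<sigma> ?g ?h"
    using a \<sigma> by unfold_locales
      (auto intro!: smooth_on_subset[OF smooth_br] W field_cov)
  interpret germ: cusp_germ a \<sigma> ?g ?h by (rule germ)
  note b = cusp_brackets[OF W vel]
  have inI: "t \<in> I" if "t \<in> {-a<..<a}" for t using a that by blast
  show arc: "arclength A D \<Omega> \<gamma> t = sgn t * \<bar>t\<bar> powr (5/3) * germ.q t" if t: "t \<in> {-a<..<a}" for t
    unfolding arclength_def by (rule germ.arclength_integral[OF t]) (rule b(1)[OF _ inI])
  show "arclength_3_5 A D \<Omega> \<gamma> t = germ.\<tau> t" if t: "t \<in> {-a<..<a}" for t
    unfolding arclength_3_5_def by (rule germ.root_arclength[OF t arc[OF t]])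
  show "normalized_curvature A D \<Omega> \<gamma> t = germ.F t" if t: "t \<in> {-a<..<a} - {0}" for t
  proof -
    have t': "t \<in> {-a<..<a}" "t \<noteq> 0" using t by auto
    show ?thesis
      unfolding normalized_curvature_def affine_curvature_def Let_def
      by (rule germ.normalized_curvature_eq_F[OF t' arc[OF t'(1)]]) (use b inI[OF t'(1)] vel in auto)
  qed
  show "bracket A D \<Omega> \<gamma> 1 2 t \<noteq> 0" if "t \<in> {-a<..<a} - {0}" for t
    using b(1)[OF _ inI, of t] \<sigma>(2)[of t] that vel by auto
  have 0: "0 \<in> I" using a by auto
  show "((\<lambda>t. (germ.F t - 4/25) / germ.\<tau> t ^ 2) \<longlongrightarrow> 1/220 * root 5 (20/3) * cuspidal_curvature A D \<Omega> \<gamma>) (at 0)"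
    by (rule germ.curvature_limit[OF cuspidal_curvature_def[unfolded Let_def]]) (use b 0 vel in auto)
qed

lemma cusp_theorem:
  assumes I: "I = {-\<delta><..<\<delta>}" "\<delta> > 0" and cusp: "has_cusp_at_0 A I \<gamma>"
  shows "\<exists>\<epsilon>>0. \<epsilon> \<le> \<delta> \<and>
           (let I = {-\<epsilon><..<\<epsilon>}; \<tau> = arclength_3_5 A D \<Omega> \<gamma>;
                f = normalized_curvature A D \<Omega> \<gamma>
            in
              (\<forall>t\<in>I - {0}. bracket A D \<Omega> \<gamma> 1 2 t \<noteq> 0) \<and>
              \<tau> 0 = 0 \<and> smooth_diffeo I (\<tau> ` I) \<tau> \<and>
              (\<exists>F. smooth_on I F \<and> (\<forall>t\<in>I - {0}. F t = f t) \<and>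
                   F 0 = 4/25 \<and> (F has_real_derivative 0) (at 0)) \<and>
              (\<exists>G. smooth_on (\<tau> ` I) G \<and> (\<forall>t\<in>I - {0}. G (\<tau> t) = f t) \<and>
                   G 0 = 4/25 \<and> (G has_real_derivative 0) (at 0)) \<and>
              ((\<lambda>t. (f t - 4/25) / (\<tau> t)^2) \<longlongrightarrow>
                 1/220 * root 5 (20/3) * cuspidal_curvature A D \<Omega> \<gamma>) (at 0))"
proof -
  obtain c e w where c: "c \<in> A" and e: "e > 0" "{-e<..<e} \<subseteq> dom_times c" and w: "smooth_on {-e<..<e} w"
    "\<And>t. t \<in> {-e<..<e} \<Longrightarrow> vel t c = t *\<^sub>R w t" "det2 (w 0) (vderiv w 0) \<noteq> 0"
    using cusp_velocity[OF cusp] by blast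
  interpret C: curve_along A D \<Omega> \<gamma> "{-e<..<e}"
    by (rule restrict_curve) (use e in auto)
  define W where "W t = tvec c (\<gamma> t) (w t)" for t
  have W: "C.field W" and vel: "\<And>t. t \<in> {-e<..<e} \<Longrightarrow> velocity A \<gamma> t = (\<lambda>c. t *\<^sub>R W t c)"
    and g0: "br W (cov W) 0 \<noteq> 0"
  proof -
    have in_dom: "\<gamma> t \<in> dom_of c" if "t \<in> {-e<..<e}" for t using e(2) that by blast
    have 0: "0 \<in> {-e<..<e}" using e(1) by simp
    note C = C.cusp_germ_of_field[OF c in_dom 0 w, folded W_def]
    show "C.field W" "br W (cov W) 0 \<noteq> 0" by (rule C; simp)+
    show "velocity A \<gamma> t = (\<lambda>c. t *\<^sub>R W t c)" if "t \<in> {-e<..<e}" for t by (rule C(2)) (use that in auto)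
  qed
  let ?g = "br W (cov W)"
  define \<sigma> where "\<sigma> = sgn (?g 0)"
  have sg: "smooth_on {-e<..<e} ?g" by (intro C.smooth_br W C.field_cov)
  have "isCont (\<lambda>t. \<sigma> * ?g t) 0"
    using smooth_on_continuous[OF sg] e by (intro continuous_intros) (auto simp: continuous_on_eq_continuous_at)
  moreover have "\<sigma> * ?g 0 > 0" using g0 by (auto simp: \<sigma>_def sgn_if)
  ultimately have "\<forall>\<^sub>F t in at 0. \<sigma> * ?g t > 0"
    unfolding isCont_def by (rule order_tendstoD)
  then obtain r where r: "r > 0" "\<And>t. t \<noteq> 0 \<Longrightarrow> \<bar>t\<bar> < r \<Longrightarrow> \<sigma> * ?g t > 0"
    by (auto simp: eventually_at dist_real_def)
  define \<epsilon> where "\<epsilon> = min r e"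
  have \<epsilon>: "\<epsilon> > 0" "{-\<epsilon><..<\<epsilon>} \<subseteq> {-e<..<e}" using r e by (auto simp: \<epsilon>_def)
  have \<sigma>: "\<sigma> = 1 \<or> \<sigma> = -1" "\<And>t. t \<in> {-\<epsilon><..<\<epsilon>} \<Longrightarrow> \<sigma> * ?g t > 0"
  proof -
    show "\<sigma> = 1 \<or> \<sigma> = -1" using g0 by (auto simp: \<sigma>_def sgn_if)
    show "\<sigma> * ?g t > 0" if "t \<in> {-\<epsilon><..<\<epsilon>}" for t
      using r(2)[of t] that \<open>\<sigma> * ?g 0 > 0\<close> by (cases "t = 0") (auto simp: \<epsilon>_def)
  qed
  note inv = C.cusp_germ_invariants[OF \<epsilon> W vel \<sigma>]
  interpret germ: cusp_germ \<epsilon> \<sigma> ?g "br (cov W) (cov (cov W))" by (rule inv(1))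
  have le: "\<epsilon> \<le> \<delta>"
  proof (rule ccontr)
    assume "\<not> \<epsilon> \<le> \<delta>"
    then have "\<delta> \<in> {-\<epsilon><..<\<epsilon>}" using I by auto
    then have "\<delta> \<in> I" using \<epsilon>(2) e(2) by blast
    then show False using I by simp
  qed
  have lim: "((\<lambda>t. (normalized_curvature A D \<Omega> \<gamma> t - 4/25) / (arclength_3_5 A D \<Omega> \<gamma> t)\<^sup>2) \<longlongrightarrow>
                 1/220 * root 5 (20/3) * cuspidal_curvature A D \<Omega> \<gamma>) (at 0)"
  proof (rule Lim_transform_eventually[OF inv(6)])
    have "\<forall>\<^sub>F t in at 0. t \<in> {-\<epsilon><..<\<epsilon>} - {0}"
      using \<epsilon>(1) by (auto simp: eventually_at intro!: exI[of _ \<epsilon>])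
    then show "\<forall>\<^sub>F t in at 0. (germ.F t - 4/25) / (germ.\<tau> t)\<^sup>2 =
        (normalized_curvature A D \<Omega> \<gamma> t - 4/25) / (arclength_3_5 A D \<Omega> \<gamma> t)\<^sup>2"
      by eventually_elim (use inv(3,4) in auto)
  qed
  have "arclength_3_5 A D \<Omega> \<gamma> 0 = 0" using inv(3)[of 0] \<epsilon> by (simp add: germ.\<tau>_def)
  moreover have "\<exists>F. smooth_on {-\<epsilon><..<\<epsilon>} F \<and> (\<forall>t\<in>{-\<epsilon><..<\<epsilon>} - {0}. F t = normalized_curvature A D \<Omega> \<gamma> t) \<and>
                   F 0 = 4/25 \<and> (F has_real_derivative 0) (at 0)"
    using germ.smooth_F germ.F_0 germ.F_deriv_0 inv(4) by (intro exI[of _ germ.F]) auto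
  ultimately show ?thesis
    unfolding Let_def using \<epsilon>(1) le inv(5) germ.smooth_diffeo_\<tau>[OF inv(3,4)] lim
    by (intro exI[of _ \<epsilon>] conjI) simp_all
qed

end


section \<open>Ordinary differential equations\<close>

text \<open>Picard iteration. The solution is the fixed point of the integral operator on the closed set of
  bounded continuous functions with values in a small ball around \<open>z0\<close>. These functions are defined on
  the whole line, and the operator makes them constant outside of \<open>[-a, a]\<close>. Smoothness follows by induction,
  because \<open>F (t, z t)\<close>, the derivative of \<open>z\<close>, is as regular as \<open>z\<close>.\<close>

lemma smooth_ode_solution:
  fixes F :: "real \<times> 'a::euclidean_space \<Rightarrow> 'a"
  assumes F: "smooth_on S F" and S: "open S" and z0: "(0, z0) \<in> S"
  obtains a z where "a > 0" "z 0 = z0" "smooth_on {-a<..<a} z"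
    "\<And>t. t \<in> {-a<..<a} \<Longrightarrow> (t, z t) \<in> S"
    "\<And>t. t \<in> {-a<..<a} \<Longrightarrow> (z has_vector_derivative F (t, z t)) (at t)"
proof -
  obtain e where e: "e > 0" "cball (0, z0) e \<subseteq> S" using S z0 open_contains_cball by blast
  define r where "r = e / 2"
  define Z where "Z = cball z0 r"
  have r: "r > 0" using e by (simp add: r_def)
  have sub: "(t, z) \<in> S" if "\<bar>t\<bar> \<le> r" "z \<in> Z" for t z
  proof -
    have "dist (0, z0) (t, z) \<le> dist 0 t + dist z0 z"
      unfolding dist_Pair_Pair by (rule sqrt_sum_squares_le_sum) auto
    also have "\<dots> \<le> e" using that by (simp add: r_def Z_def)
    finally show ?thesis using e(2) by auto
  qed
  let ?K = "{-r..r} \<times> Z"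
  have KS: "?K \<subseteq> S" using sub by auto
  have K: "compact ?K" unfolding Z_def by (intro compact_Times compact_Icc compact_cball)
  have bounded: "\<exists>B. \<forall>p\<in>?K. norm (f p) \<le> B" if "continuous_on S f" for f :: "real \<times> 'a \<Rightarrow> 'a"
    using compact_imp_bounded[OF compact_continuous_image[OF continuous_on_subset[OF that KS] K]]
    by (auto simp: bounded_iff)
  obtain B where B: "\<And>p. p \<in> ?K \<Longrightarrow> norm (F p) \<le> B" using bounded[OF smooth_on_continuous[OF F]] by blast
  let ?DF = "\<lambda>p. frechet_derivative F (at p)"
  have "\<forall>b. \<exists>C. \<forall>p\<in>?K. norm (?DF p (0, b)) \<le> C"
    using bounded smooth_on_continuous[OF smooth_on_derivative(2)[OF F]] by blast
  then obtain C where C: "\<And>b p. p \<in> ?K \<Longrightarrow> norm (?DF p (0, b)) \<le> C b" by metis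
  define L where "L = (\<Sum>b\<in>Basis. C b)"
  have Lip: "norm (F (t, x) - F (t, y)) \<le> L * norm (x - y)" if t: "\<bar>t\<bar> \<le> r" and xy: "x \<in> Z" "y \<in> Z" for t x y
  proof (rule differentiable_bound[where S = Z and f' = "\<lambda>x v. ?DF (t, x) (0, v)"])
    show "convex Z" by (simp add: Z_def)
    fix u assume u: "u \<in> Z"
    have D: "(F has_derivative ?DF (t, u)) (at (t, u))"
      by (rule smooth_on_derivative(1)[OF F sub[OF t u]])
    have "((\<lambda>x. (t, x)) has_derivative (\<lambda>v. (0, v))) (at u)"
      by (auto intro!: derivative_eq_intros)
    from has_derivative_compose[OF this, of F] D
    show "((\<lambda>x. F (t, x)) has_derivative (\<lambda>v. ?DF (t, u) (0, v))) (at u within Z)"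
      by (simp add: has_derivative_at_withinI)
    show "onorm (\<lambda>v. ?DF (t, u) (0, v)) \<le> L"
    proof (rule onorm_le)
      fix v :: 'a
      have lin: "linear (\<lambda>v. ?DF (t, u) (0, v))"
        using has_derivative_linear[OF D]
        by (intro linearI) (simp_all add: linear_add[symmetric] linear_scale[symmetric])
      have tu: "(t, u) \<in> ?K" using t u by auto
      have "?DF (t, u) (0, v) = ?DF (t, u) (0, \<Sum>b\<in>Basis. (v \<bullet> b) *\<^sub>R b)"
        by (simp only: euclidean_representation)
      also have "\<dots> = (\<Sum>b\<in>Basis. (v \<bullet> b) *\<^sub>R ?DF (t, u) (0, b))"
        using linear_sum[OF lin, of "\<lambda>b. (v \<bullet> b) *\<^sub>R b" Basis] linear_scale[OF lin] by simp
      finally have "norm (?DF (t, u) (0, v)) \<le> (\<Sum>b\<in>Basis. norm ((v \<bullet> b) *\<^sub>R ?DF (t, u) (0, b)))"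
        by (simp only: norm_sum)
      also have "\<dots> \<le> (\<Sum>b\<in>Basis. norm v * C b)"
        using C[OF tu] by (intro sum_mono) (auto intro!: mult_mono Basis_le_norm)
      also have "\<dots> = L * norm v" by (simp add: L_def sum_distrib_left mult.commute)
      finally show "norm (?DF (t, u) (0, v)) \<le> L * norm v" .
    qed
  qed (use xy in auto)
  \<comment> \<open>The operator is a difference of integrals over intervals of lengths at most \<open>2 a\<close> and \<open>a\<close>, whence the
    factors 3. The bounds keep the values in the ball and make the operator a contraction by 1/2.\<close>
  define a where "a = Min {r, r / (3 * (\<bar>B\<bar> + 1)), 1 / (6 * (\<bar>L\<bar> + 1))}"
  have a: "a > 0" "a \<le> r" and "a \<le> r / (3 * (\<bar>B\<bar> + 1))" "a \<le> 1 / (6 * (\<bar>L\<bar> + 1))"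
    unfolding a_def using r by auto
  then have "a * (3 * (\<bar>B\<bar> + 1)) \<le> r" "a * (6 * (\<bar>L\<bar> + 1)) \<le> 1"
    by (simp_all add: pos_le_divide_eq)
  moreover have "(3 * a) * B \<le> (3 * a) * (\<bar>B\<bar> + 1)" "(6 * a) * L \<le> (6 * a) * (\<bar>L\<bar> + 1)"
    by (rule mult_left_mono; use a in simp)+
  ultimately have aB: "3 * a * B \<le> r" and aL: "6 * a * L \<le> 1" by linarith+
  have B0: "B \<ge> 0" using B[of "(0, z0)"] r by (force simp: Z_def intro: order_trans[OF norm_ge_zero])
  define cl where "cl t = max (-a) (min a t)" for t :: real
  define \<Phi> where "\<Phi> \<psi> t = z0 + (integral {-a..cl t} \<psi> - integral {-a..0} \<psi>)" for \<psi> :: "real \<Rightarrow> 'a" and t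
  have \<Phi>_bound: "norm (integral {-a..cl t} \<psi> - integral {-a..0} \<psi>) \<le> 3 * a * M"
    if \<psi>: "continuous_on {-a..a} \<psi>" and M: "\<And>s. s \<in> {-a..a} \<Longrightarrow> norm (\<psi> s) \<le> M" for \<psi> :: "real \<Rightarrow> 'a" and M t
  proof -
    have M0: "M \<ge> 0" using M[of 0] a by (auto intro: order_trans[OF norm_ge_zero])
    have i: "norm (integral {-a..s} \<psi>) \<le> M * (s + a)" if "s \<in> {-a..a}" for s
    proof -
      have "continuous_on {-a..s} \<psi>" by (rule continuous_on_subset[OF \<psi>]) (use that in auto)
      from integral_bound[OF _ this, of M] M that show ?thesis by auto
    qed
    have "norm (integral {-a..cl t} \<psi>) \<le> M * (cl t + a)" by (rule i) (use a in \<open>auto simp: cl_def\<close>)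
    also have "\<dots> \<le> M * (a + a)" using M0 a by (intro mult_left_mono) (auto simp: cl_def)
    finally have "norm (integral {-a..cl t} \<psi>) \<le> M * (a + a)" .
    moreover have "norm (integral {-a..0} \<psi>) \<le> M * (0 + a)" by (rule i) (use a in auto)
    ultimately show ?thesis
      using norm_triangle_ineq4[of "integral {-a..cl t} \<psi>" "integral {-a..0} \<psi>"] by (simp add: algebra_simps)
  qed
  have \<Phi>_bcont: "\<Phi> \<psi> \<in> bcontfun"
    if \<psi>: "continuous_on {-a..a} \<psi>" "\<And>s. s \<in> {-a..a} \<Longrightarrow> norm (\<psi> s) \<le> M" for \<psi> :: "real \<Rightarrow> 'a" and M
  proof (rule bcontfun_normI)
    show "continuous_on UNIV (\<Phi> \<psi>)"
      unfolding \<Phi>_def using a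
      by (intro continuous_intros continuous_on_compose2[OF indefinite_integral_continuous_1[OF integrable_continuous_real[OF \<psi>(1)]]])
         (auto simp: cl_def intro!: continuous_intros)
    show "norm (\<Phi> \<psi> t) \<le> norm z0 + 3 * a * M" for t
      unfolding \<Phi>_def using norm_triangle_ineq \<Phi>_bound[OF \<psi>, of t] by (smt (verit))
  qed
  define P where "P = (PiC UNIV (\<lambda>_. Z) :: (real \<Rightarrow>\<^sub>C 'a) set)"
  define \<psi> where "\<psi> u s = F (s, apply_bcontfun u s)" for u :: "real \<Rightarrow>\<^sub>C 'a" and s
  define T where "T u = Bcontfun (\<Phi> (\<psi> u))" for u
  have uZ: "apply_bcontfun u t \<in> Z" if "u \<in> P" for u t
    using that by (auto simp: P_def mem_PiC_iff)
  have \<psi>_cont: "continuous_on {-a..a} (\<psi> u)" if "u \<in> P" for u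
    unfolding \<psi>_def
    by (rule continuous_on_compose2[OF smooth_on_continuous[OF F]])
       (use that uZ a sub in \<open>auto intro!: continuous_intros\<close>)
  have \<psi>_bound: "norm (\<psi> u s) \<le> B" if "u \<in> P" "s \<in> {-a..a}" for u s
    unfolding \<psi>_def by (rule B) (use that uZ a in auto)
  have T_apply: "apply_bcontfun (T u) = \<Phi> (\<psi> u)" if "u \<in> P" for u
    unfolding T_def by (rule Bcontfun_inverse[OF \<Phi>_bcont[OF \<psi>_cont \<psi>_bound]]) (use that in auto)
  have "\<exists>!u\<in>P. T u = u"
  proof (rule Banach_fix)
    show "complete P" unfolding P_def Z_def
      by (intro closed_PiC[THEN complete_eq_closed[THEN iffD2]] closed_cball)
    have "const_bcontfun z0 \<in> P" using r by (simp add: P_def Z_def mem_PiC_iff const_bcontfun.rep_eq)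
    then show "P \<noteq> {}" by blast
    show "T ` P \<subseteq> P"
    proof (rule image_subsetI, subst P_def, rule mem_PiCI, rule Pi_I)
      fix u t assume u: "u \<in> P"
      have "dist z0 (\<Phi> (\<psi> u) t) \<le> 3 * a * B"
        using \<Phi>_bound[OF \<psi>_cont[OF u] \<psi>_bound[OF u]] by (simp add: \<Phi>_def dist_norm norm_minus_commute)
      then show "apply_bcontfun (T u) t \<in> Z" using aB by (simp add: T_apply[OF u] Z_def)
    qed
    show "dist (T u) (T v) \<le> 1/2 * dist u v" if u: "u \<in> P" and v: "v \<in> P" for u v
    proof (rule dist_bound)
      fix t
      let ?d = "\<lambda>s. \<psi> u s - \<psi> v s"
      have "continuous_on {-a..a} ?d" by (intro continuous_intros \<psi>_cont u v)
      moreover have "norm (?d s) \<le> L * dist u v" if s: "s \<in> {-a..a}" for s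
      proof -
        have "norm (?d s) \<le> L * norm (apply_bcontfun u s - apply_bcontfun v s)"
          unfolding \<psi>_def by (rule Lip) (use s a uZ u v in auto)
        also have "\<dots> \<le> L * dist u v"
        proof (rule mult_left_mono)
          show "norm (apply_bcontfun u s - apply_bcontfun v s) \<le> dist u v"
            using dist_bounded[of u s v] by (simp add: dist_norm)
          have "C b \<ge> 0" for b using C[of "(0, z0)" b] r by (force simp: Z_def intro: order_trans[OF norm_ge_zero])
          then show "L \<ge> 0" unfolding L_def by (intro sum_nonneg)
        qed
        finally show ?thesis .
      qed
      ultimately have bound: "norm (integral {-a..cl t} ?d - integral {-a..0} ?d) \<le> 3 * a * (L * dist u v)"
        by (rule \<Phi>_bound)
      have int: "\<psi> w integrable_on {-a..s}" if "w \<in> P" "s \<in> {-a..a}" for w s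
        using \<psi>_cont[OF that(1)] that(2) by (intro integrable_continuous_real) (auto intro: continuous_on_subset)
      have diff: "integral {-a..s} ?d = integral {-a..s} (\<psi> u) - integral {-a..s} (\<psi> v)" if "s \<in> {-a..a}" for s
        by (intro integral_diff int u v that)
      have "cl t \<in> {-a..a}" "0 \<in> {-a..a}" using a by (auto simp: cl_def)
      then have "\<Phi> (\<psi> u) t - \<Phi> (\<psi> v) t = integral {-a..cl t} ?d - integral {-a..0} ?d"
        by (simp only: diff \<Phi>_def) simp
      then have "dist (\<Phi> (\<psi> u) t) (\<Phi> (\<psi> v) t) \<le> 3 * a * (L * dist u v)"
        using bound by (simp only: dist_norm)
      also have "\<dots> = (6 * a * L) * (1/2 * dist u v)" by simp
      also have "\<dots> \<le> 1 * (1/2 * dist u v)" using aL by (intro mult_right_mono) auto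
      finally show "dist (apply_bcontfun (T u) t) (apply_bcontfun (T v) t) \<le> 1/2 * dist u v"
        by (simp add: T_apply u v)
    qed
  qed auto
  then obtain u where u: "u \<in> P" "T u = u" by blast
  define z where "z = apply_bcontfun u"
  have z_eq: "z = \<Phi> (\<psi> u)" using T_apply[OF u(1)] u(2) by (simp add: z_def)
  have zZ: "z t \<in> Z" for t using uZ[OF u(1)] by (simp add: z_def)
  have der: "(z has_vector_derivative F (t, z t)) (at t)" if t: "t \<in> {-a<..<a}" for t
  proof -
    have "((\<lambda>s. integral {-a..s} (\<psi> u)) has_vector_derivative \<psi> u t) (at t within {-a..a})"
      using t by (intro integral_has_vector_derivative \<psi>_cont u) auto
    moreover have "at t within {-a..a} = at t" using t by (intro at_within_interior) auto
    ultimately have "((\<lambda>s. z0 + (integral {-a..s} (\<psi> u) - integral {-a..0} (\<psi> u))) has_vector_derivative \<psi> u t) (at t)"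
      by (auto intro!: derivative_eq_intros)
    then have "(z has_vector_derivative \<psi> u t) (at t)"
      by (rule has_vector_derivative_transform_within_open[where S = "{-a<..<a}"])
         (use t in \<open>auto simp: z_eq \<Phi>_def cl_def\<close>)
    then show ?thesis by (simp add: \<psi>_def z_def)
  qed
  have inS: "(t, z t) \<in> S" if "t \<in> {-a<..<a}" for t using sub[OF _ zZ] that a by auto
  have "Ck_on k {-a<..<a} z" for k
  proof (induction k)
    case 0
    show ?case using continuous_on_apply_bcontfun by (simp add: z_def)
  next
    case (Suc k)
    have id: "Ck_on k {-a<..<a} (\<lambda>t. t)" using smooth_on_id[of "{-a<..<a}"] by (simp add: smooth_on_def)
    have "Ck_on k {-a<..<a} (\<lambda>t. F (t, z t))"
      by (rule Ck_on_compose[OF _ S _ _ Ck_on_Pair[OF _ id Suc]])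
         (use F inS in \<open>auto simp: smooth_on_def\<close>)
    with der show ?case by (rule Ck_on_Suc_real[OF open_greaterThanLessThan])
  qed
  then have "smooth_on {-a<..<a} z" by (simp add: smooth_on_def)
  moreover have "z 0 = z0" using a by (simp add: z_eq \<Phi>_def cl_def)
  ultimately show ?thesis using that[OF a(1)] inS der by blast
qed


section \<open>Borel's lemma and smooth even functions\<close>

abbreviation smooth :: "(real \<Rightarrow> real) \<Rightarrow> bool" where "smooth \<equiv> smooth_on UNIV"

abbreviation nderiv :: "nat \<Rightarrow> (real \<Rightarrow> real) \<Rightarrow> real \<Rightarrow> real" where
  "nderiv k f \<equiv> (vderiv ^^ k) f"

lemma smooth_nderiv: "smooth f \<Longrightarrow> smooth (nderiv k f)"
  by (induction k) (auto intro: smooth_on_vderiv)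

lemma nderiv_Suc: "nderiv (Suc k) f = nderiv k (vderiv f)"
  by (simp add: funpow_swap1)

lemma has_real_derivative_smooth: "smooth f \<Longrightarrow> (f has_real_derivative vderiv f x) (at x)"
  by (rule has_real_derivative_vderiv[of UNIV]) auto

lemma vderiv_eqI:
  assumes "\<And>x. (f has_real_derivative f' x) (at x)"
  shows "vderiv f = f'"
  using assms by (auto intro!: ext vderiv_eq simp: has_real_derivative_iff_has_vector_derivative)

lemma vderiv_add: "smooth f \<Longrightarrow> smooth g \<Longrightarrow> vderiv (\<lambda>x. f x + g x) = (\<lambda>x. vderiv f x + vderiv g x)"
  by (rule vderiv_eqI) (auto intro!: derivative_eq_intros has_real_derivative_smooth)

lemma vderiv_mult: "smooth f \<Longrightarrow> smooth g \<Longrightarrow> vderiv (\<lambda>x. f x * g x) = (\<lambda>x. vderiv f x * g x + f x * vderiv g x)"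
  by (rule vderiv_eqI) (auto intro!: derivative_eq_intros has_real_derivative_smooth)

lemma nderiv_add: "smooth f \<Longrightarrow> smooth g \<Longrightarrow> nderiv k (\<lambda>x. f x + g x) = (\<lambda>x. nderiv k f x + nderiv k g x)"
  by (induction k) (auto simp: vderiv_add smooth_nderiv)

lemma nderiv_scaled:
  assumes f: "smooth f"
  shows "nderiv k (\<lambda>x. d * f (l * x)) = (\<lambda>x. d * l ^ k * nderiv k f (l * x))"
proof (induction k)
  case (Suc k)
  have "vderiv (\<lambda>x. d * l ^ k * nderiv k f (l * x)) = (\<lambda>x. d * l ^ Suc k * nderiv (Suc k) f (l * x))"
    by (rule vderiv_eqI)
       (auto intro!: derivative_eq_intros DERIV_chain2[OF has_real_derivative_smooth[OF smooth_nderiv[OF f]]])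
  then show ?case using Suc by simp
qed simp

text \<open>If all derivatives of \<open>f\<close> are bounded, then the derivatives of order less than \<open>n\<close> of
  \<open>f (l x) / l\<^sup>n\<close> become uniformly small for large \<open>l\<close>, while the derivative of order \<open>n\<close> at 0 stays the same.\<close>

definition bounded_derivs :: "(real \<Rightarrow> real) \<Rightarrow> bool" where
  "bounded_derivs f \<longleftrightarrow> smooth f \<and> (\<forall>k. \<exists>M. \<forall>x. \<bar>nderiv k f x\<bar> \<le> M)"

lemma bounded_derivs_vderiv: "bounded_derivs f \<Longrightarrow> bounded_derivs (vderiv f)"
  unfolding bounded_derivs_def by (auto intro!: smooth_on_vderiv simp: nderiv_Suc[symmetric] simp del: funpow.simps)

lemma bounded_derivs_mult:
  assumes "bounded_derivs f" "bounded_derivs g"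
  shows "bounded_derivs (\<lambda>x. f x * g x)"
proof -
  have sm: "smooth f" if "bounded_derivs f" for f using that by (simp add: bounded_derivs_def)
  have "\<exists>M. \<forall>x. \<bar>nderiv k (\<lambda>x. f x * g x) x\<bar> \<le> M" if "bounded_derivs f" "bounded_derivs g" for k f g
    using that
  proof (induction k arbitrary: f g)
    case 0
    then obtain M N where MN: "\<forall>x. \<bar>nderiv 0 f x\<bar> \<le> M" "\<forall>x. \<bar>nderiv 0 g x\<bar> \<le> N" unfolding bounded_derivs_def by metis
    have "\<bar>f x * g x\<bar> \<le> M * N" for x
      using MN by (auto simp: abs_mult intro!: mult_mono order_trans[OF abs_ge_zero])
    then show ?case by auto
  next
    case (Suc k)
    obtain M N where MN: "\<forall>x. \<bar>nderiv k (\<lambda>x. vderiv f x * g x) x\<bar> \<le> M"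
      "\<forall>x. \<bar>nderiv k (\<lambda>x. f x * vderiv g x) x\<bar> \<le> N"
      using Suc.IH[OF bounded_derivs_vderiv[OF Suc.prems(1)] Suc.prems(2)]
        Suc.IH[OF Suc.prems(1) bounded_derivs_vderiv[OF Suc.prems(2)]] by metis
    have eq: "nderiv (Suc k) (\<lambda>x. f x * g x) x = nderiv k (\<lambda>x. vderiv f x * g x) x + nderiv k (\<lambda>x. f x * vderiv g x) x" for x
      unfolding nderiv_Suc vderiv_mult[OF sm[OF Suc.prems(1)] sm[OF Suc.prems(2)]]
      by (subst nderiv_add) (intro smooth_on_mult smooth_on_vderiv sm[OF Suc.prems(1)] sm[OF Suc.prems(2)] open_UNIV refl)+
    have "\<bar>nderiv (Suc k) (\<lambda>x. f x * g x) x\<bar> \<le> M + N" for x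
      unfolding eq using MN(1)[rule_format, of x] MN(2)[rule_format, of x] by linarith
    then show ?case by blast
  qed
  then show ?thesis using assms by (auto simp: bounded_derivs_def intro: smooth_on_mult)
qed

lemma has_real_derivative_trig:
  "((\<lambda>x. a * sin x + b * cos x) has_real_derivative (- b) * sin x + a * cos x) (at (x::real))"
  by (auto intro!: derivative_eq_intros)

lemma smooth_trig: "smooth (\<lambda>x. a * sin x + b * cos x)"
  by (rule smooth_on_closed_class[where P = "\<lambda>f. \<exists>a b. f = (\<lambda>x. a * sin x + b * cos x)"])
     (use has_real_derivative_trig has_real_derivative_iff_has_vector_derivative in blast)+

lemma smooth_sin: "smooth sin" and smooth_cos: "smooth cos"
  using smooth_trig[of 1 0] smooth_trig[of 0 1] by simp_all

lemma bounded_derivs_sin: "bounded_derivs sin"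
proof -
  have "\<exists>a b. nderiv k sin = (\<lambda>x. a * sin x + b * cos x) \<and> \<bar>a\<bar> \<le> 1 \<and> \<bar>b\<bar> \<le> 1" for k
  proof (induction k)
    case 0
    show ?case by (intro exI[of _ 1] exI[of _ 0]) auto
  next
    case (Suc k)
    then obtain a b where ab: "nderiv k sin = (\<lambda>x. a * sin x + b * cos x)" "\<bar>a\<bar> \<le> 1" "\<bar>b\<bar> \<le> 1" by blast
    have "nderiv (Suc k) sin = (\<lambda>x. (- b) * sin x + a * cos x)"
      using vderiv_eqI[OF has_real_derivative_trig[of a b]] by (simp add: ab(1))
    then show ?case using ab(2,3) by (intro exI[of _ "- b"] exI[of _ a]) auto
  qed
  moreover have "\<bar>a * sin x + b * cos x\<bar> \<le> 2" if "\<bar>a\<bar> \<le> 1" "\<bar>b\<bar> \<le> 1" for a b x :: real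
    using abs_triangle_ineq[of "a * sin x" "b * cos x"] mult_mono[OF that(1) abs_sin_le_one[of x]]
      mult_mono[OF that(2) abs_cos_le_one[of x]] by (simp add: abs_mult)
  ultimately have "\<bar>nderiv k sin x\<bar> \<le> 2" for k x by metis
  then show ?thesis unfolding bounded_derivs_def using smooth_sin by blast
qed

lemma bounded_derivs_sin_power: "bounded_derivs (\<lambda>x. sin x ^ n)"
proof (induction n)
  case 0
  have "nderiv k (\<lambda>x. 1) = (\<lambda>x. if k = 0 then 1 else 0)" for k
  proof (induction k)
    case (Suc k)
    have "vderiv (\<lambda>x::real. if k = 0 then 1 else 0::real) = (\<lambda>x. 0)" by (rule vderiv_eqI) auto
    with Suc show ?case by simp
  qed simp
  then show ?case unfolding bounded_derivs_def by (auto intro: smooth_on_const)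
next
  case (Suc n)
  from bounded_derivs_mult[OF bounded_derivs_sin Suc] show ?case by simp
qed

text \<open>At 0 the power \<open>sin x ^ n\<close> has the same derivatives as \<open>x ^ n\<close> up to the order \<open>n\<close>, but its derivatives are
  bounded on the whole line. The factor \<open>g\<close> makes the induction work.\<close>

lemma nderiv_sin_power_0:
  assumes "smooth g" "k \<le> n"
  shows "nderiv k (\<lambda>x. sin x ^ n * g x) 0 = (if k = n then fact n * g 0 else 0)"
  using assms
proof (induction n arbitrary: g k)
  case (Suc n)
  show ?case
  proof (cases k)
    case (Suc j)
    let ?G = "\<lambda>x. real (Suc n) * cos x * g x + sin x * vderiv g x"
    have "vderiv (\<lambda>x. sin x ^ Suc n * g x) = (\<lambda>x. sin x ^ n * ?G x)"
    proof (rule vderiv_eqI)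
      fix x
      have "((\<lambda>x. sin x ^ Suc n * g x) has_real_derivative
          ((1 + real n) * (cos x * sin x ^ n)) * g x + vderiv g x * sin x ^ Suc n) (at x)"
        by (intro DERIV_mult DERIV_power_Suc DERIV_sin has_real_derivative_smooth Suc.prems)
      then show "((\<lambda>x. sin x ^ Suc n * g x) has_real_derivative sin x ^ n * ?G x) (at x)"
        by (rule DERIV_cong) (simp add: algebra_simps)
    qed
    moreover have "smooth ?G"
      by (intro smooth_on_add smooth_on_mult smooth_on_const smooth_sin smooth_cos smooth_on_vderiv Suc.prems) auto
    ultimately show ?thesis using Suc.IH[of ?G j] Suc.prems(2) \<open>k = Suc j\<close>
      by (simp add: nderiv_Suc algebra_simps del: funpow.simps)
  qed simp
qed simp

lemma geometric_Cauchy: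
  fixes a :: "nat \<Rightarrow> real"
  assumes "\<And>n. n \<ge> N \<Longrightarrow> \<bar>a (Suc n) - a n\<bar> \<le> (1/2) ^ n"
  shows "\<exists>L. a \<longlonglongrightarrow> L \<and> (\<forall>n\<ge>N. \<bar>a n - L\<bar> \<le> 2 * (1/2) ^ n)"
proof -
  have diff: "\<bar>a (n + k) - a n\<bar> \<le> 2 * (1/2) ^ n - 2 * (1/2) ^ (n + k)" if "n \<ge> N" for n k
  proof (induction k)
    case (Suc k)
    have "\<bar>a (Suc (n + k)) - a (n + k)\<bar> \<le> (1/2) ^ (n + k)" using that by (intro assms) simp
    moreover have "2 * (1/2) ^ (n + Suc k) = ((1/2) ^ (n + k) :: real)" by simp
    ultimately show ?case using Suc by simp
  qed simp
  have diff': "\<bar>a m - a n\<bar> \<le> 2 * (1/2) ^ n" if "n \<ge> N" "m \<ge> n" for m n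
  proof -
    have "\<bar>a m - a n\<bar> \<le> 2 * (1/2) ^ n - 2 * (1/2) ^ m" using diff[OF that(1), of "m - n"] that by simp
    moreover have "(0::real) \<le> (1/2) ^ m" by simp
    ultimately show ?thesis by linarith
  qed
  have "Cauchy a"
  proof (rule metric_CauchyI)
    fix e :: real assume "e > 0"
    have "(\<lambda>n. 4 * (1/2::real) ^ n) \<longlonglongrightarrow> 4 * 0" by (intro tendsto_intros LIMSEQ_realpow_zero) auto
    from order_tendstoD(2)[OF this, of e] \<open>e > 0\<close> obtain M where M: "\<And>n. n \<ge> M \<Longrightarrow> 4 * (1/2::real) ^ n < e"
      by (auto simp: eventually_sequentially)
    let ?M = "max M N"
    have "dist (a m) (a n) < e" if "m \<ge> ?M" "n \<ge> ?M" for m n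
      using diff'[of ?M m] diff'[of ?M n] that M[of ?M] by (auto simp: dist_real_def)
    then show "\<exists>M. \<forall>m\<ge>M. \<forall>n\<ge>M. dist (a m) (a n) < e" by blast
  qed
  then obtain L where L: "a \<longlonglongrightarrow> L" using convergent_eq_Cauchy by blast
  have "\<bar>a n - L\<bar> \<le> 2 * (1/2) ^ n" if "n \<ge> N" for n
  proof (rule LIMSEQ_le_const2)
    show "(\<lambda>m. \<bar>a n - a m\<bar>) \<longlonglongrightarrow> \<bar>a n - L\<bar>" by (intro tendsto_intros L)
    show "\<exists>M. \<forall>m\<ge>M. \<bar>a n - a m\<bar> \<le> 2 * (1/2) ^ n"
      using diff'[OF that] by (auto simp: abs_minus_commute)
  qed
  then show ?thesis using L by blast
qed

text \<open>The terms \<open>d * sin (l x) ^ n / l ^ n\<close> of a series are chosen one after the other: \<open>d\<close> corrects the derivative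
  of order \<open>n\<close> at 0 without affecting those of lower order, and \<open>l\<close> is so large that the derivatives of order less
  than \<open>n\<close> are at most \<open>2\<^sup>-\<^sup>n\<close>. Hence all derived series converge uniformly.\<close>

lemma Borel:
  fixes c :: "nat \<Rightarrow> real"
  obtains D :: "nat \<Rightarrow> real \<Rightarrow> real" where "\<And>n x. (D n has_real_derivative D (Suc n) x) (at x)" "\<And>n. D n 0 = c n"
proof -
  let ?P = "\<lambda>n p. smooth p \<and> (\<forall>k<n. nderiv k p 0 = c k)"
  let ?Q = "\<lambda>n p p'. \<forall>k<n. \<forall>x. \<bar>nderiv k p' x - nderiv k p x\<bar> \<le> (1/2) ^ n"
  have "\<exists>p. \<forall>n. ?P n (p n) \<and> ?Q n (p n) (p (Suc n))"
  proof (rule dependent_nat_choice)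
    show "\<exists>p. ?P 0 p" by (intro exI[of _ "\<lambda>x. 0"]) (auto intro: smooth_on_const)
    fix p n assume p: "?P n p"
    let ?\<psi> = "\<lambda>x. sin x ^ n :: real"
    define d where "d = (c n - nderiv n p 0) / fact n"
    have bd: "smooth ?\<psi>" "\<forall>k. \<exists>M. \<forall>x. \<bar>nderiv k ?\<psi> x\<bar> \<le> M"
      using bounded_derivs_sin_power[of n] by (auto simp: bounded_derivs_def)
    from bd(2) obtain M where M: "\<And>k x. \<bar>nderiv k ?\<psi> x\<bar> \<le> M k" by metis
    have M0: "M k \<ge> 0" for k using M[of k 0] by linarith
    define M' where "M' = (\<Sum>k<n. M k)"
    define l where "l = max 1 (\<bar>d\<bar> * M' * 2 ^ n)"
    have l: "l \<ge> 1" "\<bar>d\<bar> * M' * 2 ^ n \<le> l" by (auto simp: l_def)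
    let ?T = "\<lambda>x. (d / l ^ n) * ?\<psi> (l * x)"
    have sT: "smooth ?T"
      by (intro smooth_on_mult smooth_on_const smooth_on_compose[OF bd(1)] smooth_on_id) auto
    have nT: "nderiv k ?T x = d / l ^ n * l ^ k * nderiv k ?\<psi> (l * x)" for k x
      using fun_cong[OF nderiv_scaled[OF bd(1), of k "d / l ^ n" l], of x] by simp
    have np: "nderiv k (\<lambda>x. p x + ?T x) x = nderiv k p x + nderiv k ?T x" for k x
      using p sT by (simp add: nderiv_add)
    have \<psi>0: "nderiv k ?\<psi> 0 = (if k = n then fact n else 0)" if "k \<le> n" for k
      using nderiv_sin_power_0[OF smooth_on_const[of UNIV 1] that] by simp
    show "\<exists>p'. ?P (Suc n) p' \<and> ?Q n p p'"
    proof (intro exI[of _ "\<lambda>x. p x + ?T x"] conjI allI impI)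
      show "smooth (\<lambda>x. p x + ?T x)" using p sT by (intro smooth_on_add) auto
      fix k assume "k < Suc n"
      then show "nderiv k (\<lambda>x. p x + ?T x) 0 = c k"
        using p l unfolding np nT by (auto simp: \<psi>0 d_def less_Suc_eq)
    next
      fix k x assume k: "k < n"
      have "\<bar>nderiv k (\<lambda>x. p x + ?T x) x - nderiv k p x\<bar> = \<bar>d\<bar> * (l ^ k / l ^ n) * \<bar>nderiv k ?\<psi> (l * x)\<bar>"
        unfolding np nT using l by (simp add: abs_mult)
      also have "\<dots> \<le> \<bar>d\<bar> * (1 / l) * M'"
      proof (intro mult_mono)
        have "l ^ k * l \<le> l ^ n" using power_increasing[of "Suc k" n l] k l by (simp add: mult.commute)
        then show "l ^ k / l ^ n \<le> 1 / l" using l by (simp add: field_simps)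
        have "M k \<le> M'" unfolding M'_def using k M0 by (intro member_le_sum) auto
        then show "\<bar>nderiv k ?\<psi> (l * x)\<bar> \<le> M'" using M[of k "l * x"] by linarith
      qed (use l in auto)
      also have "\<dots> = (\<bar>d\<bar> * M' * 2 ^ n) / l * (1/2) ^ n"
        by (simp add: power_one_over field_simps)
      also have "\<dots> \<le> 1 * (1/2) ^ n" using l by (intro mult_right_mono) (auto simp: pos_divide_le_eq)
      finally show "\<bar>nderiv k (\<lambda>x. p x + ?T x) x - nderiv k p x\<bar> \<le> (1/2) ^ n" by simp
    qed
  qed
  then obtain p where p: "\<forall>n. ?P n (p n) \<and> ?Q n (p n) (p (Suc n))" ..
  have sp: "smooth (p n)" for n using p[rule_format, THEN conjunct1, THEN conjunct1] .
  have p0: "nderiv k (p n) 0 = c k" if "k < n" for n k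
    using p[THEN spec, THEN conjunct1, THEN conjunct2, THEN spec, THEN mp, OF that] .
  have step: "\<bar>nderiv k (p (Suc n)) x - nderiv k (p n) x\<bar> \<le> (1/2) ^ n" if "k < n" for n k x
    using p[THEN spec, THEN conjunct2, THEN spec, THEN mp, OF that, THEN spec] .
  have "\<exists>L. (\<lambda>n. nderiv k (p n) x) \<longlonglongrightarrow> L \<and> (\<forall>n\<ge>Suc k. \<bar>nderiv k (p n) x - L\<bar> \<le> 2 * (1/2) ^ n)" for k x
    by (rule geometric_Cauchy) (rule step, simp)
  then obtain D where D: "\<And>k x. (\<lambda>n. nderiv k (p n) x) \<longlonglongrightarrow> D k x"
    "\<And>k x n. n \<ge> Suc k \<Longrightarrow> \<bar>nderiv k (p n) x - D k x\<bar> \<le> 2 * (1/2) ^ n" by metis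
  have "(D k has_real_derivative D (Suc k) x) (at x)" for k x
  proof -
    have "\<exists>g. \<forall>x\<in>UNIV. (\<lambda>n. nderiv k (p n) x) \<longlonglongrightarrow> g x \<and> (g has_derivative (\<lambda>h. D (Suc k) x * h)) (at x within UNIV)"
    proof (rule has_derivative_sequence[where f' = "\<lambda>n x h. nderiv (Suc k) (p n) x * h"])
      show "(nderiv k (p n) has_derivative (\<lambda>h. nderiv (Suc k) (p n) x * h)) (at x within UNIV)" for n x
        using has_real_derivative_smooth[OF smooth_nderiv[OF sp]] by (simp add: has_field_derivative_def)
      fix e :: real assume e: "e > 0"
      have "(\<lambda>n. 2 * (1/2::real) ^ n) \<longlonglongrightarrow> 2 * 0" by (intro tendsto_intros LIMSEQ_realpow_zero) auto
      from order_tendstoD(2)[OF this, of e] e have "\<forall>\<^sub>F n in sequentially. 2 * (1/2::real) ^ n < e" by simp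
      then show "\<forall>\<^sub>F n in sequentially. \<forall>x\<in>UNIV. \<forall>h. norm (nderiv (Suc k) (p n) x * h - D (Suc k) x * h) \<le> e * norm h"
        using eventually_ge_at_top[of "Suc (Suc k)"]
      proof eventually_elim
        fix n assume n: "2 * (1/2::real) ^ n < e" "Suc (Suc k) \<le> n"
        have "\<bar>nderiv (Suc k) (p n) x - D (Suc k) x\<bar> \<le> e" for x
          using D(2)[OF n(2), of x] n(1) by linarith
        then show "\<forall>x\<in>UNIV. \<forall>h. norm (nderiv (Suc k) (p n) x * h - D (Suc k) x * h) \<le> e * norm h"
          by (auto simp: left_diff_distrib[symmetric] abs_mult simp del: funpow.simps intro!: mult_right_mono)
      qed
    qed (use D(1) in auto)
    then obtain g where g: "\<And>x. (\<lambda>n. nderiv k (p n) x) \<longlonglongrightarrow> g x" "\<And>x. (g has_derivative (\<lambda>h. D (Suc k) x * h)) (at x)"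
      by auto
    have "g = D k" using LIMSEQ_unique[OF g(1) D(1)] by blast
    then show ?thesis using g(2) by (simp add: has_field_derivative_def)
  qed
  moreover have "D k 0 = c k" for k
  proof -
    have "\<forall>\<^sub>F n in sequentially. nderiv k (p n) 0 = c k"
      using eventually_gt_at_top[of k] by eventually_elim (rule p0)
    then have "(\<lambda>n. nderiv k (p n) 0) \<longlonglongrightarrow> c k" by (rule tendsto_eventually)
    then show ?thesis using LIMSEQ_unique D(1) by blast
  qed
  ultimately show ?thesis using that by blast
qed

text \<open>If \<open>E s = e (s\<^sup>2)\<close>, then \<open>E' s = 2 s e'(s\<^sup>2)\<close>; so \<open>E1\<close> is the even function that represents \<open>e'\<close>.\<close>

lemma even_derivative_quotient:
  assumes E: "smooth_on {-\<eta><..<\<eta>} E" and even: "\<And>s. s \<in> {-\<eta><..<\<eta>} \<Longrightarrow> E (- s) = E s" and \<eta>: "\<eta> > 0"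
  shows "\<exists>E1 :: real \<Rightarrow> real. smooth_on {-\<eta><..<\<eta>} E1 \<and> (\<forall>s\<in>{-\<eta><..<\<eta>}. E1 (- s) = E1 s) \<and>
    (\<forall>s\<in>{-\<eta><..<\<eta>}. (E has_real_derivative 2 * s * E1 s) (at s))"
proof -
  let ?J = "{-\<eta><..<\<eta>}"
  have odd: "vderiv E (- s) = - vderiv E s" if s: "s \<in> ?J" for s
  proof -
    have "((\<lambda>s. E (- s)) has_real_derivative vderiv E (- s) * (-1)) (at s)"
      using s by (intro DERIV_chain2[OF has_real_derivative_vderiv[OF E]]) (auto intro!: derivative_eq_intros)
    then have "(E has_real_derivative vderiv E (- s) * (-1)) (at s)"
      by (rule has_field_derivative_transform_within_open[where S = ?J]) (use s even in auto)
    from DERIV_unique[OF this has_real_derivative_vderiv[OF E s]] show ?thesis by simp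
  qed
  have "vderiv E 0 = 0" using odd[of 0] \<eta> by simp
  from Hadamard[OF smooth_on_vderiv[OF _ E] this] obtain K where
    K: "smooth_on ?J K" "\<And>s. s \<in> ?J \<Longrightarrow> vderiv E s = s * K s" by auto
  have "K (- s) = K s" if "s \<in> ?J" for s
    using K(2)[of s] K(2)[of "-s"] odd[OF that] that by (cases "s = 0") auto
  then show ?thesis
    using K has_real_derivative_vderiv[OF E]
    by (intro exI[of _ "\<lambda>s. K s / 2"]) (auto intro!: smooth_on_divide smooth_on_const)
qed

text \<open>Whitney's theorem. For \<open>X \<ge> 0\<close> the function \<open>e\<close> and its derivatives are forced to be \<open>X \<mapsto> En n (sqrt X)\<close>. For
  \<open>X < 0\<close> it is continued by a function that has the same derivatives at 0, which exists by Borel's lemma.\<close>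

lemma smooth_even_function:
  assumes E: "smooth_on {-\<eta><..<\<eta>} E" and even: "\<And>s. s \<in> {-\<eta><..<\<eta>} \<Longrightarrow> E (- s) = E s" and \<eta>: "\<eta> > 0"
  obtains e :: "real \<Rightarrow> real" where "smooth_on {..<\<eta>\<^sup>2} e" "\<And>s. s \<in> {-\<eta><..<\<eta>} \<Longrightarrow> E s = e (s\<^sup>2)"
proof -
  let ?J = "{-\<eta><..<\<eta>}"
  have "\<exists>En. \<forall>n. (smooth_on ?J (En n) \<and> (\<forall>s\<in>?J. En n (- s) = En n s) \<and> (n = 0 \<longrightarrow> En n = E)) \<and>
      (\<forall>s\<in>?J. (En n has_real_derivative 2 * s * En (Suc n) s) (at s))"
    by (rule dependent_nat_choice) (use E even even_derivative_quotient[OF _ _ \<eta>] in auto)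
  then obtain En :: "nat \<Rightarrow> real \<Rightarrow> real" where En: "\<And>n. smooth_on ?J (En n)" "\<And>n s. s \<in> ?J \<Longrightarrow> En n (- s) = En n s"
    "En 0 = E" "\<And>n s. s \<in> ?J \<Longrightarrow> (En n has_real_derivative 2 * s * En (Suc n) s) (at s)" by blast
  obtain D where D: "\<And>n x. (D n has_real_derivative D (Suc n) x) (at x)" "\<And>n. D n 0 = En n 0"
    using Borel[of "\<lambda>n. En n 0"] by blast
  let ?S = "{..<\<eta>\<^sup>2}"
  \<comment> \<open>The formula joins the two pieces without a case distinction, which makes continuity evident.\<close>
  define e where "e n X = En n (sqrt (max X 0)) + (D n (min X 0) - D n 0)" for n X
  have pos: "e n X = En n (sqrt X)" if "X \<ge> 0" for n X using that by (simp add: e_def)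
  have neg: "e n X = D n X" if "X \<le> 0" for n X using that by (simp add: e_def D(2))
  have sq: "sqrt (max X 0) \<in> ?J" if "X \<in> ?S" for X
  proof -
    have "sqrt (max X 0) < sqrt (\<eta>\<^sup>2)" using that \<eta> by (intro real_sqrt_less_mono) auto
    moreover have "0 \<le> sqrt (max X 0)" by simp
    ultimately have "- \<eta> < sqrt (max X 0)" "sqrt (max X 0) < \<eta>" using \<eta> by (linarith, simp)
    then show ?thesis by simp
  qed
  have contD: "continuous_on UNIV (D n)" for n
    using D(1) by (auto intro!: continuous_at_imp_continuous_on DERIV_isCont)
  have cont: "continuous_on ?S (e n)" for n
    unfolding e_def
    by (intro continuous_intros continuous_on_compose2[OF smooth_on_continuous[OF En(1)]] continuous_on_compose2[OF contD])
       (use sq in auto)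
  have der_nz: "(e n has_real_derivative e (Suc n) X) (at X)" if X: "X \<in> ?S" "X \<noteq> 0" for n X
  proof (cases "X > 0")
    case True
    have "sqrt X \<in> ?J" using sq[OF X(1)] True by simp
    then have "((\<lambda>X. En n (sqrt X)) has_real_derivative 2 * sqrt X * En (Suc n) (sqrt X) * (inverse (sqrt X) / 2)) (at X)"
      by (rule DERIV_chain2[OF En(4) DERIV_real_sqrt[OF True]])
    then have "((\<lambda>X. En n (sqrt X)) has_real_derivative e (Suc n) X) (at X)"
      using True by (simp add: pos field_simps)
    then show ?thesis
      by (rule has_field_derivative_transform_within_open[where S = "{0<..}"]) (use True in \<open>auto simp: pos\<close>)
  next
    case False
    then have "X < 0" using X by simp
    have "(D n has_real_derivative e (Suc n) X) (at X)" using D(1)[of n X] \<open>X < 0\<close> by (simp add: neg)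
    then show ?thesis
      by (rule has_field_derivative_transform_within_open[where S = "{..<0}"]) (use \<open>X < 0\<close> in \<open>auto simp: neg\<close>)
  qed
  have S0: "0 \<in> ?S" using \<eta> by simp
  have tend: "(e n \<longlongrightarrow> e n 0) (at 0)" for n
    using cont[of n] S0 by (simp add: continuous_on_eq_continuous_at isCont_def)
  have der_0: "(e n has_real_derivative e (Suc n) 0) (at 0)" for n
  proof -
    have ev: "\<forall>\<^sub>F X in at 0. X \<in> ?S \<and> X \<noteq> 0"
      using S0 by (intro eventually_conj eventually_at_in_open' open_lessThan) (auto simp: eventually_at_filter)
    have "((\<lambda>X. (e n X - e n 0) / (X - 0)) \<longlongrightarrow> e (Suc n) 0) (at 0)"
    proof (rule lhopital)
      show "((\<lambda>X. e n X - e n 0) \<longlongrightarrow> 0) (at 0)" using tend[of n] by (rule LIM_zero)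
      show "((\<lambda>X::real. X - 0) \<longlongrightarrow> 0) (at 0)" by (auto intro!: tendsto_eq_intros)
      show "\<forall>\<^sub>F X in at 0. X - 0 \<noteq> (0::real)" using ev by eventually_elim simp
      show "\<forall>\<^sub>F X in at 0. ((\<lambda>X. e n X - e n 0) has_real_derivative e (Suc n) X) (at X)"
        using ev by eventually_elim (auto intro!: derivative_eq_intros der_nz)
      show "\<forall>\<^sub>F X in at 0. ((\<lambda>X. X - 0) has_real_derivative 1) (at (X::real))"
        by (auto intro!: derivative_eq_intros)
      show "((\<lambda>X. e (Suc n) X / 1) \<longlongrightarrow> e (Suc n) 0) (at 0)" using tend[of "Suc n"] by simp
    qed simp
    then show ?thesis by (simp add: has_field_derivative_iff)
  qed
  have "smooth_on ?S (e 0)"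
  proof (rule smooth_on_chain[where D = e])
    fix n X assume "X \<in> ?S"
    then have "(e n has_real_derivative e (Suc n) X) (at X)" using der_nz der_0 by (cases "X = 0") auto
    then show "(e n has_vector_derivative e (Suc n) X) (at X)"
      by (simp add: has_real_derivative_iff_has_vector_derivative)
  qed simp
  moreover have "E s = e 0 (s\<^sup>2)" if "s \<in> ?J" for s
    using En(2)[OF that, of 0] by (cases "s \<ge> 0") (auto simp: pos En(3))
  ultimately show ?thesis using that by blast
qed


section \<open>Normal form of cusps\<close>

lemma (in equiaffine) local_coordinates_change:
  assumes c: "c \<in> A" and U: "open U" and V: "open V"
    and \<Psi>: "smooth_on U \<Psi>" "\<And>x. x \<in> U \<Longrightarrow> \<Psi> x \<in> V" and \<Phi>: "smooth_on V \<Phi>" "\<And>y. y \<in> V \<Longrightarrow> \<Phi> y \<in> U"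
    and inv: "\<And>x. x \<in> U \<Longrightarrow> \<Phi> (\<Psi> x) = x" "\<And>y. y \<in> V \<Longrightarrow> \<Psi> (\<Phi> y) = y"
  shows "local_coordinates A ({p \<in> dom_of c. coord c p \<in> U}, \<lambda>p. \<Psi> (coord c p))"
proof -
  let ?X = "{p \<in> dom_of c. coord c p \<in> U}" and ?\<psi> = "\<lambda>p. \<Psi> (coord c p)"
  let ?d = "(?X, ?\<psi>)"
  let ?\<phi> = "\<lambda>y. param c (\<Phi> y)"
  note hom = chart_homeomorphism[OF is_chart[OF c]]
  have im: "?\<psi> ` ?X = V \<inter> \<Phi> -` (coord c ` dom_of c)"
  proof (intro equalityI subsetI)
    fix y assume "y \<in> V \<inter> \<Phi> -` (coord c ` dom_of c)"
    then obtain p where p: "y \<in> V" "p \<in> dom_of c" "\<Phi> y = coord c p" by auto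
    then have "p \<in> ?X" "y = ?\<psi> p" using \<Phi>(2)[OF p(1)] inv(2)[OF p(1)] by simp_all
    then show "y \<in> ?\<psi> ` ?X" by blast
  qed (use \<Psi>(2) inv(1) in auto)
  have opX: "open ?X"
  proof -
    have "open (dom_of c \<inter> coord c -` U)"
      using homeomorphism_cont1[OF hom] open_dom[OF c] U by (simp add: continuous_on_open_vimage Int_commute)
    also have "dom_of c \<inter> coord c -` U = ?X" by blast
    finally show ?thesis .
  qed
  have opim: "open (?\<psi> ` ?X)"
    unfolding im using smooth_on_continuous[OF \<Phi>(1)] V open_coord_dom[OF c]
    by (simp add: continuous_on_open_vimage Int_commute)
  have \<phi>\<psi>: "?\<phi> (?\<psi> p) = p" if "p \<in> ?X" for p using that inv(1) c by simp
  have hom': "homeomorphism ?X (?\<psi> ` ?X) ?\<psi> ?\<phi>"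
    unfolding homeomorphism_def
  proof (intro conjI ballI)
    show "?\<phi> ` ?\<psi> ` ?X = ?X" by (force simp: image_image \<phi>\<psi>)
    show "continuous_on ?X ?\<psi>"
      by (rule continuous_on_compose2[OF smooth_on_continuous[OF \<Psi>(1)] continuous_on_subset[OF homeomorphism_cont1[OF hom]]]) auto
    show "continuous_on (?\<psi> ` ?X) ?\<phi>"
      unfolding im
      by (rule continuous_on_compose2[OF homeomorphism_cont2[OF hom] continuous_on_subset[OF smooth_on_continuous[OF \<Phi>(1)]]]) auto
  qed (use \<phi>\<psi> in auto)
  have par: "param ?d y = ?\<phi> y" if y: "y \<in> ?\<psi> ` ?X" for y
  proof -
    have inj: "inj_on ?\<psi> ?X" using \<phi>\<psi> by (rule inj_on_inverseI)
    obtain p where p: "p \<in> ?X" "y = ?\<psi> p" using y by blast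
    show ?thesis using inv_into_f_f[OF inj p(1)] \<phi>\<psi>[OF p(1)] by (simp add: p(2))
  qed
  have "homeomorphism ?X (?\<psi> ` ?X) ?\<psi> (param ?d)"
    by (rule homeomorphism_cong[OF hom' refl refl refl]) (use par in simp)
  then have "is_chart ?d"
    unfolding is_chart_def fst_conv snd_conv using opX opim by blast
  moreover have "compatible ?d c'" if c': "c' \<in> A" for c'
    unfolding compatible_def fst_conv snd_conv
  proof
    let ?Y = "?\<psi> ` (?X \<inter> dom_of c')"
    have opY: "open ?Y" using chart_open_image[OF \<open>is_chart ?d\<close> open_dom[OF c']] by simp
    have "smooth_on ?Y (\<lambda>y. transition c c' (\<Phi> y))"
    proof (rule smooth_on_compose[OF smooth_transition[OF c c'] smooth_on_subset[OF \<Phi>(1)]])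
      show "\<Phi> ` ?Y \<subseteq> coord c ` (dom_of c \<inter> dom_of c')" using inv(1) by (auto simp: image_image)
    qed (use \<Psi>(2) opY open_image[OF c open_dom[OF c']] in auto)
    moreover have "(coord c' \<circ> inv_into ?X ?\<psi>) y = transition c c' (\<Phi> y)" if "y \<in> ?Y" for y
      using par[of y] that by auto
    ultimately show "smooth_on ?Y (coord c' \<circ> inv_into ?X ?\<psi>)"
      using smooth_on_cong[OF opY, of "coord c' \<circ> inv_into ?X ?\<psi>" "\<lambda>y. transition c c' (\<Phi> y)"] by blast
    let ?Z = "coord c' ` (?X \<inter> dom_of c')"
    have opZ: "open ?Z" using open_image[OF c' opX] by (simp add: Int_commute)
    have "smooth_on ?Z (\<lambda>x. \<Psi> (transition c' c x))"
    proof (rule smooth_on_compose[OF \<Psi>(1) smooth_on_subset[OF smooth_transition[OF c' c]]])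
      show "transition c' c ` ?Z \<subseteq> U" using c' by auto
    qed (use opZ U in auto)
    then show "smooth_on ?Z (?\<psi> \<circ> param c')" by (simp add: o_def)
  qed
  ultimately show ?thesis by (simp add: local_coordinates_def)
qed

lemma eventually_interval:
  assumes "eventually P (nhds (0::real))"
  obtains e where "e > 0" "\<And>t. t \<in> {-e<..<e} \<Longrightarrow> P t"
proof -
  from assms obtain e where "e > 0" "\<And>t. dist t 0 < e \<Longrightarrow> P t" by (auto simp: eventually_nhds_metric)
  then show ?thesis by (intro that[of e]) (auto simp: dist_real_def)
qed

lemma positive_interval:
  fixes f :: "real \<Rightarrow> real"
  assumes f: "smooth_on S f" "open S" "0 \<in> S" and pos: "f 0 > 0"
  obtains e where "e > 0" "{-e<..<e} \<subseteq> S" "\<And>t. t \<in> {-e<..<e} \<Longrightarrow> f t > 0"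
proof -
  have "isCont f 0" using smooth_on_continuous[OF f(1)] f by (simp add: continuous_on_eq_continuous_at)
  then have "\<forall>\<^sub>F t in nhds 0. f t > 0"
    using pos by (intro order_tendstoD(1)[of f "f 0"]) (simp add: isCont_def tendsto_at_iff_tendsto_nhds)
  moreover have "\<forall>\<^sub>F t in nhds 0. t \<in> S" by (rule eventually_nhds_in_open[OF f(2,3)])
  ultimately have "\<forall>\<^sub>F t in nhds 0. f t > 0 \<and> t \<in> S" by eventually_elim simp
  from eventually_interval[OF this] obtain e where "e > 0" "\<And>t. t \<in> {-e<..<e} \<Longrightarrow> f t > 0 \<and> t \<in> S" by blast
  then show ?thesis by (intro that[of e]) auto
qed

lemma even_odd_decomposition:
  fixes v :: "real \<Rightarrow> real"
  assumes v: "smooth_on {-\<eta><..<\<eta>} v" and \<eta>: "\<eta> > 0"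
  obtains p q where "smooth_on {..<\<eta>\<^sup>2} p" "smooth_on {..<\<eta>\<^sup>2} q"
    "\<And>s. s \<in> {-\<eta><..<\<eta>} \<Longrightarrow> v s = p (s\<^sup>2) + s * q (s\<^sup>2)"
proof -
  let ?J = "{-\<eta><..<\<eta>}"
  have v': "smooth_on ?J (\<lambda>s. v (- s))"
    by (rule smooth_on_compose[OF v smooth_on_minus[OF _ smooth_on_id]]) auto
  let ?E = "\<lambda>s. (v s + v (- s)) / 2" and ?O = "\<lambda>s. (v s - v (- s)) / 2"
  have "smooth_on ?J ?E" by (intro smooth_on_divide smooth_on_add smooth_on_const v v') auto
  from smooth_even_function[OF this _ \<eta>] obtain p where p: "smooth_on {..<\<eta>\<^sup>2} p"
    "\<And>s. s \<in> ?J \<Longrightarrow> ?E s = p (s\<^sup>2)" by auto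
  have "smooth_on ?J ?O" by (intro smooth_on_divide smooth_on_diff smooth_on_const v v') auto
  from Hadamard[OF this] obtain R where R: "smooth_on ?J R" "\<And>s. s \<in> ?J \<Longrightarrow> ?O s = s * R s" by auto
  have "R (- s) = R s" if "s \<in> ?J" for s
    using R(2)[of s] R(2)[of "- s"] that by (cases "s = 0") (auto simp: field_simps)
  from smooth_even_function[OF R(1) this \<eta>] obtain q where q: "smooth_on {..<\<eta>\<^sup>2} q"
    "\<And>s. s \<in> ?J \<Longrightarrow> R s = q (s\<^sup>2)" by auto
  have "v s = p (s\<^sup>2) + s * q (s\<^sup>2)" if "s \<in> ?J" for s
    using p(2)[OF that] R(2)[OF that] q(2)[OF that] by (simp add: field_simps)
  then show ?thesis using that p q by blast
qed

lemma det2_Cramer: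
  assumes "det2 a b \<noteq> 0"
  shows "(det2 z b / det2 a b) *\<^sub>R a + (det2 a z / det2 a b) *\<^sub>R b = z"
proof -
  have "det2 z b * a $ i + det2 a z * b $ i = det2 a b * z $ i" for i
    using exhaust_2[of i] by (auto simp: det2_def algebra_simps)
  then show ?thesis using assms by (simp add: vec_eq_iff field_simps)
qed

lemma smooth_diffeo_restrict:
  assumes hom: "homeomorphism S T f g" and f: "smooth_on S f" and g: "smooth_on T g"
    and S: "open S" and T': "open T'" "T' \<subseteq> T"
  shows "smooth_diffeo T' (g ` T') g"
proof -
  have eq: "g ` T' = S \<inter> f -` T'"
    using hom T'(2) by (force simp: homeomorphism_def)
  have "open (g ` T')"
    unfolding eq using smooth_on_continuous[OF f] S T'(1) by (simp add: continuous_on_open_vimage Int_commute)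
  moreover have "homeomorphism T' (g ` T') g f"
    by (rule homeomorphism_of_subsets[OF homeomorphism_symD[OF hom]]) (use T' eq in auto)
  ultimately show ?thesis
    unfolding smooth_diffeo_def using T' smooth_on_subset[OF g T'(2)] smooth_on_subset[OF f, of "g ` T'"] eq by auto
qed

text \<open>Affine coordinates adapted to \<open>w(0)\<close> and \<open>w'(0)\<close> bring the curve to the form \<open>(t\<^sup>2 u, t\<^sup>3 v)\<close>, and a
  change of the parameter to \<open>(s\<^sup>2, s\<^sup>3 V)\<close>. The smooth function \<open>V s\<close> is \<open>p (s\<^sup>2) + s q (s\<^sup>2)\<close> by Whitney's theorem, so that
  \<open>(X, Y) \<mapsto> (X, (Y - X\<^sup>2 q X) / p X)\<close> takes the curve to \<open>(s\<^sup>2, s\<^sup>3)\<close>.\<close>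

lemma (in curve_along) has_cuspI:
  assumes c: "c \<in> A" and \<epsilon>: "\<epsilon> > 0" "{-\<epsilon><..<\<epsilon>} \<subseteq> dom_times c" and w: "smooth_on {-\<epsilon><..<\<epsilon>} w"
    and vel: "\<And>t. t \<in> {-\<epsilon><..<\<epsilon>} \<Longrightarrow> vel t c = t *\<^sub>R w t" and det: "det2 (w 0) (vderiv w 0) \<noteq> 0"
  shows "has_cusp_at_0 A I \<gamma>"
proof -
  let ?J = "{-\<epsilon><..<\<epsilon>}"
  define x where "x t = coord c (\<gamma> t)" for t
  define a b where "a = w 0" and "b = vderiv w 0"
  define d where "d = det2 a b"
  have d: "d \<noteq> 0" using det by (simp add: d_def a_def b_def)
  define y1 where "y1 z = 2 * det2 (z - x 0) b / d" for z
  define y2 where "y2 z = 3 * det2 a (z - x 0) / d" for z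
  have J0: "0 \<in> ?J" using \<epsilon> by simp
  have sx: "smooth_on ?J x" unfolding x_def by (rule smooth_on_subset[OF smooth_coord_\<gamma>[OF c] \<epsilon>(2)])
  have dx: "(x has_vector_derivative t *\<^sub>R w t) (at t)" if "t \<in> ?J" for t
    using has_vector_derivative_\<gamma>[OF c, of t] vel[OF that] \<epsilon>(2) that by (auto simp: x_def[abs_def])
  have dx': "((\<lambda>t. x t $ i) has_real_derivative t * w t $ i) (at t)" if "t \<in> ?J" for i t
    using bounded_linear.has_vector_derivative[OF bounded_linear_vec_nth dx[OF that], of i]
    by (simp add: has_real_derivative_iff_has_vector_derivative)
  have sy: "smooth_on UNIV y1" "smooth_on UNIV y2"
    unfolding y1_def y2_def using d
    by (intro smooth_on_divide smooth_on_mult smooth_on_det2 smooth_on_diff smooth_on_const smooth_on_id; simp)+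
  have sy1: "smooth_on ?J (\<lambda>t. y1 (x t))" and sy2: "smooth_on ?J (\<lambda>t. y2 (x t))"
    by (rule smooth_on_compose[OF sy(1) sx] smooth_on_compose[OF sy(2) sx]; simp)+
  \<comment> \<open>In these coordinates the curve is \<open>(t\<^sup>2 u, t\<^sup>3 v)\<close> with \<open>u 0 = v 0 = 1\<close>.\<close>
  obtain u where u: "smooth_on ?J u" "\<And>t. t \<in> ?J \<Longrightarrow> y1 (x t) = t\<^sup>2 * u t" "u 0 = 1"
  proof -
    let ?m = "\<lambda>t. 2 * det2 (w t) b / d"
    have "vderiv (\<lambda>t. y1 (x t)) t = t ^ 1 *\<^sub>R ?m t" if t: "t \<in> ?J" for t
    proof (rule vderiv_eq, unfold has_real_derivative_iff_has_vector_derivative[symmetric])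
      show "((\<lambda>t. y1 (x t)) has_real_derivative t ^ 1 *\<^sub>R ?m t) (at t)"
        unfolding y1_def det2_def using dx'[OF t] d
        by (auto intro!: derivative_eq_intros simp: field_simps)
    qed
    moreover have "smooth_on ?J ?m"
      using d by (intro smooth_on_divide smooth_on_mult smooth_on_det2 smooth_on_const w) auto
    moreover have "y1 (x 0) = 0" by (simp add: y1_def det2_def)
    ultimately obtain M where "smooth_on ?J M" "\<And>t. t \<in> ?J \<Longrightarrow> y1 (x t) = t ^ Suc 1 *\<^sub>R M t"
      "M 0 = ?m 0 /\<^sub>R Suc 1"
      using Hadamard_power[OF sy1] by blast
    then show ?thesis using d by (intro that[of M]) (auto simp: d_def a_def power2_eq_square)
  qed
  obtain v where v: "smooth_on ?J v" "\<And>t. t \<in> ?J \<Longrightarrow> y2 (x t) = t ^ 3 * v t" "v 0 = 1"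
  proof -
    let ?m = "\<lambda>t. 3 * det2 a (w t) / d"
    have sm: "smooth_on ?J ?m"
      using d by (intro smooth_on_divide smooth_on_mult smooth_on_det2 smooth_on_const w) auto
    have m0: "?m 0 = 0" by (simp add: a_def det2_def)
    obtain n where n: "smooth_on ?J n" "\<And>t. t \<in> ?J \<Longrightarrow> ?m t = t * n t" "n 0 = vderiv ?m 0"
      using Hadamard[OF sm m0] by auto
    have dw: "((\<lambda>t. w t $ i) has_real_derivative b $ i) (at 0)" for i
      using bounded_linear.has_vector_derivative[OF bounded_linear_vec_nth has_vector_derivative_vderiv[OF w J0], of i]
      by (simp add: has_real_derivative_iff_has_vector_derivative b_def)
    have "vderiv ?m 0 = 3"
    proof (rule vderiv_eq, unfold has_real_derivative_iff_has_vector_derivative[symmetric])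
      have "(?m has_real_derivative 3 * det2 a b / d) (at 0)"
        unfolding det2_def using dw d by (auto intro!: derivative_eq_intros simp: field_simps)
      then show "(?m has_real_derivative 3) (at 0)" using d by (simp add: d_def)
    qed
    then have n0: "n 0 = 3" using n(3) by simp
    have "vderiv (\<lambda>t. y2 (x t)) t = t ^ 2 *\<^sub>R n t" if t: "t \<in> ?J" for t
    proof (rule vderiv_eq, unfold has_real_derivative_iff_has_vector_derivative[symmetric])
      have "((\<lambda>t. y2 (x t)) has_real_derivative t * ?m t) (at t)"
        unfolding y2_def det2_def using dx'[OF t] d
        by (auto intro!: derivative_eq_intros simp: field_simps)
      then show "((\<lambda>t. y2 (x t)) has_real_derivative t ^ 2 *\<^sub>R n t) (at t)"
        unfolding n(2)[OF t] by (simp add: power2_eq_square mult.assoc)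
    qed
    moreover have "y2 (x 0) = 0" by (simp add: y2_def det2_def)
    ultimately obtain M where "smooth_on ?J M" "\<And>t. t \<in> ?J \<Longrightarrow> y2 (x t) = t ^ Suc 2 *\<^sub>R M t" "M 0 = n 0 /\<^sub>R Suc 2"
      using Hadamard_power[OF sy2 _ n(1)] by blast
    then show ?thesis using n0 by (intro that[of M]) (auto simp: eval_nat_numeral)
  qed
  \<comment> \<open>The new parameter \<open>s = t u\<^bsup>1/2\<^esup>\<close> makes the first coordinate equal to \<open>s\<^sup>2\<close>.\<close>
  obtain e1 where e1: "e1 > 0" "{-e1<..<e1} \<subseteq> ?J" "\<And>t. t \<in> {-e1<..<e1} \<Longrightarrow> u t > 0"
    using positive_interval[OF u(1) _ J0] u(3) by auto
  define \<sigma> where "\<sigma> t = t * u t powr (1/2)" for t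
  have s\<sigma>: "smooth_on {-e1<..<e1} \<sigma>"
    unfolding \<sigma>_def using e1 by (intro smooth_on_mult smooth_on_id smooth_on_powr smooth_on_subset[OF u(1)]) auto
  have \<sigma>2: "\<sigma> t ^ 2 = y1 (x t)" if "t \<in> {-e1<..<e1}" for t
    using u(2)[of t] e1 that by (auto simp: \<sigma>_def power_mult_distrib powr_half_sqrt subset_iff less_imp_le)
  have \<sigma>'0: "vderiv \<sigma> 0 = 1"
  proof (rule vderiv_eq, unfold has_real_derivative_iff_has_vector_derivative[symmetric])
    have sp: "smooth_on {-e1<..<e1} (\<lambda>t. u t powr (1/2))"
      using e1 by (intro smooth_on_powr smooth_on_subset[OF u(1)]) auto
    have "((\<lambda>t. u t powr (1/2)) has_real_derivative vderiv (\<lambda>t. u t powr (1/2)) 0) (at 0)"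
      by (rule has_real_derivative_vderiv[OF sp]) (use e1 in simp)
    from DERIV_mult[OF DERIV_ident this] show "(\<sigma> has_real_derivative 1) (at 0)"
      unfolding \<sigma>_def by (simp add: u(3))
  qed
  obtain e2 where e2: "e2 > 0" "{-e2<..<e2} \<subseteq> {-e1<..<e1}" "\<And>t. t \<in> {-e2<..<e2} \<Longrightarrow> vderiv \<sigma> t > 0"
    by (rule positive_interval[OF smooth_on_vderiv[OF open_greaterThanLessThan s\<sigma>] open_greaterThanLessThan])
       (use e1 \<sigma>'0 in auto)
  let ?K = "{-e2<..<e2}"
  have s\<sigma>2: "smooth_on ?K \<sigma>" by (rule smooth_on_subset[OF s\<sigma> e2(2)])
  have KJ: "?K \<subseteq> ?J" using e1 e2 by auto
  obtain h where h: "homeomorphism ?K (\<sigma> ` ?K) \<sigma> h" "open (\<sigma> ` ?K)" "smooth_on (\<sigma> ` ?K) h"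
    "\<And>t. t \<in> ?K \<Longrightarrow> (h has_real_derivative inverse (vderiv \<sigma> t)) (at (\<sigma> t))"
    using smooth_inverse_function[OF s\<sigma>2 e2(3)] by blast
  have K0: "0 \<in> ?K" using e2 by simp
  have \<sigma>0: "\<sigma> 0 = 0" by (simp add: \<sigma>_def)
  have h0: "h 0 = 0" using homeomorphism_apply1[OF h(1) K0] by (simp add: \<sigma>0)
  have "\<forall>\<^sub>F s in nhds 0. s \<in> \<sigma> ` ?K"
    by (rule eventually_nhds_in_open[OF h(2)]) (use K0 \<sigma>0 in \<open>metis imageI\<close>)
  then obtain \<eta> where \<eta>: "\<eta> > 0" "{-\<eta><..<\<eta>} \<subseteq> \<sigma> ` ?K" using eventually_interval by (metis subsetI)
  let ?N = "{-\<eta><..<\<eta>}"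
  have hK: "h s \<in> ?K" "\<sigma> (h s) = s" if "s \<in> ?N" for s
    using homeomorphism_image2[OF h(1)] homeomorphism_apply2[OF h(1)] \<eta>(2) that by blast+
  have sh: "smooth_on ?N h" by (rule smooth_on_subset[OF h(3) \<eta>(2)])
  obtain \<kappa> where \<kappa>: "smooth_on ?N \<kappa>" "\<And>s. s \<in> ?N \<Longrightarrow> h s = s * \<kappa> s" "\<kappa> 0 = vderiv h 0"
    using Hadamard[OF sh h0] by auto
  have "vderiv h 0 = 1"
    by (rule vderiv_eq) (use h(4)[OF K0] \<sigma>'0 \<sigma>0 in \<open>simp add: has_real_derivative_iff_has_vector_derivative\<close>)
  then have \<kappa>0: "\<kappa> 0 = 1" using \<kappa>(3) by simp
  have "smooth_on ?N (\<lambda>s. \<kappa> s ^ 3 * v (h s))"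
    by (intro smooth_on_mult smooth_on_power \<kappa> smooth_on_compose[OF v(1) sh]) (use hK(1) KJ in auto)
  from even_odd_decomposition[OF this \<eta>(1)] obtain p q where p: "smooth_on {..<\<eta>\<^sup>2} p" and q: "smooth_on {..<\<eta>\<^sup>2} q"
    and pq: "\<And>s. s \<in> ?N \<Longrightarrow> \<kappa> s ^ 3 * v (h s) = p (s\<^sup>2) + s * q (s\<^sup>2)" by blast
  have p0: "p 0 = 1" using pq[of 0] \<eta> \<kappa>0 h0 v(3) by simp
  obtain n where n: "n > 0" "{-n<..<n} \<subseteq> {..<\<eta>\<^sup>2}" "\<And>X. X \<in> {-n<..<n} \<Longrightarrow> p X > 0"
    using positive_interval[OF p] p0 \<eta>(1) by auto
  let ?X = "{-n<..<n}"
  define \<Psi> :: "real^2 \<Rightarrow> real^2" where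
    "\<Psi> z = y1 z *\<^sub>R axis 1 1 + ((y2 z - y1 z ^ 2 * q (y1 z)) / p (y1 z)) *\<^sub>R axis 2 1" for z
  define \<Phi> :: "real^2 \<Rightarrow> real^2" where
    "\<Phi> y = x 0 + (y $ 1 / 2) *\<^sub>R a + ((y $ 2 * p (y $ 1) + (y $ 1) ^ 2 * q (y $ 1)) / 3) *\<^sub>R b" for y
  let ?U = "y1 -` ?X" and ?V = "{y :: real^2. y $ 1 \<in> ?X}"
  have opU: "open ?U"
    using smooth_on_continuous[OF sy(1)] by (simp add: continuous_on_open_vimage)
  have opV: "open ?V"
  proof -
    have "open ((\<lambda>y::real^2. y $ 1) -` ?X)"
      by (intro open_vimage continuous_intros open_greaterThanLessThan)
    then show ?thesis by (simp add: vimage_def)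
  qed
  have sp: "smooth_on ?X p" and sq: "smooth_on ?X q"
    by (rule smooth_on_subset[OF p n(2)], rule smooth_on_subset[OF q n(2)])
  have s\<Psi>: "smooth_on ?U \<Psi>"
  proof -
    have y: "smooth_on ?U y1" "smooth_on ?U y2" using sy by (auto intro: smooth_on_subset)
    have "p (y1 z) \<noteq> 0" if "z \<in> ?U" for z using n(3)[of "y1 z"] that by auto
    then show ?thesis
      unfolding \<Psi>_def using opU
      by (intro smooth_on_add smooth_on_scaleR smooth_on_const smooth_on_divide smooth_on_diff smooth_on_mult
          smooth_on_power y smooth_on_compose[OF sq y(1)] smooth_on_compose[OF sp y(1)]) auto
  qed
  have s\<Phi>: "smooth_on ?V \<Phi>"
  proof -
    have y: "smooth_on ?V (\<lambda>y. y $ i)" for i using opV by (intro smooth_on_nth smooth_on_id)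
    show ?thesis
      unfolding \<Phi>_def using opV
      by (intro smooth_on_add smooth_on_scaleR smooth_on_const smooth_on_divide smooth_on_mult
          smooth_on_power y smooth_on_compose[OF sq y] smooth_on_compose[OF sp y]) auto
  qed
  have \<Psi>_nth: "\<Psi> z $ 1 = y1 z" "\<Psi> z $ 2 = (y2 z - y1 z ^ 2 * q (y1 z)) / p (y1 z)" for z
    by (simp_all add: \<Psi>_def axis_def)
  have y\<Phi>: "y1 (\<Phi> y) = y $ 1" "y2 (\<Phi> y) = y $ 2 * p (y $ 1) + (y $ 1) ^ 2 * q (y $ 1)" for y
  proof -
    have eq: "det2 (\<Phi> y - x 0) b = (y $ 1 / 2) * d"
      "det2 a (\<Phi> y - x 0) = ((y $ 2 * p (y $ 1) + (y $ 1) ^ 2 * q (y $ 1)) / 3) * d"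
      by (simp_all add: \<Phi>_def d_def det2_def field_simps)
    show "y1 (\<Phi> y) = y $ 1" "y2 (\<Phi> y) = y $ 2 * p (y $ 1) + (y $ 1) ^ 2 * q (y $ 1)"
      unfolding y1_def y2_def eq using d by simp_all
  qed
  have inv1: "\<Phi> (\<Psi> z) = z" if "z \<in> ?U" for z
  proof -
    have "p (y1 z) \<noteq> 0" using n(3)[of "y1 z"] that by auto
    then have "\<Phi> (\<Psi> z) = x 0 + ((y1 z / 2) *\<^sub>R a + (y2 z / 3) *\<^sub>R b)"
      by (simp add: \<Phi>_def \<Psi>_nth)
    also have "(y1 z / 2) *\<^sub>R a + (y2 z / 3) *\<^sub>R b = z - x 0"
      using det2_Cramer[of a b "z - x 0"] d by (simp add: y1_def y2_def d_def)
    finally show ?thesis by simp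
  qed
  have inv2: "\<Psi> (\<Phi> y) = y" if "y \<in> ?V" for y
    using n(3)[of "y $ 1"] that by (simp add: vec_eq_iff forall_2 \<Psi>_nth y\<Phi>)
  let ?c = "({p \<in> dom_of c. coord c p \<in> ?U}, \<lambda>p. \<Psi> (coord c p))"
  have lc: "local_coordinates A ?c"
    by (rule local_coordinates_change[OF c opU opV s\<Psi> _ s\<Phi>]) (use inv1 inv2 in \<open>auto simp: \<Psi>_nth y\<Phi>\<close>)
  define \<zeta> where "\<zeta> = min \<eta> (sqrt n)"
  have \<zeta>: "\<zeta> > 0" "{-\<zeta><..<\<zeta>} \<subseteq> ?N" using \<eta> n by (auto simp: \<zeta>_def)
  have std: "\<gamma> (h s) \<in> dom_of ?c \<and> coord ?c (\<gamma> (h s)) = vector [s^2, s^3]" if s: "s \<in> {-\<zeta><..<\<zeta>}" for s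
  proof -
    have sN: "s \<in> ?N" using s \<zeta>(2) by blast
    have hs: "h s \<in> ?K" "h s \<in> ?J" "h s \<in> {-e1<..<e1}" using hK(1)[OF sN] KJ e2(2) by blast+
    have y1: "y1 (x (h s)) = s\<^sup>2" using \<sigma>2[OF hs(3)] hK(2)[OF sN] by simp
    have "\<bar>s\<bar> < sqrt n" using s by (auto simp: \<zeta>_def)
    then have "s\<^sup>2 < n" using real_less_lsqrt real_sqrt_abs by (metis real_sqrt_less_iff)
    moreover have "- n < s\<^sup>2" by (rule less_le_trans[of _ 0]) (use n(1) in auto)
    ultimately have sX: "s\<^sup>2 \<in> ?X" by simp
    have "y2 (x (h s)) = s ^ 3 * (\<kappa> s ^ 3 * v (h s))"
      using v(2)[OF hs(2)] \<kappa>(2)[OF sN] by (simp add: power_mult_distrib)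
    also have "\<dots> = s ^ 3 * p (s\<^sup>2) + (s\<^sup>2)\<^sup>2 * q (s\<^sup>2)"
      unfolding pq[OF sN] by (simp add: algebra_simps eval_nat_numeral)
    finally have "(y2 (x (h s)) - (s\<^sup>2)\<^sup>2 * q (s\<^sup>2)) / p (s\<^sup>2) = s ^ 3" using n(3)[OF sX] by simp
    then have "\<Psi> (x (h s)) = vector [s^2, s^3]" by (simp add: \<Psi>_def y1 vector2_eq)
    moreover have "\<gamma> (h s) \<in> dom_of c" using \<epsilon>(2) hs(2) by blast
    moreover have "x (h s) \<in> ?U" using y1 sX by simp
    ultimately show ?thesis by (simp add: x_def)
  qed
  have "smooth_diffeo {-\<zeta><..<\<zeta>} (h ` {-\<zeta><..<\<zeta>}) h"
    by (rule smooth_diffeo_restrict[OF h(1) s\<sigma>2 h(3)]) (use \<zeta>(2) \<eta>(2) in auto)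
  moreover have "h ` {-\<zeta><..<\<zeta>} \<subseteq> I"
  proof
    fix t assume "t \<in> h ` {-\<zeta><..<\<zeta>}"
    then have "t \<in> ?J" using hK(1) \<zeta>(2) KJ by blast
    then show "t \<in> I" using \<epsilon>(2) by blast
  qed
  ultimately show ?thesis
    unfolding has_cusp_at_0_def using lc \<zeta>(1) h0 std by blast
qed


section \<open>Prescribing the normalized curvature\<close>

context equiaffine
begin

lemma smooth_curve_param:
  assumes c: "c \<in> A" and I: "open I" and x: "smooth_on I x" "\<And>t. t \<in> I \<Longrightarrow> x t \<in> coord c ` dom_of c"
  shows "smooth_curve A I (\<lambda>t. param c (x t))"
  unfolding smooth_curve_def
proof (intro conjI ballI)
  show cont: "continuous_on I (\<lambda>t. param c (x t))"
    by (rule continuous_on_compose2[OF homeomorphism_cont2[OF chart_homeomorphism[OF is_chart[OF c]]] smooth_on_continuous[OF x(1)]])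
       (use x(2) in auto)
  fix c' assume c': "c' \<in> A"
  let ?T = "{t \<in> I. param c (x t) \<in> dom_of c'}"
  have "open (I \<inter> (\<lambda>t. param c (x t)) -` dom_of c')"
    using cont I open_dom[OF c'] by (simp add: continuous_on_open_vimage Int_commute)
  also have "I \<inter> (\<lambda>t. param c (x t)) -` dom_of c' = ?T" by blast
  finally have T: "open ?T" .
  have "smooth_on ?T (\<lambda>t. transition c c' (x t))"
  proof (rule smooth_on_compose[OF smooth_transition[OF c c'] smooth_on_subset[OF x(1)]])
    show "x ` ?T \<subseteq> coord c ` (dom_of c \<inter> dom_of c')"
    proof
      fix y assume "y \<in> x ` ?T"
      then obtain t where t: "t \<in> I" "param c (x t) \<in> dom_of c'" "y = x t" by blast
      obtain q where "q \<in> dom_of c" "x t = coord c q" using x(2)[OF t(1)] by blast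
      then show "y \<in> coord c ` (dom_of c \<inter> dom_of c')" using t c by simp
    qed
  qed (use T open_image[OF c open_dom[OF c']] in auto)
  then show "smooth_on ?T (coord c' \<circ> (\<lambda>t. param c (x t)))" by (simp add: o_def)
qed

definition chr2 :: "'m chart \<Rightarrow> real^2 \<Rightarrow> real^2 \<Rightarrow> real^2 \<Rightarrow> real^2" where
  "chr2 c x u v = (\<Sum>j\<in>UNIV. v $ j *\<^sub>R (\<Sum>i\<in>UNIV. u $ i *\<^sub>R chr c i j x))"

lemma chr2_scale: "chr2 c x (k *\<^sub>R u) v = k *\<^sub>R chr2 c x u v"
  by (simp add: chr2_def scaleR_sum_right mult.left_commute)

lemma smooth_on_chr2:
  fixes x u v :: "'a::real_normed_vector \<Rightarrow> real^2"
  assumes c: "c \<in> A" and S: "open S" and x: "smooth_on S x" "\<And>z. z \<in> S \<Longrightarrow> x z \<in> coord c ` dom_of c"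
    and uv: "smooth_on S u" "smooth_on S v"
  shows "smooth_on S (\<lambda>z. chr2 c (x z) (u z) (v z))"
proof -
  have "smooth_on S (\<lambda>z. chr c i j (x z))" for i j
    by (rule smooth_on_compose[OF smooth_chr[OF c] x(1)]) (use x(2) S open_coord_dom[OF c] in auto)
  then show ?thesis
    unfolding chr2_def by (intro smooth_on_sum smooth_on_scaleR smooth_on_nth S uv)
qed

text \<open>In a chart the equations \<open>\<gamma>' = t W\<close>, \<open>W' = W\<^sub>1\<close>, \<open>W\<^sub>1' = \<alpha> W\<close>, with covariant derivatives of \<open>W\<close> and \<open>W\<^sub>1\<close>, are an
  ordinary differential equation for \<open>\<gamma>\<close>, \<open>W\<close> and \<open>W\<^sub>1\<close>.\<close>

lemma ex_curve_with_frame: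
  assumes \<alpha>: "smooth_on {-r<..<r} \<alpha>" and r: "r > 0" and c: "c \<in> A" and p: "p \<in> dom_of c"
  obtains \<gamma> \<delta> w w1 where "0 < \<delta>" "\<delta> \<le> r" "smooth_curve A {-\<delta><..<\<delta>} \<gamma>"
    "\<And>t. t \<in> {-\<delta><..<\<delta>} \<Longrightarrow> \<gamma> t \<in> dom_of c"
    "smooth_on {-\<delta><..<\<delta>} w" "smooth_on {-\<delta><..<\<delta>} w1" "\<gamma> 0 = p" "w 0 = a" "w1 0 = b"
    "\<And>t. t \<in> {-\<delta><..<\<delta>} \<Longrightarrow> velocity A \<gamma> t c = t *\<^sub>R w t"
    "\<And>t. t \<in> {-\<delta><..<\<delta>} \<Longrightarrow> vderiv w t = w1 t - t *\<^sub>R chr2 c (coord c (\<gamma> t)) (w t) (w t)"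
    "\<And>t. t \<in> {-\<delta><..<\<delta>} \<Longrightarrow> vderiv w1 t = \<alpha> t *\<^sub>R w t - t *\<^sub>R chr2 c (coord c (\<gamma> t)) (w t) (w1 t)"
proof -
  define S where "S = {-r<..<r} \<times> (coord c ` dom_of c \<times> (UNIV :: ((real^2) \<times> (real^2)) set))"
  have S: "open S" unfolding S_def by (intro open_Times open_coord_dom c open_greaterThanLessThan open_UNIV)
  let ?t = "\<lambda>z :: real \<times> (real^2) \<times> (real^2) \<times> (real^2). fst z" and ?x = "\<lambda>z :: real \<times> (real^2) \<times> (real^2) \<times> (real^2). fst (snd z)"
    and ?w = "\<lambda>z :: real \<times> (real^2) \<times> (real^2) \<times> (real^2). fst (snd (snd z))"
    and ?w1 = "\<lambda>z :: real \<times> (real^2) \<times> (real^2) \<times> (real^2). snd (snd (snd z))"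
  define F where "F z = (?t z *\<^sub>R ?w z, ?w1 z - ?t z *\<^sub>R chr2 c (?x z) (?w z) (?w z),
     \<alpha> (?t z) *\<^sub>R ?w z - ?t z *\<^sub>R chr2 c (?x z) (?w z) (?w1 z))" for z
  have s: "smooth_on S ?t" "smooth_on S ?x" "smooth_on S ?w" "smooth_on S ?w1"
    by (intro smooth_on_fst smooth_on_snd smooth_on_id S)+
  have s\<alpha>: "smooth_on S (\<lambda>z. \<alpha> (?t z))"
    by (rule smooth_on_compose[OF \<alpha> s(1)]) (use S in \<open>auto simp: S_def\<close>)
  have sF: "smooth_on S F"
    unfolding F_def
    by (intro smooth_on_Pair smooth_on_diff smooth_on_scaleR S s s\<alpha> smooth_on_chr2 c) (auto simp: S_def)
  have "(0, coord c p, a, b) \<in> S" using r p by (auto simp: S_def)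
  from smooth_ode_solution[OF sF S this] obtain \<delta> z where \<delta>: "\<delta> > 0" and z0: "z 0 = (coord c p, a, b)"
    and sz: "smooth_on {-\<delta><..<\<delta>} z" and zS: "\<And>t. t \<in> {-\<delta><..<\<delta>} \<Longrightarrow> (t, z t) \<in> S"
    and dz: "\<And>t. t \<in> {-\<delta><..<\<delta>} \<Longrightarrow> (z has_vector_derivative F (t, z t)) (at t)" by blast
  let ?I = "{-\<delta><..<\<delta>}"
  define x where "x t = fst (z t)" for t
  define w where "w t = fst (snd (z t))" for t
  define w1 where "w1 t = snd (snd (z t))" for t
  define \<gamma> where "\<gamma> t = param c (x t)" for t
  have smooth: "smooth_on ?I x" "smooth_on ?I w" "smooth_on ?I w1"
    unfolding x_def w_def w1_def by (intro smooth_on_fst smooth_on_snd sz open_greaterThanLessThan)+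
  have xc: "x t \<in> coord c ` dom_of c" if "t \<in> ?I" for t using zS[OF that] by (simp add: S_def x_def mem_Times_iff)
  have \<gamma>c: "\<gamma> t \<in> dom_of c" "coord c (\<gamma> t) = x t" if "t \<in> ?I" for t
    using xc[OF that] c by (auto simp: \<gamma>_def)
  have bl: "bounded_linear (\<lambda>z :: (real^2) \<times> (real^2) \<times> (real^2). fst z)"
    "bounded_linear (\<lambda>z :: (real^2) \<times> (real^2) \<times> (real^2). fst (snd z))"
    "bounded_linear (\<lambda>z :: (real^2) \<times> (real^2) \<times> (real^2). snd (snd z))"
    by (auto intro!: bounded_linear_intros)
  have dx: "(x has_vector_derivative t *\<^sub>R w t) (at t)" if "t \<in> ?I" for t
    using bounded_linear.has_vector_derivative[OF bl(1) dz[OF that]]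
    by (simp add: x_def[abs_def] w_def F_def)
  have dw: "(w has_vector_derivative w1 t - t *\<^sub>R chr2 c (coord c (\<gamma> t)) (w t) (w t)) (at t)" if "t \<in> ?I" for t
    using bounded_linear.has_vector_derivative[OF bl(2) dz[OF that]]
    by (simp add: \<gamma>c(2)[OF that] x_def w_def[abs_def] w1_def F_def)
  have dw1: "(w1 has_vector_derivative \<alpha> t *\<^sub>R w t - t *\<^sub>R chr2 c (coord c (\<gamma> t)) (w t) (w1 t)) (at t)" if "t \<in> ?I" for t
    using bounded_linear.has_vector_derivative[OF bl(3) dz[OF that]]
    by (simp add: \<gamma>c(2)[OF that] x_def w_def w1_def[abs_def] F_def)
  have "\<delta> \<le> r"
  proof (rule ccontr)
    assume "\<not> \<delta> \<le> r"
    then show False using zS[of r] r by (simp add: S_def)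
  qed
  moreover have "smooth_curve A ?I \<gamma>"
    unfolding \<gamma>_def by (rule smooth_curve_param[OF c _ smooth(1) xc]) auto
  moreover have "velocity A \<gamma> t c = t *\<^sub>R w t" if t: "t \<in> ?I" for t
  proof -
    have "((coord c \<circ> \<gamma>) has_vector_derivative t *\<^sub>R w t) (at t)"
      by (rule has_vector_derivative_transform_within_open[OF dx[OF t], where S = ?I])
         (use t \<gamma>c(2) in auto)
    then show ?thesis using \<gamma>c(1)[OF t] c by (simp add: velocity_def vector_derivative_at)
  qed
  moreover have "\<gamma> 0 = p" using c p by (simp add: \<gamma>_def x_def z0)
  moreover have "w 0 = a" "w1 0 = b" by (simp_all add: w_def w1_def z0)
  ultimately show ?thesis
    using that[OF \<delta>] \<gamma>c(1) smooth(2,3) vderiv_eq[OF dw] vderiv_eq[OF dw1] by blast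
qed

text \<open>If \<open>W'' = \<alpha> W\<close>, then \<open>g' = [W, W''] = 0\<close> and \<open>h = [W', W''] = - \<alpha> g\<close>. So the constant \<open>g\<close> can be chosen such that
  the parameter is the 3/5-arclength, and \<open>\<alpha>\<close> such that the curvature is the given one.\<close>

lemma ex_cusp_with_curvature:
  fixes f :: "real \<Rightarrow> real"
  assumes r: "r > 0" and f: "smooth_on {-r<..<r} f" "f 0 = 4/25" "(f has_real_derivative 0) (at 0)"
  shows "\<exists>(\<gamma> :: real \<Rightarrow> 'm) \<delta>. 0 < \<delta> \<and> \<delta> \<le> r \<and>
           smooth_curve A {-\<delta><..<\<delta>} \<gamma> \<and> has_cusp_at_0 A {-\<delta><..<\<delta>} \<gamma> \<and>
           (\<forall>t\<in>{-\<delta><..<\<delta>} - {0}. bracket A D \<Omega> \<gamma> 1 2 t \<noteq> 0) \<and>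
           (\<forall>t\<in>{-\<delta><..<\<delta>}. arclength_3_5 A D \<Omega> \<gamma> t = t) \<and>
           (\<forall>t\<in>{-\<delta><..<\<delta>} - {0}. normalized_curvature A D \<Omega> \<gamma> t = f t)"
proof -
  let ?R = "{-r<..<r}"
  have "smooth_on ?R (\<lambda>t. f t - 4/25)" by (intro smooth_intros f) auto
  moreover have "vderiv (\<lambda>t. f t - 4/25) 0 = 0"
    by (rule vderiv_eq, unfold has_real_derivative_iff_has_vector_derivative[symmetric])
       (use f(3) in \<open>auto intro!: derivative_eq_intros\<close>)
  ultimately obtain f1 where f1: "smooth_on ?R f1" "\<And>t. t \<in> ?R \<Longrightarrow> f t - 4/25 = t * f1 t" "f1 0 = 0"
    using Hadamard[of r "\<lambda>t. f t - 4/25"] f(2) r by auto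
  obtain k where k: "smooth_on ?R k" "\<And>t. t \<in> ?R \<Longrightarrow> f1 t = t * k t"
    using Hadamard[OF f1(1,3)] by auto
  have f_eq: "f t = 4/25 + t\<^sup>2 * k t" if "t \<in> ?R" for t
    using f1(2)[OF that] k(2)[OF that] by (simp add: power2_eq_square algebra_simps)
  \<comment> \<open>For constant \<open>g = (5/3)\<^sup>3\<close> the arclength is \<open>\<plusminus>|t|\<^bsup>5/3\<^esup>\<close>, so \<open>t\<close> is the 3/5-arclength; then
    \<open>f = 4/25 + t\<^sup>2 h / (5/3)\<^sup>5\<close>, which determines \<open>h = - \<alpha> g\<close>.\<close>
  define \<alpha> where "\<alpha> t = - (25/9) * k t" for t
  have s\<alpha>: "smooth_on ?R \<alpha>" unfolding \<alpha>_def by (intro smooth_intros k) auto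
  \<comment> \<open>Any point of the manifold will do.\<close>
  obtain c where c: "c \<in> A" and p: "undefined \<in> dom_of c" using ex_chart by blast
  define p :: 'm where "p = undefined"
  have \<omega>: "\<omega> c (coord c p) > 0" using \<omega>_pos[OF c] p by (simp add: p_def)
  let ?b = "(125 / 27 / \<omega> c (coord c p)) *\<^sub>R axis 2 1 :: real^2"
  obtain \<gamma> \<delta> w w1 where \<delta>: "0 < \<delta>" "\<delta> \<le> r" and \<gamma>: "smooth_curve A {-\<delta><..<\<delta>} \<gamma>"
    "\<And>t. t \<in> {-\<delta><..<\<delta>} \<Longrightarrow> \<gamma> t \<in> dom_of c"
    and w: "smooth_on {-\<delta><..<\<delta>} w" and w1: "smooth_on {-\<delta><..<\<delta>} w1"
    and init: "\<gamma> 0 = p" "w 0 = axis 1 1" "w1 0 = ?b"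
    and vel: "\<And>t. t \<in> {-\<delta><..<\<delta>} \<Longrightarrow> velocity A \<gamma> t c = t *\<^sub>R w t"
    and dw: "\<And>t. t \<in> {-\<delta><..<\<delta>} \<Longrightarrow> vderiv w t = w1 t - t *\<^sub>R chr2 c (coord c (\<gamma> t)) (w t) (w t)"
    and dw1: "\<And>t. t \<in> {-\<delta><..<\<delta>} \<Longrightarrow> vderiv w1 t = \<alpha> t *\<^sub>R w t - t *\<^sub>R chr2 c (coord c (\<gamma> t)) (w t) (w1 t)"
    using ex_curve_with_frame[OF s\<alpha> r c, of p "axis 1 1" ?b] p p_def by metis
  let ?I = "{-\<delta><..<\<delta>}"
  interpret curve_along A D \<Omega> \<gamma> ?I by unfold_locales (use \<gamma>(1) in auto)
  have I0: "0 \<in> ?I" using \<delta> by simp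
  have tc: "t \<in> dom_times c" if "t \<in> ?I" for t using that \<gamma>(2) by simp
  have det: "det2 (w 0) (vderiv w 0) \<noteq> 0"
    using \<omega> by (simp add: dw[OF I0] init det2_def axis_def)
  define W where "W t = tvec c (\<gamma> t) (w t)" for t
  define W1 where "W1 t = tvec c (\<gamma> t) (w1 t)" for t
  have fW: "field W" and velW: "\<And>t. t \<in> ?I \<Longrightarrow> velocity A \<gamma> t = (\<lambda>c. t *\<^sub>R W t c)"
  proof -
    note C = cusp_germ_of_field[OF c \<gamma>(2) I0 w, folded W_def]
    show "field W" by (rule C(1)) (use vel det in auto)
    show "velocity A \<gamma> t = (\<lambda>c. t *\<^sub>R W t c)" if "t \<in> ?I" for t by (rule C(2)) (use vel det that in auto)
  qed
  have fW1: "field W1" unfolding W1_def by (rule field_tvec[OF c \<gamma>(2) w1])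
  have Wc: "W t c = w t" "W1 t c = w1 t" if "t \<in> ?I" for t
    using \<gamma>(2)[OF that] c by (simp_all add: W_def W1_def tvec_self)
  have cov_c: "cov V t c = vderiv (\<lambda>u. V u c) t + t *\<^sub>R chr2 c (coord c (\<gamma> t)) (w t) (V t c)" if t: "t \<in> ?I" for V t
  proof -
    have "cov V t c = vderiv (\<lambda>u. V u c) t + chr2 c (coord c (\<gamma> t)) (vel t c) (V t c)"
      unfolding cov_self[OF c tc[OF t]] chr2_def
      by (simp add: D_coord_field[OF c \<gamma>(2)[OF t] vel_tangent[OF t]])
    then show ?thesis by (simp add: vel[OF t] chr2_scale)
  qed
  have covW: "cov W t = W1 t" if t: "t \<in> ?I" for t
  proof (rule tangent_eqI[OF cov_tangent[OF fW t] fieldD[OF fW1 t] c \<gamma>(2)[OF t]])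
    have "vderiv (\<lambda>u. W u c) t = vderiv w t"
      by (rule vderiv_cong_open[OF open_I t]) (simp add: Wc)
    then show "cov W t c = W1 t c" by (simp add: cov_c[OF t] Wc[OF t] dw[OF t])
  qed
  have covcovW: "cov (cov W) t c = \<alpha> t *\<^sub>R w t" if t: "t \<in> ?I" for t
  proof -
    have "cov (cov W) t c = cov W1 t c" using cov_cong[OF covW t] by simp
    moreover have "vderiv (\<lambda>u. W1 u c) t = vderiv w1 t"
      by (rule vderiv_cong_open[OF open_I t]) (simp add: Wc)
    ultimately show ?thesis by (simp add: cov_c[OF t] Wc[OF t] dw1[OF t])
  qed
  note f1W = field_cov[OF fW] and f2W = field_cov[OF field_cov[OF fW]]
  let ?g = "br W (cov W)" and ?h = "br (cov W) (cov (cov W))"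
  have g': "vderiv ?g t = 0" if t: "t \<in> ?I" for t
    using vderiv_br[OF fW f1W t] br_self[OF f1W t]
    by (simp add: br_eq[OF fW f2W c tc[OF t]] covcovW[OF t] Wc[OF t] det2_def)
  have g: "?g t = 125/27" if t: "t \<in> ?I" for t
  proof -
    have "?g t = ?g 0"
    proof (rule has_field_derivative_zero_constant[of ?I ?g, THEN exE])
      show "(?g has_real_derivative 0) (at t within ?I)" if "t \<in> ?I" for t
        using has_real_derivative_vderiv[OF smooth_br[OF fW f1W] that] g'[OF that]
        by (simp add: has_field_derivative_at_within)
      fix k assume "\<forall>x\<in>?I. ?g x = k"
      then show "?g t = ?g 0" using t I0 by simp
    qed simp
    also have "?g 0 = 125/27"
      using \<omega> by (simp add: br_eq[OF fW f1W c tc[OF I0]] covW[OF I0] Wc[OF I0] init det2_def axis_def)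
    finally show ?thesis .
  qed
  have h: "?h t = (5/3) ^ 5 * k t" if t: "t \<in> ?I" for t
  proof -
    have "?h t = - \<alpha> t * ?g t"
      by (simp add: br_eq[OF fW f1W c tc[OF t]] br_eq[OF f1W f2W c tc[OF t]] covcovW[OF t] covW[OF t]
          Wc[OF t] det2_def algebra_simps)
    then show ?thesis by (simp add: g[OF t] \<alpha>_def power_divide)
  qed
  have \<sigma>: "1 * ?g t > 0" if "t \<in> ?I" for t using g[OF that] by simp
  note inv = cusp_germ_invariants[OF \<delta>(1) subset_refl fW velW disjI1[OF refl] \<sigma>]
  interpret germ: cusp_germ \<delta> 1 ?g ?h by (rule inv(1))
  have \<phi>: "germ.\<phi> t = 5/3" if "t \<in> ?I" for t
  proof -
    have "germ.\<phi> t ^ 3 = (5/3) ^ 3" using germ.g_eq[OF that] g[OF that] by (simp add: power_divide)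
    then show ?thesis
      by (rule power_eq_imp_eq_base) (use germ.\<phi>_pos[OF that] in \<open>simp_all add: less_imp_le\<close>)
  qed
  have q: "germ.q t = 1" if t: "t \<in> ?I" for t
  proof -
    have "germ.q t = germ.q 0"
      unfolding germ.q_def
      by (rule integral_cong) (use germ.scaled_in_I[OF t] germ.scaled_in_I[OF I0] in \<open>simp add: \<phi>\<close>)
    then show ?thesis using germ.q_jet(1) \<phi>[OF I0] by simp
  qed
  have "arclength_3_5 A D \<Omega> \<gamma> t = t" if "t \<in> ?I" for t
    using inv(3)[OF _ _ that] that by (simp add: germ.\<tau>_def q)
  moreover have "normalized_curvature A D \<Omega> \<gamma> t = f t" if t: "t \<in> ?I - {0}" for t
  proof -
    have tI: "t \<in> ?I" using t by simp
    have g'': "vderiv (vderiv ?g) t = 0"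
    proof -
      have "vderiv (vderiv ?g) t = vderiv (\<lambda>_. 0) t"
        by (rule vderiv_cong_open[OF open_I tI]) (rule g')
      also have "\<dots> = 0" by (rule vderiv_eq) (auto intro!: derivative_eq_intros)
      finally show ?thesis .
    qed
    have "f t = 4/25 + t\<^sup>2 * k t" by (rule f_eq) (use tI \<delta> in auto)
    also have "\<dots> = germ.F t"
      unfolding germ.F_def q[OF tI] \<phi>[OF tI] g'[OF tI] g'' g[OF tI] h[OF tI]
      by (simp add: field_simps power_divide)
    also have "\<dots> = normalized_curvature A D \<Omega> \<gamma> t" using inv(4)[OF _ _ t] by simp
    finally show ?thesis by simp
  qed
  moreover have "has_cusp_at_0 A ?I \<gamma>"
    by (rule has_cuspI[OF c \<delta>(1) _ w vel det]) (use tc in auto)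
  moreover have "bracket A D \<Omega> \<gamma> 1 2 t \<noteq> 0" if "t \<in> ?I - {0}" for t using inv(5)[OF _ _ that] by blast
  ultimately show ?thesis using \<delta> \<gamma>(1) by blast
qed

end

theorem theorem3p8:
  fixes A :: "'m::{t2_space,second_countable_topology} chart set"
    and D :: "'m connection"
    and \<Omega> :: "'m form2"
  assumes "equiaffine_2_manifold A D \<Omega>"
  shows
    "(\<forall>(\<gamma> :: real \<Rightarrow> 'm) \<delta>::real.
        \<delta> > 0 \<longrightarrow> smooth_curve A {-\<delta><..<\<delta>} \<gamma> \<longrightarrow> has_cusp_at_0 A {-\<delta><..<\<delta>} \<gamma> \<longrightarrow>
        (\<exists>\<epsilon>>0. \<epsilon> \<le> \<delta> \<and>
           (let I = {-\<epsilon><..<\<epsilon>}; \<tau> = arclength_3_5 A D \<Omega> \<gamma>;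
                f = normalized_curvature A D \<Omega> \<gamma>
            in
              (\<forall>t\<in>I - {0}. bracket A D \<Omega> \<gamma> 1 2 t \<noteq> 0) \<and>
              \<tau> 0 = 0 \<and> smooth_diffeo I (\<tau> ` I) \<tau> \<and>
              (\<exists>F. smooth_on I F \<and> (\<forall>t\<in>I - {0}. F t = f t) \<and>
                   F 0 = 4/25 \<and> (F has_real_derivative 0) (at 0)) \<and>
              (\<exists>G. smooth_on (\<tau> ` I) G \<and> (\<forall>t\<in>I - {0}. G (\<tau> t) = f t) \<and>
                   G 0 = 4/25 \<and> (G has_real_derivative 0) (at 0)) \<and>
              ((\<lambda>t. (f t - 4/25) / (\<tau> t)^2) \<longlongrightarrow>
                 1/220 * root 5 (20/3) * cuspidal_curvature A D \<Omega> \<gamma>) (at 0)))) \<and>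
     (\<forall>(f :: real \<Rightarrow> real) r::real.
        r > 0 \<longrightarrow> smooth_on {-r<..<r} f \<longrightarrow> f 0 = 4/25 \<longrightarrow> (f has_real_derivative 0) (at 0) \<longrightarrow>
        (\<exists>(\<gamma> :: real \<Rightarrow> 'm) \<delta>. 0 < \<delta> \<and> \<delta> \<le> r \<and>
           smooth_curve A {-\<delta><..<\<delta>} \<gamma> \<and> has_cusp_at_0 A {-\<delta><..<\<delta>} \<gamma> \<and>
           (\<forall>t\<in>{-\<delta><..<\<delta>} - {0}. bracket A D \<Omega> \<gamma> 1 2 t \<noteq> 0) \<and>
           (\<forall>t\<in>{-\<delta><..<\<delta>}. arclength_3_5 A D \<Omega> \<gamma> t = t) \<and>
           (\<forall>t\<in>{-\<delta><..<\<delta>} - {0}. normalized_curvature A D \<Omega> \<gamma> t = f t)))"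
proof (intro conjI allI impI, goal_cases)
  case (1 \<gamma> \<delta>)
  interpret curve_along A D \<Omega> \<gamma> "{-\<delta><..<\<delta>}" by unfold_locales (use assms 1 in auto)
  show ?case by (rule cusp_theorem[OF refl 1(1,3)])
next
  case (2 f r)
  interpret equiaffine A D \<Omega> by unfold_locales (rule assms)
  show ?case using 2 by (rule ex_cusp_with_curvature)
qed

end
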